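(* Let $F\in\mathcal F$ with $F=O(|\mathbf x|^{-3-\epsilon})$ as $|\mathbf x|\to+\infty$ for some $\epsilon>0$, and let $s_1,s_2>0$. Let $I_{\alpha,\beta}$ denote the analytic continuation, near $(\alpha,\beta)=(0,0)\in\mathbb C^2$, of $\int d^3\mathbf x\,\bigl(\tfrac{r_1}{s_1}\bigr)^\alpha\bigl(\tfrac{r_2}{s_2}\bigr)^\beta F$. Then $$\mathrm{Pf}_{s_1,s_2}\int d^3\mathbf x\,F=\mathop{\mathrm{FP}}_{\beta\to0}\Bigl\{\mathop{\mathrm{FP}}_{\alpha\to0}I_{\alpha,\beta}\Bigr\}=\mathop{\mathrm{FP}}_{\alpha\to0}\Bigl\{\mathop{\mathrm{FP}}_{\beta\to0}I_{\alpha,\beta}\Bigr\}.$$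
   Context: Fix two distinct points $\mathbf y_1,\mathbf y_2\in\mathbb R^3$. For $\mathbf x\in\mathbb R^3$ put $r_1=|\mathbf x-\mathbf y_1|$, $\mathbf n_1=(\mathbf x-\mathbf y_1)/r_1$, $r_2=|\mathbf x-\mathbf y_2|$, $\mathbf n_2=(\mathbf x-\mathbf y_2)/r_2$; $d\Omega_1$, $d\Omega_2$ are the solid angle elements of $\mathbf n_1$, $\mathbf n_2$. Class $\mathcal F$: real functions $F$, smooth on $\mathbb R^3\setminus\{\mathbf y_1,\mathbf y_2\}$, for which there are real exponents $a_0<a_1<a_2<\cdots$ (only finitely many below any bound) and functions ${}_1f_{a}$ on the unit sphere such that for all $N\in\mathbb N$, $F=\sum_{a\le N}r_1^{a}\,{}_1f_{a}(\mathbf n_1)+o(r_1^N)$ as $r_1\to0$ (uniformly in $\mathbf n_1$); and similarly at $\mathbf y_2$ with exponents $b_0<b_1<\cdots$ and coefficients ${}_2f_b(\mathbf n_2)$. Put ${}_1f_a=0$ if $a$ is not one of the exponents (same for 2). Partie finie of an integral: with $\mathcal B_{1}(s),\mathcal B_2(s)$ the closed balls of radius $s$ centred at $\mathbf y_{1},\mathbf y_2$, $$\mathrm{Pf}_{s_1,s_2}\int d^3\mathbf x\,F=\lim_{s\to0}\Bigl\{\int_{\mathbb R^3\setminus\mathcal B_1(s)\cup\mathcal B_2(s)}d^3\mathbf x\,F+\sum_{a+3<0}\frac{s^{a+3}}{a+3}\int d\Omega_1\,{}_1f_a+\ln\Bigl(\frac s{s_1}\Bigr)\int d\Omega_1\,{}_1f_{-3}+\sum_{b+3<0}\frac{s^{b+3}}{b+3}\int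 d\Omega_2\,{}_2f_b+\ln\Bigl(\frac s{s_2}\Bigr)\int d\Omega_2\,{}_2f_{-3}\Bigr\}.$$ Analytic continuation: $I_{\alpha,\beta}={}_1I_{\alpha,\beta}+{}_2I_{\alpha,\beta}+{}_3I_{\alpha,\beta}$, the integrals of $(r_1/s_1)^\alpha(r_2/s_2)^\beta F$ over $\mathcal B_1(s)$, $\mathcal B_2(s)$ and $\mathbb R^3\setminus\mathcal B_1(s)\cup\mathcal B_2(s)$ respectively (any small fixed $s>0$ with disjoint balls). ${}_1I$ converges for $\Re\alpha>-a_0-3$ and all $\beta$, ${}_2I$ for $\Re\beta>-b_0-3$ and all $\alpha$, ${}_3I$ for $\Re(\alpha+\beta)<\epsilon$; each is continued analytically (meromorphically) to a neighbourhood of the origin, where ${}_1I$ has at most a simple pole in $\alpha$ at $\alpha=0$ and ${}_2I$ at most a simple pole in $\beta$ at $\beta=0$; the sum is independent of $s$. Finite part: $\mathrm{FP}_{\alpha\to0}$ denotes the coefficient of $\alpha^0$ in the Laurent expansion at $\alpha=0$ (with $\beta$ a fixed nonzero complex number near $0$ when it is taken first); likewise $\mathrm{FP}_{\beta\to0}$. The two finite parts are taken successively. *)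

theory Defs
  imports "HOL-Complex_Analysis.Complex_Analysis" "HOL-Library.Landau_Symbols"
begin

subsection \<open>Smooth functions and the class of singular functions\<close>

fun C_k_on :: "nat \<Rightarrow> ('a::real_normed_vector \<Rightarrow> 'b::real_normed_vector) \<Rightarrow> 'a set \<Rightarrow> bool" where
  "C_k_on 0 f S \<longleftrightarrow> continuous_on S f"
| "C_k_on (Suc k) f S \<longleftrightarrow>
     (\<forall>x\<in>S. f differentiable (at x)) \<and>
     (\<forall>v. C_k_on k (\<lambda>x. frechet_derivative f (at x) v) S)"

text \<open>Only meant for open \<open>S\<close>, since \<open>C_k_on\<close> uses derivatives at unrestricted points.\<close>

definition smooth_on :: "('a::real_normed_vector \<Rightarrow> 'b::real_normed_vector) \<Rightarrow> 'a set \<Rightarrow> bool" where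
  "smooth_on f S \<longleftrightarrow> (\<forall>k. C_k_on k f S)"

text \<open>
  The increasing sequence \<open>a\<close> lists the exponents and \<open>f c\<close> is the coefficient of \<open>r powr c\<close>, a
  function of the direction (only its values on the unit sphere matter), which is zero if \<open>c\<close> is
  not an exponent. The remainder is a little-o for \<open>x\<close> tending to \<open>y\<close> in space, i.e. it is uniform
  in the direction.
\<close>

definition singular_expansion ::
  "(real ^ 3 \<Rightarrow> real) \<Rightarrow> real ^ 3 \<Rightarrow> (nat \<Rightarrow> real) \<Rightarrow> (real \<Rightarrow> real ^ 3 \<Rightarrow> real) \<Rightarrow> bool" where
  "singular_expansion F y a f \<longleftrightarrow>
     strict_mono a \<and> filterlim a at_top sequentially \<and>
     (\<forall>c n. c \<notin> range a \<longrightarrow> norm n = 1 \<longrightarrow> f c n = 0) \<and>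
     (\<forall>N::nat.
        (\<lambda>x. F x - (\<Sum>c\<in>{c \<in> range a. c \<le> real N}.
                      norm (x - y) powr c * f c ((x - y) /\<^sub>R norm (x - y))))
          \<in> o[at y](\<lambda>x. norm (x - y) ^ N))"

definition class_F ::
  "real ^ 3 \<Rightarrow> real ^ 3 \<Rightarrow> (nat \<Rightarrow> real) \<Rightarrow> (real \<Rightarrow> real ^ 3 \<Rightarrow> real) \<Rightarrow>
   (nat \<Rightarrow> real) \<Rightarrow> (real \<Rightarrow> real ^ 3 \<Rightarrow> real) \<Rightarrow> (real ^ 3 \<Rightarrow> real) \<Rightarrow> bool" where
  "class_F y1 y2 a f1 b f2 F \<longleftrightarrow>
     smooth_on F (- {y1, y2}) \<and> singular_expansion F y1 a f1 \<and> singular_expansion F y2 b f2"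


subsection \<open>Hadamard partie finie\<close>

text \<open>Integration over the unit sphere, with solid angle element \<open>sin \<theta> d\<theta> d\<phi>\<close>.\<close>

definition sphere_point :: "real \<times> real \<Rightarrow> real ^ 3" where
  "sphere_point = (\<lambda>(\<theta>, \<phi>). vector [sin \<theta> * cos \<phi>, sin \<theta> * sin \<phi>, cos \<theta>])"

definition solid_angle_integrable :: "(real ^ 3 \<Rightarrow> real) \<Rightarrow> bool" where
  "solid_angle_integrable g \<longleftrightarrow>
     set_integrable lborel ({0..pi} \<times> {0..2 * pi}) (\<lambda>p. sin (fst p) * g (sphere_point p))"

definition solid_angle_integral :: "(real ^ 3 \<Rightarrow> real) \<Rightarrow> real" where
  "solid_angle_integral g =
     set_lebesgue_integral lborel ({0..pi} \<times> {0..2 * pi}) (\<lambda>p. sin (fst p) * g (sphere_point p))"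

definition exterior :: "real ^ 3 \<Rightarrow> real ^ 3 \<Rightarrow> real \<Rightarrow> (real ^ 3) set" where
  "exterior y1 y2 s = - (cball y1 s \<union> cball y2 s)"

definition Pf_counterterm ::
  "(nat \<Rightarrow> real) \<Rightarrow> (real \<Rightarrow> real ^ 3 \<Rightarrow> real) \<Rightarrow> real \<Rightarrow> real \<Rightarrow> real" where
  "Pf_counterterm a f s0 s =
     (\<Sum>c\<in>{c \<in> range a. c + 3 < 0}. s powr (c + 3) / (c + 3) * solid_angle_integral (f c))
     + ln (s / s0) * solid_angle_integral (f (- 3))"

text \<open>The partie finie with length scales \<open>s1\<close>, \<open>s2\<close> exists (all integrals occurring in it
  converge absolutely and the limit exists) and equals \<open>L\<close>.\<close>

definition has_Pf_integral ::
  "real ^ 3 \<Rightarrow> real ^ 3 \<Rightarrow> (nat \<Rightarrow> real) \<Rightarrow> (real \<Rightarrow> real ^ 3 \<Rightarrow> real) \<Rightarrow>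
   (nat \<Rightarrow> real) \<Rightarrow> (real \<Rightarrow> real ^ 3 \<Rightarrow> real) \<Rightarrow> real \<Rightarrow> real \<Rightarrow>
   (real ^ 3 \<Rightarrow> real) \<Rightarrow> real \<Rightarrow> bool" where
  "has_Pf_integral y1 y2 a f1 b f2 s1 s2 F L \<longleftrightarrow>
     (\<forall>s>0. set_integrable lborel (exterior y1 y2 s) F) \<and>
     (\<forall>c. solid_angle_integrable (f1 c)) \<and> (\<forall>c. solid_angle_integrable (f2 c)) \<and>
     ((\<lambda>s. set_lebesgue_integral lborel (exterior y1 y2 s) F
           + Pf_counterterm a f1 s1 s + Pf_counterterm b f2 s2 s) \<longlongrightarrow> L) (at_right 0)"


subsection \<open>Analytic continuation in two complex variables\<close>

definition holomorphic2_on :: "(complex \<times> complex \<Rightarrow> complex) \<Rightarrow> (complex \<times> complex) set \<Rightarrow> bool" where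
  "holomorphic2_on f D \<longleftrightarrow>
     (\<forall>p\<in>D. \<exists>u v. (f has_derivative (\<lambda>(h, k). u * h + v * k)) (at p))"

text \<open>
  \<open>J\<close> is an analytic continuation of \<open>G\<close> from the region \<open>R\<close> to a neighbourhood of the origin, up
  to at most a simple pole there along the zero set of the coordinate function \<open>q\<close>: \<open>J\<close> is
  holomorphic on a connected open set \<open>D\<close> which contains \<open>R\<close> and the points near the origin where
  \<open>q\<close> does not vanish, and \<open>q * J\<close> extends holomorphically over the origin. Taking \<open>D\<close> to be any
  such set allows for further poles of \<open>J\<close> between \<open>R\<close> and the origin.
\<close>

definition continuation_near_0 ::
  "(complex \<times> complex \<Rightarrow> complex) \<Rightarrow> (complex \<times> complex) set \<Rightarrow> (complex \<times> complex \<Rightarrow> complex) \<Rightarrow>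
   (complex \<times> complex \<Rightarrow> complex) \<Rightarrow> bool" where
  "continuation_near_0 G R q J \<longleftrightarrow>
     (\<exists>D \<delta> H. open D \<and> connected D \<and> R \<subseteq> D \<and> holomorphic2_on J D \<and> (\<forall>p\<in>R. J p = G p) \<and>
        \<delta> > 0 \<and> {p \<in> ball 0 \<delta>. q p \<noteq> 0} \<subseteq> D \<and>
        holomorphic2_on H (ball 0 \<delta>) \<and> (\<forall>p\<in>ball 0 \<delta>. q p \<noteq> 0 \<longrightarrow> q p * J p = H p))"

definition regularized ::
  "real ^ 3 \<Rightarrow> real ^ 3 \<Rightarrow> real \<Rightarrow> real \<Rightarrow> (real ^ 3 \<Rightarrow> real) \<Rightarrow> complex \<times> complex \<Rightarrow> real ^ 3 \<Rightarrow> complex" where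
  "regularized y1 y2 s1 s2 F = (\<lambda>(\<alpha>, \<beta>) x.
     of_real (norm (x - y1) / s1) powr \<alpha> * of_real (norm (x - y2) / s2) powr \<beta> * of_real (F x))"

text \<open>
  \<open>J\<close> continues the integral over \<open>S\<close> of the regularized function, which converges absolutely
  for all exponents in \<open>R\<close>.
\<close>

definition continues_integral ::
  "(complex \<times> complex \<Rightarrow> real ^ 3 \<Rightarrow> complex) \<Rightarrow> (real ^ 3) set \<Rightarrow> (complex \<times> complex) set \<Rightarrow>
   (complex \<times> complex \<Rightarrow> complex) \<Rightarrow> (complex \<times> complex \<Rightarrow> complex) \<Rightarrow> bool" where
  "continues_integral g S R q J \<longleftrightarrow>
     (\<forall>p\<in>R. set_integrable lborel S (g p)) \<and>
     continuation_near_0 (\<lambda>p. set_lebesgue_integral lborel S (g p)) R q J"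

text \<open>
  \<open>I\<close> is the analytic continuation near the origin of the regularized integral over the whole
  space, obtained by cutting out balls of radius \<open>s\<close>; \<open>a0\<close>, \<open>b0\<close> are the lowest exponents at the
  two singular points and \<open>\<epsilon>\<close> is the decay parameter at infinity. The exterior integral converges
  near the origin, hence its continuation has no pole there.
\<close>

definition regularized_integral ::
  "real ^ 3 \<Rightarrow> real ^ 3 \<Rightarrow> real \<Rightarrow> real \<Rightarrow> real \<Rightarrow> real \<Rightarrow> real \<Rightarrow> (real ^ 3 \<Rightarrow> real) \<Rightarrow>
   real \<Rightarrow> (complex \<times> complex \<Rightarrow> complex) \<Rightarrow> bool" where
  "regularized_integral y1 y2 a0 b0 \<epsilon> s1 s2 F s I \<longleftrightarrow>
     (\<exists>J1 J2 J3.
        continues_integral (regularized y1 y2 s1 s2 F) (cball y1 s)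
          {(\<alpha>, \<beta>). Re \<alpha> > - a0 - 3} fst J1 \<and>
        continues_integral (regularized y1 y2 s1 s2 F) (cball y2 s)
          {(\<alpha>, \<beta>). Re \<beta> > - b0 - 3} snd J2 \<and>
        continues_integral (regularized y1 y2 s1 s2 F) (exterior y1 y2 s)
          {(\<alpha>, \<beta>). Re (\<alpha> + \<beta>) < \<epsilon>} (\<lambda>_. 1) J3 \<and>
        (\<forall>p. I p = J1 p + J2 p + J3 p))"


subsection \<open>Finite parts\<close>

text \<open>\<open>f\<close> has a Laurent expansion at \<open>0\<close>, with constant coefficient \<open>c\<close>.\<close>

definition has_FP :: "(complex \<Rightarrow> complex) \<Rightarrow> complex \<Rightarrow> bool" where
  "has_FP f c \<longleftrightarrow> (\<exists>L. f has_laurent_expansion L \<and> fls_nth L 0 = c)"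

text \<open>The outer variable of an iterated finite part is the first argument of \<open>f\<close>; the inner
  finite part is taken with that variable fixed, nonzero and near \<open>0\<close>.\<close>

definition has_iterated_FP :: "(complex \<Rightarrow> complex \<Rightarrow> complex) \<Rightarrow> complex \<Rightarrow> bool" where
  "has_iterated_FP f c \<longleftrightarrow> (\<exists>h. (\<forall>\<^sub>F w in at 0. has_FP (f w) (h w)) \<and> has_FP h c)"

end

theory Submission
  imports Defs
begin

text \<open>
  Near \<open>y1\<close> the factor \<open>(r2 / s2) powr \<beta>\<close> is expanded by the binomial series in a polynomial which
  vanishes at \<open>y1\<close>. Multiplied by the expansion of \<open>F\<close>, it gives a finite sum of terms
  \<open>e \<beta> * r1 powr c * g n1\<close> with \<open>e\<close> entire, up to a remainder of arbitrarily high order in \<open>r1\<close>.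
  Integrated over a ball in polar coordinates, each term gives a simple pole at \<open>\<alpha> = - c - 3\<close>, and the
  remainder is holomorphic in a large half-space: this is the analytic continuation of the first
  integral, and the identity theorem shows that there is no other one. Hence \<open>\<alpha> * J1\<close> is holomorphic
  near the origin, and likewise \<open>\<beta> * J2\<close> for the second ball. Both iterated finite parts of the sum
  are then \<open>\<partial>(\<alpha> * J1) / \<partial>\<alpha> + \<partial>(\<beta> * J2) / \<partial>\<beta> + J3\<close> at the origin. The first term is the finite part
  of \<open>J1\<close> on the line \<open>\<beta> = 0\<close>, where the expansion in \<open>\<beta>\<close> collapses, and its explicit value is the one
  that the ball contributes to the partie finie.
\<close>

subsection \<open>Polar coordinates\<close>

text \<open>Three obstacles shape the argument. The definition of a continuation admits any
  connected domain \<open>D\<close>, so the origin may be reached only along a path that goes far to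
  the left; the order of the expansion has to be chosen after that path, and the constants obtained
  must then be seen not to depend on the order. They do not, because for every order they are the
  limit of one and the same expression in the radius of a shrinking ball. Next, the coefficients of
  the expansions come without any regularity; that they are continuous, hence integrable over the
  sphere, is drawn from the continuity of \<open>F\<close> and the uniformity of the remainder.
  Finally, r2 is not a polynomial in x - y1, but its square is: (r2 / d)^2 - 1, with d the distance
  of the two points, has only terms of degree 1 and 2, and a power \<beta> of r2 / d is the power
  \<beta> / 2 of 1 plus this quantity. The two orders of finite parts agree because no product of
  poles 1 / (\<alpha> \<beta>) occurs: the first ball gives a pole in \<alpha> only, with
  coefficients holomorphic in \<beta>, and the second ball the reverse.\<close>

no_notation fps_nth (infixl \<open>$\<close> 75)

text \<open>Jacobians are computed on \<open>real ^ 3\<close>, where a derivative has a matrix and a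
  determinant, while the theorem of Fubini needs a product of measure spaces. This map passes from
  one description to the other.\<close>

definition triple_vec :: "real \<times> real \<times> real \<Rightarrow> real ^ 3" where
  "triple_vec = (\<lambda>(r, \<theta>, \<phi>). vector [r, \<theta>, \<phi>])"

lemma triple_vec_nth [simp]:
  "triple_vec q $ 1 = fst q" "triple_vec q $ 2 = fst (snd q)" "triple_vec q $ 3 = snd (snd q)"
  by (auto simp: triple_vec_def split: prod.splits)

lemma continuous_on_vec3:
  fixes f :: "'a::topological_space \<Rightarrow> real ^ 3"
  assumes "continuous_on S (\<lambda>x. f x $ 1)" "continuous_on S (\<lambda>x. f x $ 2)" "continuous_on S (\<lambda>x. f x $ 3)"
  shows "continuous_on S f"
proof -
  have "continuous_on S (\<lambda>x. f x $ i)" for i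
    using assms exhaust_3[of i] by auto
  hence "continuous_on S (\<lambda>x. \<chi> i. f x $ i)"
    by (intro continuous_on_vec_lambda)
  thus ?thesis by simp
qed

lemma has_derivative_vec3:
  fixes f :: "'a::real_normed_vector \<Rightarrow> real ^ 3"
  assumes "\<And>i. ((\<lambda>x. f x $ i) has_derivative (\<lambda>x. f' x $ i)) (at a within S)"
  shows "(f has_derivative f') (at a within S)"
  using assms
  by (subst has_derivative_componentwise_within) (auto simp: Basis_vec_def inner_axis)

lemma mem_box_vec3:
  "x \<in> box l (u :: real ^ 3) \<longleftrightarrow> l $ 1 < x $ 1 \<and> x $ 1 < u $ 1 \<and> l $ 2 < x $ 2 \<and> x $ 2 < u $ 2 \<and> l $ 3 < x $ 3 \<and> x $ 3 < u $ 3"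
  by (auto simp: mem_box_cart forall_3)

lemma inj_axis_one: "inj (\<lambda>i::'n::finite. axis i (1::real))"
  by (rule injI) (simp add: axis_eq_axis)

lemma prod_Basis_vec3: "(\<Prod>b\<in>Basis. (v :: real ^ 3) \<bullet> b) = v $ 1 * v $ 2 * v $ 3"
proof -
  have "(\<Prod>b\<in>Basis. (v :: real ^ 3) \<bullet> b) = (\<Prod>i\<in>UNIV. v \<bullet> axis i 1)"
    by (rule prod.reindex_cong[OF inj_axis_one]) (simp_all only: Basis_vec_def Basis_real_def, blast)
  also have "\<dots> = v $ 1 * v $ 2 * v $ 3"
    by (simp only: inner_axis UNIV_3) simp
  finally show ?thesis .
qed

lemma triple_vec_measurable [measurable]: "triple_vec \<in> borel_measurable borel"
  by (intro borel_measurable_continuous_onI continuous_on_vec3) (auto intro!: continuous_intros)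

lemma emeasure_lborel_Times:
  assumes "A \<in> sets borel" "B \<in> sets borel"
  shows "emeasure lborel (A \<times> B) = emeasure lborel A * emeasure lborel B"
  unfolding lborel_prod[symmetric] using assms by (intro lborel.emeasure_pair_measure_Times) auto

text \<open>Lebesgue measure is determined by its values on boxes, and the preimage of a box is a
  product of three intervals.\<close>

lemma lborel_triple_vec: "lborel = distr lborel borel triple_vec"
proof (rule lborel_eqI)
  fix l u :: "real ^ 3"
  assume le: "\<And>b. b \<in> Basis \<Longrightarrow> l \<bullet> b \<le> u \<bullet> b"
  have le': "l $ i \<le> u $ i" for i
    using le[of "axis i 1"] by (auto simp: Basis_vec_def inner_axis)
  have "triple_vec -` box l u = {l $ 1<..<u $ 1} \<times> ({l $ 2<..<u $ 2} \<times> {l $ 3<..<u $ 3})"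
    by (auto simp: mem_box_vec3)
  moreover have "emeasure (distr lborel borel triple_vec) (box l u) = emeasure lborel (triple_vec -` box l u)"
    using emeasure_distr[of triple_vec lborel borel "box l u"] by simp
  moreover have "emeasure lborel ({l $ 1<..<u $ 1} \<times> ({l $ 2<..<u $ 2} \<times> {l $ 3<..<u $ 3}))
      = ennreal ((u $ 1 - l $ 1) * ((u $ 2 - l $ 2) * (u $ 3 - l $ 3)))"
  proof -
    have "emeasure lborel {l $ i<..<u $ i} = ennreal (u $ i - l $ i)" for i
      by (rule emeasure_lborel_Ioo[OF le'])
    thus ?thesis
      using le'[of 1] le'[of 2] le'[of 3]
      by (subst emeasure_lborel_Times, simp, simp add: borel_Times, subst emeasure_lborel_Times)
         (simp_all only: ennreal_mult diff_ge_0_iff_ge mult_nonneg_nonneg borel_open open_greaterThanLessThan)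
  qed
  moreover have "(\<Prod>b\<in>Basis. (u - l) \<bullet> b) = (u $ 1 - l $ 1) * ((u $ 2 - l $ 2) * (u $ 3 - l $ 3))"
    unfolding prod_Basis_vec3 by (simp only: vector_minus_component mult.assoc)
  ultimately show "emeasure (distr lborel borel triple_vec) (box l u) = (\<Prod>b\<in>Basis. (u - l) \<bullet> b)"
    by (simp only:)
qed auto

section \<open>The spherical parametrisation and its Jacobian\<close>

definition polar_cart :: "real ^ 3 \<Rightarrow> real ^ 3" where
  "polar_cart v = v $ 1 *\<^sub>R sphere_point (v $ 2, v $ 3)"

text \<open>Open, so that derivatives need no restriction to the domain, and without the axis and
  the half-plane \<phi> = 0, so that \<open>polar_cart\<close> is injective on it.\<close>

definition polar_dom :: "(real ^ 3) set" where
  "polar_dom = {v. 0 < v $ 1 \<and> 0 < v $ 2 \<and> v $ 2 < pi \<and> 0 < v $ 3 \<and> v $ 3 < 2 * pi}"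

lemma sphere_point_nth [simp]:
  "sphere_point p $ 1 = sin (fst p) * cos (snd p)"
  "sphere_point p $ 2 = sin (fst p) * sin (snd p)"
  "sphere_point p $ 3 = cos (fst p)"
  by (auto simp: sphere_point_def split: prod.splits)

lemma norm_vec3: "norm (v :: real ^ 3) = sqrt ((v $ 1)\<^sup>2 + (v $ 2)\<^sup>2 + (v $ 3)\<^sup>2)"
  by (simp add: norm_vec_def L2_set_def sum_3)

lemma norm_sphere_point [simp]: "norm (sphere_point p) = 1"
proof -
  have "(sin (fst p) * cos (snd p))\<^sup>2 + (sin (fst p) * sin (snd p))\<^sup>2 + (cos (fst p))\<^sup>2
      = (sin (fst p))\<^sup>2 * ((sin (snd p))\<^sup>2 + (cos (snd p))\<^sup>2) + (cos (fst p))\<^sup>2"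
    by (simp only: distrib_left power_mult_distrib)
  also have "\<dots> = 1" by (simp only: sin_cos_squared_add mult_1_right)
  finally show ?thesis by (simp add: norm_vec3)
qed

lemma continuous_on_sphere_point: "continuous_on S sphere_point"
  by (rule continuous_on_vec3) (auto intro!: continuous_intros)

lemma continuous_on_polar_cart: "continuous_on S polar_cart"
  unfolding polar_cart_def
  by (intro continuous_intros continuous_on_compose2[OF continuous_on_sphere_point[of UNIV]]) auto

lemma open_polar_dom: "open polar_dom"
  unfolding polar_dom_def by (intro open_Collect_conj open_Collect_less continuous_intros)

lemma inj_on_polar_cart: "inj_on polar_cart polar_dom"
proof (rule inj_onI)
  fix v w assume v: "v \<in> polar_dom" and w: "w \<in> polar_dom" and eq: "polar_cart v = polar_cart w"
  have pos: "v $ 1 > 0" "w $ 1 > 0" using v w by (auto simp: polar_dom_def)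
  have "norm (polar_cart v) = norm (polar_cart w)" using eq by simp
  hence 1: "v $ 1 = w $ 1" using pos by (simp add: polar_cart_def)
  hence sp: "sphere_point (v $ 2, v $ 3) = sphere_point (w $ 2, w $ 3)"
    using eq pos unfolding polar_cart_def 1 by (simp only: scaleR_cancel_left) simp
  have "cos (v $ 2) = cos (w $ 2)" using arg_cong[OF sp, of "\<lambda>x. x $ 3"] by simp
  hence 2: "v $ 2 = w $ 2"
    using v w by (subst cos_inj_pi[of "v $ 2" "w $ 2"]) (simp_all add: polar_dom_def)
  have s: "sin (w $ 2) > 0" using w by (intro sin_gt_zero) (auto simp: polar_dom_def)
  have "cos (v $ 3) = cos (w $ 3)" "sin (v $ 3) = sin (w $ 3)"
    using arg_cong[OF sp, of "\<lambda>x. x $ 1"] arg_cong[OF sp, of "\<lambda>x. x $ 2"] 2 s by auto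
  then obtain n where n: "v $ 3 = w $ 3 + 2 * pi * of_int n"
    using sin_cos_eq_iff[of "v $ 3" "w $ 3"] by (auto simp: Ints_def)
  have "\<bar>v $ 3 - w $ 3\<bar> < 2 * pi" using v w by (auto simp: polar_dom_def)
  hence "2 * pi * \<bar>of_int n\<bar> < 2 * pi * 1" using n by (simp add: abs_mult)
  hence "\<bar>of_int n :: real\<bar> < 1" by (subst (asm) mult_less_cancel_left_pos) auto
  hence "n = 0" by linarith
  hence 3: "v $ 3 = w $ 3" using n by simp
  show "v = w" using 1 2 3 by (simp add: vec_eq_iff forall_3)
qed

text \<open>The condition discards a plane, hence a null set, and excludes at once the axis and the
  half-plane \<phi> = 0: both the distance \<rho> from the axis and the sine of \<phi> are then
  nonzero.\<close>

lemma polar_cart_surj: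
  assumes "x $ 2 \<noteq> 0"
  shows "x \<in> polar_cart ` polar_dom"
proof -
  define r where "r = norm x"
  define \<rho> where "\<rho> = sqrt ((x $ 1)\<^sup>2 + (x $ 2)\<^sup>2)"
  have \<rho>: "\<rho> > 0" using assms unfolding \<rho>_def by (simp add: sum_power2_gt_zero_iff)
  have r: "r > 0" using assms by (auto simp: r_def)
  have r2: "r\<^sup>2 = \<rho>\<^sup>2 + (x $ 3)\<^sup>2"
    by (simp add: r_def \<rho>_def norm_vec3)
  have "(x $ 3 / r)\<^sup>2 + (\<rho> / r)\<^sup>2 = 1"
    using r r2 by (simp add: power_divide add.commute flip: add_divide_distrib) auto
  moreover have "0 \<le> \<rho> / r" using r \<rho> by simp
  ultimately obtain \<theta> where t: "0 \<le> \<theta>" "\<theta> \<le> pi" "x $ 3 / r = cos \<theta>" "\<rho> / r = sin \<theta>"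
    using sincos_total_pi[of "\<rho> / r" "x $ 3 / r"] by auto
  have "sin \<theta> \<noteq> 0" using t(4) r \<rho> by (metis divide_pos_pos less_numeral_extra(3))
  hence t': "0 < \<theta>" "\<theta> < pi" using t(1,2) by (auto simp: less_le)
  have "(x $ 1 / \<rho>)\<^sup>2 + (x $ 2 / \<rho>)\<^sup>2 = ((x $ 1)\<^sup>2 + (x $ 2)\<^sup>2) / \<rho>\<^sup>2"
    by (simp add: power_divide add_divide_distrib)
  also have "\<dots> = 1" using \<rho> assms by (simp add: \<rho>_def)
  finally obtain \<phi> where p: "0 \<le> \<phi>" "\<phi> < 2 * pi" "x $ 1 / \<rho> = cos \<phi>" "x $ 2 / \<rho> = sin \<phi>"
    by (rule sincos_total_2pi)
  have "\<phi> \<noteq> 0" using p(4) assms \<rho> by auto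
  hence "vector [r, \<theta>, \<phi>] \<in> polar_dom" using t' p r by (simp add: polar_dom_def)
  moreover have "polar_cart (vector [r, \<theta>, \<phi>]) = x"
    using r \<rho> by (simp add: polar_cart_def vec_eq_iff forall_3 t(3,4)[symmetric] p(3,4)[symmetric])
  ultimately show ?thesis by force
qed

definition polar_deriv :: "real ^ 3 \<Rightarrow> real ^ 3 \<Rightarrow> real ^ 3" where
  "polar_deriv v h = vector [
     h $ 1 * (sin (v $ 2) * cos (v $ 3)) + v $ 1 * (cos (v $ 2) * h $ 2 * cos (v $ 3) - sin (v $ 2) * (sin (v $ 3) * h $ 3)),
     h $ 1 * (sin (v $ 2) * sin (v $ 3)) + v $ 1 * (cos (v $ 2) * h $ 2 * sin (v $ 3) + sin (v $ 2) * (cos (v $ 3) * h $ 3)),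
     h $ 1 * cos (v $ 2) - v $ 1 * (sin (v $ 2) * h $ 2)]"

lemma has_derivative_nth: "((\<lambda>x. x $ i) has_derivative (\<lambda>h. h $ i)) F"
  by (rule bounded_linear_imp_has_derivative) (rule bounded_linear_vec_nth)

lemma polar_cart_has_derivative: "(polar_cart has_derivative polar_deriv v) (at v within S)"
proof (rule has_derivative_vec3)
  fix i :: 3
  note [derivative_intros] = has_derivative_nth
  have "((\<lambda>x. polar_cart x $ 1) has_derivative (\<lambda>x. polar_deriv v x $ 1)) (at v within S)"
    by (auto simp: polar_cart_def polar_deriv_def algebra_simps intro!: derivative_eq_intros)
  moreover have "((\<lambda>x. polar_cart x $ 2) has_derivative (\<lambda>x. polar_deriv v x $ 2)) (at v within S)"
    by (auto simp: polar_cart_def polar_deriv_def algebra_simps intro!: derivative_eq_intros)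
  moreover have "((\<lambda>x. polar_cart x $ 3) has_derivative (\<lambda>x. polar_deriv v x $ 3)) (at v within S)"
    by (auto simp: polar_cart_def polar_deriv_def algebra_simps intro!: derivative_eq_intros)
  ultimately show "((\<lambda>x. polar_cart x $ i) has_derivative (\<lambda>x. polar_deriv v x $ i)) (at v within S)"
    using exhaust_3[of i] by auto
qed

lemma det_polar_deriv: "det (matrix (polar_deriv v)) = (v $ 1)\<^sup>2 * sin (v $ 2)"
proof -
  define s c s' c' r where "s = sin (v $ 2)" "c = cos (v $ 2)" "s' = sin (v $ 3)" "c' = cos (v $ 3)" "r = v $ 1"
  have a: "s * s = 1 - c * c" "s' * s' = 1 - c' * c'"
    using sin_squared_eq[of "v $ 2"] sin_squared_eq[of "v $ 3"] by (auto simp: s_c_s'_c'_r_def power2_eq_square)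
  \<comment> \<open>The sums of squares are kept as factors, so that this is a polynomial identity;
    they are replaced by 1 afterwards.\<close>
  have "det (matrix (polar_deriv v)) = r * r * s * (s * s + c * c) * (s' * s' + c' * c')"
    unfolding det_3 matrix_def polar_deriv_def
    by (simp add: axis_def s_c_s'_c'_r_def[symmetric]) algebra
  also have "\<dots> = r * r * s" by (simp only: a) simp
  finally show ?thesis by (simp add: s_c_s'_c'_r_def power2_eq_square)
qed

text \<open>Up to the null set where the second coordinate vanishes, a box is the injective image of
  its preimage in \<open>polar_dom\<close>, so its volume is the integral of the Jacobian over that
  preimage.\<close>

lemma nn_integral_polar_box:
  assumes le: "\<And>b. b \<in> Basis \<Longrightarrow> l \<bullet> b \<le> u \<bullet> (b :: real ^ 3)"
  shows "(\<integral>\<^sup>+v. ennreal (indicator {v \<in> polar_dom. polar_cart v \<in> box l u} v * ((v $ 1)\<^sup>2 * sin (v $ 2))) \<partial>lborel)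
    = (\<Prod>b\<in>Basis. (u - l) \<bullet> b)"
proof -
  define S where "S = {v \<in> polar_dom. polar_cart v \<in> box l u}"
  have "S = polar_dom \<inter> polar_cart -` box l u" by (auto simp: S_def)
  hence opS: "open S"
    using open_polar_dom continuous_on_polar_cart[of UNIV]
    by (auto intro!: open_Int open_vimage)
  have sub: "polar_cart ` S \<subseteq> box l u" "box l u - {x. x $ 2 = 0} \<subseteq> polar_cart ` S"
    using polar_cart_surj by (auto simp: S_def)
  have neg: "negligible {x :: real ^ 3. x $ 2 = 0}"
    by (rule negligible_standard_hyperplane_cart)
  have sd: "negligible (sym_diff (box l u) (polar_cart ` S))"
    by (rule negligible_subset[OF neg]) (use sub in auto)
  have bl: "box l u \<in> lmeasurable" by simp
  have "polar_cart ` S \<in> lmeasurable"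
    by (rule lmeasurable_negligible_symdiff[OF bl sd])
  moreover have "measure lebesgue (polar_cart ` S) = measure lebesgue (box l u)"
    by (rule measure_negligible_symdiff[OF _ sd]) (use bl in auto)
  ultimately have "((\<lambda>x. \<bar>det (matrix (polar_deriv x))\<bar>) has_integral measure lebesgue (box l u)) S"
    using has_measure_differentiable_image[of S polar_cart polar_deriv "measure lebesgue (box l u)"]
      opS polar_cart_has_derivative inj_on_subset[OF inj_on_polar_cart, of S]
    by (auto simp: S_def)
  moreover have "\<bar>det (matrix (polar_deriv x))\<bar> = (x $ 1)\<^sup>2 * sin (x $ 2)" if "x \<in> S" for x
    using that sin_ge_zero[of "x $ 2"] by (auto simp: S_def polar_dom_def det_polar_deriv abs_mult)
  ultimately have "((\<lambda>x. (x $ 1)\<^sup>2 * sin (x $ 2)) has_integral measure lebesgue (box l u)) S"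
    by (metis (no_types, lifting) has_integral_cong)
  moreover have "0 \<le> (x $ 1)\<^sup>2 * sin (x $ 2)" if "x \<in> S" for x
    using that sin_ge_zero[of "x $ 2"] by (auto simp: S_def polar_dom_def)
  ultimately have "(\<integral>\<^sup>+v. ennreal (indicator S v * ((v $ 1)\<^sup>2 * sin (v $ 2))) \<partial>lborel) = measure lebesgue (box l u)"
    by (rule nn_integral_has_integral_lebesgue[rotated])
  also have "\<dots> = (\<Prod>b\<in>Basis. (u - l) \<bullet> b)"
    using le by (simp add: measure_lborel_box_eq)
  finally show ?thesis by (simp add: S_def)
qed

section \<open>Lebesgue measure in polar coordinates\<close>

definition polar_weight :: "real \<times> real \<times> real \<Rightarrow> real" where
  "polar_weight q = indicator ({0<..} \<times> ({0..pi} \<times> {0..2 * pi})) q * ((fst q)\<^sup>2 * sin (fst (snd q)))"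

definition polar_map :: "real ^ 3 \<Rightarrow> real \<times> real \<times> real \<Rightarrow> real ^ 3" where
  "polar_map y q = y + fst q *\<^sub>R sphere_point (snd q)"

lemma polar_weight_measurable [measurable]: "polar_weight \<in> borel_measurable borel"
  unfolding polar_weight_def borel_prod[symmetric] by measurable

lemma polar_map_measurable [measurable]: "polar_map y \<in> borel_measurable borel"
  unfolding polar_map_def
  by (intro borel_measurable_continuous_onI continuous_intros continuous_on_compose2[OF continuous_on_sphere_point[of UNIV]]) auto

lemma polar_weight_nonneg: "polar_weight q \<ge> 0"
  by (auto simp: polar_weight_def indicator_def sin_ge_zero split: prod.splits)

text \<open>\<open>polar_weight\<close> has closed angular intervals, to match
  \<open>solid_angle_integral\<close>, and \<open>polar_dom\<close> open ones. At \<theta> = 0 and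
  \<theta> = pi both sides vanish with the sine, so they differ only where \<phi> is 0 or 2
  pi.\<close>

lemma polar_weight_AE:
  "AE q in lborel. polar_weight q = indicator polar_dom (triple_vec q) * ((triple_vec q $ 1)\<^sup>2 * sin (triple_vec q $ 2))"
proof -
  define N where "N = {q :: real \<times> real \<times> real. q \<bullet> (0, 0, 1) = 0} \<union> {q. q \<bullet> (0, 0, 1) = 2 * pi}"
  have "negligible N" unfolding N_def
    by (intro negligible_Un negligible_standard_hyperplane) (auto simp: Basis_prod_def)
  moreover have "closed N" unfolding N_def
    by (intro closed_Un closed_Collect_eq continuous_intros)
  ultimately have "N \<in> null_sets lborel"
    by (simp add: negligible_iff_null_sets null_sets_completion_iff borel_closed)
  thus ?thesis
  proof (rule AE_I')
    show "{q \<in> space lborel. polar_weight q \<noteq> indicator polar_dom (triple_vec q) * ((triple_vec q $ 1)\<^sup>2 * sin (triple_vec q $ 2))} \<subseteq> N"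
      by (auto simp: N_def polar_weight_def polar_dom_def indicator_def less_le)
  qed
qed

lemma lborel_polar_0: "lborel = distr (density lborel polar_weight) borel (polar_map 0)"
proof (rule lborel_eqI)
  fix l u :: "real ^ 3"
  assume le: "\<And>b. b \<in> Basis \<Longrightarrow> l \<bullet> b \<le> u \<bullet> b"
  have [measurable]: "polar_dom \<in> sets borel" "polar_cart \<in> borel_measurable borel"
    by (auto intro!: borel_open open_polar_dom borel_measurable_continuous_onI continuous_on_polar_cart)
  have pm: "polar_map 0 q = polar_cart (triple_vec q)" for q
    by (simp add: polar_map_def polar_cart_def)
  have "emeasure (distr (density lborel polar_weight) borel (polar_map 0)) (box l u)
      = (\<integral>\<^sup>+q. ennreal (polar_weight q) * indicator (polar_map 0 -` box l u) q \<partial>lborel)"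
    by (subst emeasure_distr) (simp_all add: emeasure_density measurable_sets_borel[OF polar_map_measurable])
  also have "\<dots> = (\<integral>\<^sup>+q. ennreal (indicator {v \<in> polar_dom. polar_cart v \<in> box l u} (triple_vec q) *
      ((triple_vec q $ 1)\<^sup>2 * sin (triple_vec q $ 2))) \<partial>lborel)"
    by (intro nn_integral_cong_AE eventually_mono[OF polar_weight_AE]) (auto simp: indicator_def pm)
  also have "\<dots> = (\<integral>\<^sup>+v. ennreal (indicator {v \<in> polar_dom. polar_cart v \<in> box l u} v *
      ((v $ 1)\<^sup>2 * sin (v $ 2))) \<partial>distr lborel borel triple_vec)"
    by (subst nn_integral_distr) auto
  also have "\<dots> = (\<Prod>b\<in>Basis. (u - l) \<bullet> b)"
    unfolding lborel_triple_vec[symmetric] by (rule nn_integral_polar_box[OF le])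
  finally show "emeasure (distr (density lborel polar_weight) borel (polar_map 0)) (box l u) = (\<Prod>b\<in>Basis. (u - l) \<bullet> b)" .
qed auto

lemma lborel_polar: "lborel = distr (density lborel polar_weight) borel (polar_map y)"
proof -
  have "lborel = distr lborel borel ((+) y)" by (rule lborel_distr_plus[symmetric])
  also have "\<dots> = distr (distr (density lborel polar_weight) borel (polar_map 0)) borel ((+) y)"
    by (rule arg_cong[OF lborel_polar_0])
  also have "\<dots> = distr (density lborel polar_weight) borel ((+) y \<circ> polar_map 0)"
    by (subst distr_distr) simp_all
  also have "(+) y \<circ> polar_map 0 = polar_map y"
    by (auto simp: polar_map_def)
  finally show ?thesis .
qed


text \<open>Off y the direction depends continuously on x. At y itself it is 0, by the convention
  for division by 0, and a single exceptional point does not affect measurability.\<close>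

lemma continuous_on_sphere_measurable:
  fixes g :: "real ^ 3 \<Rightarrow> 'b::topological_space"
  assumes "continuous_on (sphere 0 1) g"
  shows "(\<lambda>x. g ((x - y) /\<^sub>R norm (x - y))) \<in> borel_measurable borel"
proof (rule borel_measurable_continuous_countable_exceptions)
  show "continuous_on (- {y}) (\<lambda>x. g ((x - y) /\<^sub>R norm (x - y)))"
  proof (rule continuous_on_compose2[OF assms])
    show "continuous_on (- {y}) (\<lambda>x. (x - y) /\<^sub>R norm (x - y))"
      by (auto intro!: continuous_intros)
    have "norm ((x - y) /\<^sub>R norm (x - y)) = 1" if "x \<noteq> y" for x
      using that by simp
    thus "(\<lambda>x. (x - y) /\<^sub>R norm (x - y)) ` (- {y}) \<subseteq> sphere 0 1"
      by (intro image_subsetI) (simp only: mem_sphere_0 Compl_iff singleton_iff)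
  qed
qed simp

section \<open>Integration of products of a radial and an angular factor\<close>

lemma continuous_on_sphere_point_comp:
  fixes g :: "real ^ 3 \<Rightarrow> 'b::topological_space"
  assumes "continuous_on (sphere 0 1) g"
  shows "continuous_on S (\<lambda>p. g (sphere_point p))"
  by (rule continuous_on_compose2[OF assms continuous_on_sphere_point]) auto

lemma solid_angle_integrable_continuous:
  assumes "continuous_on (sphere 0 1) g"
  shows "solid_angle_integrable g"
  unfolding solid_angle_integrable_def set_integrable_def
  by (intro borel_integrable_compact compact_Times compact_Icc continuous_intros
        continuous_on_sphere_point_comp[OF assms])

text \<open>For nonpositive radius both sides are 0, so the factorisation holds everywhere and no
  exceptional set has to be carried along.\<close>

lemma polar_integrand:
  fixes k :: "real \<Rightarrow> complex"
  shows "polar_weight q *\<^sub>R (k (norm (polar_map y q - y)) * of_real (g ((polar_map y q - y) /\<^sub>R norm (polar_map y q - y))))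
    = (indicator {0<..} (fst q) *\<^sub>R (of_real ((fst q)\<^sup>2) * k (fst q))) *
      of_real (indicator ({0..pi} \<times> {0..2 * pi}) (snd q) *\<^sub>R (sin (fst (snd q)) * g (sphere_point (snd q))))"
proof (cases "fst q > 0")
  case True
  hence "polar_map y q - y = fst q *\<^sub>R sphere_point (snd q)"
    "norm (polar_map y q - y) = fst q"
    "(polar_map y q - y) /\<^sub>R norm (polar_map y q - y) = sphere_point (snd q)"
    by (simp_all add: polar_map_def)
  thus ?thesis
    by (cases q) (auto simp: polar_weight_def indicator_def scaleR_conv_of_real)
qed (auto simp: polar_weight_def indicator_def mem_Times_iff)

text \<open>In polar coordinates the integrand is a product of a function of the radius and one of
  the angles, each absolutely integrable, so Fubini applies. The radial factor is complex because it
  will be a complex power.\<close>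

lemma integral_polar:
  fixes k :: "real \<Rightarrow> complex" and g :: "real ^ 3 \<Rightarrow> real"
  assumes k [measurable]: "k \<in> borel_measurable borel"
    and int: "set_integrable lborel {0<..} (\<lambda>r. of_real (r\<^sup>2) * k r)"
    and g: "continuous_on (sphere 0 1) g"
  shows "integrable lborel (\<lambda>x. k (norm (x - y)) * of_real (g ((x - y) /\<^sub>R norm (x - y))))"
    and "(\<integral>x. k (norm (x - y)) * of_real (g ((x - y) /\<^sub>R norm (x - y))) \<partial>lborel)
      = (LINT r:{0<..}|lborel. of_real (r\<^sup>2) * k r) * of_real (solid_angle_integral g)"
proof -
  define h where "h x = k (norm (x - y)) * of_real (g ((x - y) /\<^sub>R norm (x - y)))" for x
  define A where "A r = indicator {0<..} r *\<^sub>R (of_real (r\<^sup>2) * k r)" for r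
  define B where "B p = indicator ({0..pi} \<times> {0..2 * pi}) p *\<^sub>R (sin (fst p) * g (sphere_point p))" for p
  have [measurable]: "h \<in> borel_measurable borel"
    using continuous_on_sphere_measurable[OF g, of y] unfolding h_def by measurable
  have A: "integrable lborel A"
    using int unfolding A_def set_integrable_def .
  have B: "integrable lborel B"
    using solid_angle_integrable_continuous[OF g]
    unfolding B_def solid_angle_integrable_def set_integrable_def .
  have B': "integrable lborel (\<lambda>p. complex_of_real (B p))"
    using B by (rule integrable_of_real)
  have AB: "polar_weight q *\<^sub>R h (polar_map y q) = A (fst q) * of_real (B (snd q))" for q
    unfolding h_def A_def B_def by (rule polar_integrand)
  have prod: "integrable (lborel \<Otimes>\<^sub>M lborel) (\<lambda>(r, p). A r * of_real (B p))"
  proof (rule lborel_pair.Fubini_integrable)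
    show "(\<lambda>(r, p). A r * complex_of_real (B p)) \<in> borel_measurable (lborel \<Otimes>\<^sub>M lborel)"
      using borel_measurable_integrable[OF A] borel_measurable_integrable[OF B'] by measurable
    have "integrable lborel (\<lambda>r. norm (A r) * (\<integral>p. norm (complex_of_real (B p)) \<partial>lborel))"
      using A by (intro integrable_mult_left integrable_norm)
    thus "integrable lborel (\<lambda>r. \<integral>p. norm (case (r, p) of (r, p) \<Rightarrow> A r * complex_of_real (B p)) \<partial>lborel)"
      by (simp add: norm_mult)
    show "AE r in lborel. integrable lborel (\<lambda>p. case (r, p) of (r, p) \<Rightarrow> A r * complex_of_real (B p))"
      using B' by simp
  qed
  have eq: "(\<lambda>q. polar_weight q *\<^sub>R h (polar_map y q)) = (\<lambda>(r, p). A r * of_real (B p))"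
    by (auto simp: AB)
  have int_q: "integrable lborel (\<lambda>q. polar_weight q *\<^sub>R h (polar_map y q))"
    using prod unfolding eq lborel_prod .
  have "integrable (distr (density lborel polar_weight) borel (polar_map y)) h"
    by (subst integrable_distr_eq, simp, simp, subst integrable_density)
       (use int_q polar_weight_nonneg in auto)
  thus "integrable lborel (\<lambda>x. k (norm (x - y)) * of_real (g ((x - y) /\<^sub>R norm (x - y))))"
    unfolding lborel_polar[of y, symmetric] h_def .
  have "(\<integral>x. h x \<partial>lborel) = (\<integral>x. h x \<partial>distr (density lborel polar_weight) borel (polar_map y))"
    unfolding lborel_polar[of y, symmetric] ..
  also have "\<dots> = (\<integral>q. polar_weight q *\<^sub>R h (polar_map y q) \<partial>lborel)"
    by (subst integral_distr, simp, simp, subst integral_density)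
       (use polar_weight_nonneg in auto)
  also have "\<dots> = (\<integral>q. (case q of (r, p) \<Rightarrow> A r * complex_of_real (B p)) \<partial>(lborel \<Otimes>\<^sub>M lborel))"
    unfolding eq lborel_prod ..
  also have "\<dots> = (\<integral>r. (\<integral>p. A r * complex_of_real (B p) \<partial>lborel) \<partial>lborel)"
    using lborel_pair.integral_fst'[OF prod] by simp
  also have "\<dots> = (\<integral>r. A r \<partial>lborel) * of_real (\<integral>p. B p \<partial>lborel)"
    using A B' by simp
  finally show "(\<integral>x. k (norm (x - y)) * of_real (g ((x - y) /\<^sub>R norm (x - y))) \<partial>lborel)
      = (LINT r:{0<..}|lborel. of_real (r\<^sup>2) * k r) * of_real (solid_angle_integral g)"
    unfolding h_def A_def B_def solid_angle_integral_def set_lebesgue_integral_def .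
qed

text \<open>The set of admissible radii is absorbed into the radial factor as an indicator; it is
  used for balls, for shells and for the outside of a ball.\<close>

lemma set_integral_polar_shell:
  fixes k :: "real \<Rightarrow> complex" and g :: "real ^ 3 \<Rightarrow> real"
  assumes k [measurable]: "k \<in> borel_measurable borel"
    and T: "T \<in> sets borel" "T \<subseteq> {0<..}"
    and int: "set_integrable lborel T (\<lambda>r. of_real (r\<^sup>2) * k r)"
    and g: "continuous_on (sphere 0 1) g"
  shows "set_integrable lborel {x. norm (x - y) \<in> T} (\<lambda>x. k (norm (x - y)) * of_real (g ((x - y) /\<^sub>R norm (x - y))))"
    and "(LINT x:{x. norm (x - y) \<in> T}|lborel. k (norm (x - y)) * of_real (g ((x - y) /\<^sub>R norm (x - y))))
      = (LINT r:T|lborel. of_real (r\<^sup>2) * k r) * of_real (solid_angle_integral g)"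
proof -
  have [measurable]: "(\<lambda>r. indicator T r *\<^sub>R k r) \<in> borel_measurable borel"
    using T(1) by measurable
  have 1: "indicator {0<..} r *\<^sub>R (of_real (r\<^sup>2) * (indicator T r *\<^sub>R k r)) = indicator T r *\<^sub>R (of_real (r\<^sup>2) * k r)" for r
    using T(2) by (auto simp: indicator_def)
  have int': "set_integrable lborel {0<..} (\<lambda>r. of_real (r\<^sup>2) * (indicator T r *\<^sub>R k r))"
    using int unfolding set_integrable_def 1 .
  have 2: "indicator {x. norm (x - y) \<in> T} x *\<^sub>R (k (norm (x - y)) * of_real (g ((x - y) /\<^sub>R norm (x - y))))
     = (indicator T (norm (x - y)) *\<^sub>R k (norm (x - y))) * of_real (g ((x - y) /\<^sub>R norm (x - y)))" for x
    by (auto simp: indicator_def)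
  show "set_integrable lborel {x. norm (x - y) \<in> T} (\<lambda>x. k (norm (x - y)) * of_real (g ((x - y) /\<^sub>R norm (x - y))))"
    unfolding set_integrable_def 2 by (rule integral_polar(1)[OF _ int' g]) simp
  show "(LINT x:{x. norm (x - y) \<in> T}|lborel. k (norm (x - y)) * of_real (g ((x - y) /\<^sub>R norm (x - y))))
      = (LINT r:T|lborel. of_real (r\<^sup>2) * k r) * of_real (solid_angle_integral g)"
    unfolding set_lebesgue_integral_def 2
    by (subst integral_polar(2)[OF _ int' g], simp) (simp only: set_lebesgue_integral_def 1)
qed

subsection \<open>Holomorphic functions of two variables\<close>

lemma holomorphic2_onI:
  assumes "\<And>p. p \<in> D \<Longrightarrow> \<exists>u v. (f has_derivative (\<lambda>h. u * fst h + v * snd h)) (at p)"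
  shows "holomorphic2_on f D"
  using assms by (simp add: holomorphic2_on_def case_prod_unfold)

lemma holomorphic2_onD:
  assumes "holomorphic2_on f D" "p \<in> D"
  obtains u v where "(f has_derivative (\<lambda>h. u * fst h + v * snd h)) (at p)"
  using assms by (auto simp: holomorphic2_on_def case_prod_unfold)

lemma holomorphic2_on_subset: "holomorphic2_on f D \<Longrightarrow> E \<subseteq> D \<Longrightarrow> holomorphic2_on f E"
  by (auto simp: holomorphic2_on_def)

lemma holomorphic2_on_const: "holomorphic2_on (\<lambda>_. c) D"
  by (rule holomorphic2_onI) (rule exI[of _ 0], rule exI[of _ 0], simp)

lemma holomorphic2_on_fst: "holomorphic2_on fst D"
proof (rule holomorphic2_onI)
  fix p :: "complex \<times> complex"
  have "(fst has_derivative (\<lambda>h. 1 * fst h + 0 * snd h)) (at p)"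
    by (auto intro!: derivative_eq_intros)
  thus "\<exists>u v. (fst has_derivative (\<lambda>h. u * fst h + v * snd h)) (at p)" by blast
qed

lemma holomorphic2_on_snd: "holomorphic2_on snd D"
proof (rule holomorphic2_onI)
  fix p :: "complex \<times> complex"
  have "(snd has_derivative (\<lambda>h. 0 * fst h + 1 * snd h)) (at p)"
    by (auto intro!: derivative_eq_intros)
  thus "\<exists>u v. (snd has_derivative (\<lambda>h. u * fst h + v * snd h)) (at p)" by blast
qed

lemma holomorphic2_on_add:
  assumes "holomorphic2_on f D" "holomorphic2_on g D"
  shows "holomorphic2_on (\<lambda>p. f p + g p) D"
proof (rule holomorphic2_onI)
  fix p assume p: "p \<in> D"
  obtain u v where f: "(f has_derivative (\<lambda>h. u * fst h + v * snd h)) (at p)"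
    using assms(1) p by (rule holomorphic2_onD)
  obtain u' v' where g: "(g has_derivative (\<lambda>h. u' * fst h + v' * snd h)) (at p)"
    using assms(2) p by (rule holomorphic2_onD)
  have "((\<lambda>p. f p + g p) has_derivative (\<lambda>h. (u + u') * fst h + (v + v') * snd h)) (at p)"
    by (rule derivative_eq_intros f g refl)+ (simp add: algebra_simps)
  thus "\<exists>u v. ((\<lambda>p. f p + g p) has_derivative (\<lambda>h. u * fst h + v * snd h)) (at p)" by blast
qed

lemma holomorphic2_on_mult:
  assumes "holomorphic2_on f D" "holomorphic2_on g D"
  shows "holomorphic2_on (\<lambda>p. f p * g p) D"
proof (rule holomorphic2_onI)
  fix p assume p: "p \<in> D"
  obtain u v where f: "(f has_derivative (\<lambda>h. u * fst h + v * snd h)) (at p)"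
    using assms(1) p by (rule holomorphic2_onD)
  obtain u' v' where g: "(g has_derivative (\<lambda>h. u' * fst h + v' * snd h)) (at p)"
    using assms(2) p by (rule holomorphic2_onD)
  have "((\<lambda>p. f p * g p) has_derivative (\<lambda>h. (f p * u' + u * g p) * fst h + (f p * v' + v * g p) * snd h)) (at p)"
    by (rule derivative_eq_intros f g refl)+ (simp add: algebra_simps)
  thus "\<exists>u v. ((\<lambda>p. f p * g p) has_derivative (\<lambda>h. u * fst h + v * snd h)) (at p)" by blast
qed

lemma holomorphic2_on_compose:
  assumes "f holomorphic_on S" "open S" "holomorphic2_on g D" "\<And>p. p \<in> D \<Longrightarrow> g p \<in> S"
  shows "holomorphic2_on (\<lambda>p. f (g p)) D"
proof (rule holomorphic2_onI)
  fix p assume p: "p \<in> D"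
  obtain u v where g: "(g has_derivative (\<lambda>h. u * fst h + v * snd h)) (at p)"
    using assms(3) p by (rule holomorphic2_onD)
  have "(f has_field_derivative deriv f (g p)) (at (g p))"
    by (rule holomorphic_derivI[OF assms(1,2) assms(4)[OF p]])
  hence "(f has_derivative (\<lambda>h. deriv f (g p) * h)) (at (g p))"
    by (simp add: has_field_derivative_def)
  from has_derivative_compose[OF g this]
  have "((\<lambda>p. f (g p)) has_derivative (\<lambda>h. (deriv f (g p) * u) * fst h + (deriv f (g p) * v) * snd h)) (at p)"
    by (simp add: algebra_simps)
  thus "\<exists>u v. ((\<lambda>p. f (g p)) has_derivative (\<lambda>h. u * fst h + v * snd h)) (at p)" by blast
qed

lemma holomorphic2_on_fst_compose:
  assumes "f holomorphic_on UNIV"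
  shows "holomorphic2_on (\<lambda>p. f (fst p)) D"
  by (rule holomorphic2_on_compose[OF assms open_UNIV holomorphic2_on_fst]) simp

lemma holomorphic2_on_snd_compose:
  assumes "f holomorphic_on UNIV"
  shows "holomorphic2_on (\<lambda>p. f (snd p)) D"
  by (rule holomorphic2_on_compose[OF assms open_UNIV holomorphic2_on_snd]) simp

lemma holomorphic2_on_uminus: "holomorphic2_on f D \<Longrightarrow> holomorphic2_on (\<lambda>p. - f p) D"
  using holomorphic2_on_mult[OF holomorphic2_on_const[of "-1"], of f D] by simp

lemma holomorphic2_on_diff:
  "holomorphic2_on f D \<Longrightarrow> holomorphic2_on g D \<Longrightarrow> holomorphic2_on (\<lambda>p. f p - g p) D"
  using holomorphic2_on_add[OF _ holomorphic2_on_uminus, of f D g] by simp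

lemma holomorphic2_on_divide:
  assumes "holomorphic2_on f D" "holomorphic2_on g D" "\<And>p. p \<in> D \<Longrightarrow> g p \<noteq> 0"
  shows "holomorphic2_on (\<lambda>p. f p / g p) D"
proof -
  have "holomorphic2_on (\<lambda>p. inverse (g p)) D"
    by (rule holomorphic2_on_compose[of inverse "- {0}"]) (use assms in \<open>auto intro!: holomorphic_intros\<close>)
  from holomorphic2_on_mult[OF assms(1) this] show ?thesis
    by (simp add: divide_inverse)
qed

lemma holomorphic2_on_sum_list:
  assumes "\<And>x. x \<in> set xs \<Longrightarrow> holomorphic2_on (f x) D"
  shows "holomorphic2_on (\<lambda>p. \<Sum>x\<leftarrow>xs. f x p) D"
  using assms by (induction xs) (auto intro!: holomorphic2_on_add holomorphic2_on_const)

lemmas holomorphic2_intros =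
  holomorphic2_on_const holomorphic2_on_fst holomorphic2_on_snd holomorphic2_on_add
  holomorphic2_on_mult holomorphic2_on_diff holomorphic2_on_sum_list

section \<open>Restriction to complex lines and the identity theorem\<close>

lemma holomorphic2_on_imp_continuous_on:
  assumes "holomorphic2_on f D"
  shows "continuous_on D f"
proof (rule continuous_at_imp_continuous_on, rule ballI)
  fix p assume "p \<in> D"
  then obtain u v where "(f has_derivative (\<lambda>h. u * fst h + v * snd h)) (at p)"
    using assms holomorphic2_onD by blast
  thus "isCont f p" by (rule has_derivative_continuous)
qed

text \<open>Complex lines reduce questions in two variables to one-variable function theory. The
  multiple of \<open>h\<close> by a complex \<open>t\<close> is written in coordinates, since pairs
  carry only a real scalar multiplication.\<close>

lemma holomorphic2_on_line:
  assumes "holomorphic2_on f D" "p + (t * fst h, t * snd h) \<in> D"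
  shows "\<exists>d. ((\<lambda>t. f (p + (t * fst h, t * snd h))) has_field_derivative d) (at t)"
proof -
  obtain u v where f: "(f has_derivative (\<lambda>h. u * fst h + v * snd h)) (at (p + (t * fst h, t * snd h)))"
    using assms by (rule holomorphic2_onD)
  have "((\<lambda>t. p + (t * fst h, t * snd h)) has_derivative (\<lambda>t. (t * fst h, t * snd h))) (at t)"
    by (auto intro!: derivative_eq_intros)
  from has_derivative_compose[OF this f]
  moreover have "(\<lambda>t. u * (t * fst h) + v * (t * snd h)) = (*) (u * fst h + v * snd h)"
    by (auto simp: algebra_simps)
  ultimately have "((\<lambda>t. f (p + (t * fst h, t * snd h))) has_field_derivative (u * fst h + v * snd h)) (at t)"
    by (simp add: has_field_derivative_def)
  thus ?thesis ..
qed

lemma holomorphic2_on_line_holomorphic: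
  assumes "holomorphic2_on f D" "\<And>t. t \<in> T \<Longrightarrow> p + (t * fst h, t * snd h) \<in> D"
  shows "(\<lambda>t. f (p + (t * fst h, t * snd h))) holomorphic_on T"
  unfolding holomorphic_on_def field_differentiable_def
  using holomorphic2_on_line[OF assms(1) assms(2)] has_field_derivative_at_within by blast

lemma convex_line_vimage:
  fixes p h :: "complex \<times> complex"
  assumes "convex S"
  shows "convex {t. p + (t * fst h, t * snd h) \<in> S}"
  unfolding convex_alt
proof (intro ballI allI impI)
  fix s t :: complex and u :: real
  assume "s \<in> {t. p + (t * fst h, t * snd h) \<in> S}" "t \<in> {t. p + (t * fst h, t * snd h) \<in> S}" "0 \<le> u \<and> u \<le> 1"
  hence "(1 - u) *\<^sub>R (p + (s * fst h, s * snd h)) + u *\<^sub>R (p + (t * fst h, t * snd h)) \<in> S"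
    using assms unfolding convex_alt by auto
  also have "(1 - u) *\<^sub>R (p + (s * fst h, s * snd h)) + u *\<^sub>R (p + (t * fst h, t * snd h))
     = p + (((1 - u) *\<^sub>R s + u *\<^sub>R t) * fst h, ((1 - u) *\<^sub>R s + u *\<^sub>R t) * snd h)"
    by (cases p) (simp add: scaleR_conv_of_real algebra_simps)
  finally show "(1 - u) *\<^sub>R s + u *\<^sub>R t \<in> {t. p + (t * fst h, t * snd h) \<in> S}" by simp
qed

lemma open_line_vimage:
  fixes p h :: "complex \<times> complex"
  assumes "open S"
  shows "open {t. p + (t * fst h, t * snd h) \<in> S}"
proof -
  have "open ((\<lambda>t. p + (t * fst h, t * snd h)) -` S)"
    by (rule open_vimage[OF assms]) (auto intro!: continuous_intros)
  thus ?thesis by (simp add: vimage_def)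
qed

text \<open>The complex line through \<open>z\<close> and \<open>w\<close> meets the ball in a
  convex set, and \<open>f\<close> vanishes on it near \<open>z\<close>, so the one-variable
  identity theorem carries the zero from t = 0 to t = 1.\<close>

lemma holomorphic2_on_identity_ball:
  assumes "holomorphic2_on f (ball p r)" "open Z" "z \<in> Z" "z \<in> ball p r" "w \<in> ball p r"
    and zero: "\<And>q. q \<in> Z \<Longrightarrow> f q = 0"
  shows "f w = 0"
proof -
  define h where "h = w - z"
  define T where "T = {t. z + (t * fst h, t * snd h) \<in> ball p r}"
  define s where "s = {t. z + (t * fst h, t * snd h) \<in> Z \<inter> ball p r}"
  have T: "open T" "connected T"
    unfolding T_def by (intro open_line_vimage convex_connected convex_line_vimage convex_ball open_ball)+
  have s: "open s" unfolding s_def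
    using assms(2) by (intro open_line_vimage) auto
  have "f (z + (1 * fst h, 1 * snd h)) = 0"
  proof (rule analytic_continuation_open[OF s T(1) _ T(2), of "\<lambda>t. f (z + (t * fst h, t * snd h))" "\<lambda>_. 0" 1])
    have "z + (0 * fst h, 0 * snd h) = z" by (cases z) simp
    hence "0 \<in> s" using assms(3,4) by (simp only: s_def mem_Collect_eq IntI)
    thus "s \<noteq> {}" by blast
    show "s \<subseteq> T" by (auto simp: s_def T_def)
    show "(\<lambda>t. f (z + (t * fst h, t * snd h))) holomorphic_on T"
      by (rule holomorphic2_on_line_holomorphic[OF assms(1)]) (simp add: T_def)
    show "f (z + (t * fst h, t * snd h)) = 0" if "t \<in> s" for t
      using that zero by (simp add: s_def)
    have "z + (1 * fst h, 1 * snd h) = w" by (cases z; cases w) (simp add: h_def)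
    thus "1 \<in> T" using assms(5) by (simp only: T_def mem_Collect_eq)
  qed simp
  moreover have "z + (1 * fst h, 1 * snd h) = w" by (cases z; cases w) (simp add: h_def)
  ultimately show ?thesis by simp
qed

text \<open>The interior of the zero set is also closed relative to \<open>D\<close>: a ball in
  \<open>D\<close> around a limit point meets it, and then \<open>f\<close> vanishes on the whole
  ball. Connectedness of \<open>D\<close> does the rest.\<close>

theorem holomorphic2_on_identity:
  assumes D: "open D" "connected D" and f: "holomorphic2_on f D"
    and U: "open U" "U \<noteq> {}" "U \<subseteq> D" and zero: "\<And>q. q \<in> U \<Longrightarrow> f q = 0"
    and p: "p \<in> D"
  shows "f p = 0"
proof -
  define Z where "Z = interior {q \<in> D. f q = 0}"
  have Z0: "f q = 0" if "q \<in> Z" for q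
    using that interior_subset by (fastforce simp: Z_def)
  have oZ: "open Z" by (simp add: Z_def)
  have cl: "q \<in> Z" if q: "q \<in> D" "q \<in> closure Z" for q
  proof -
    obtain r where r: "r > 0" "ball q r \<subseteq> D" using D(1) q(1) by (auto elim: openE)
    obtain z where z: "z \<in> Z" "dist z q < r" using q(2) r(1) by (auto simp: closure_approachable)
    have "f w = 0" if "w \<in> ball q r" for w
      by (rule holomorphic2_on_identity_ball[OF holomorphic2_on_subset[OF f r(2)] oZ z(1) _ that Z0])
         (use z(2) in \<open>auto simp: dist_commute\<close>)
    hence "ball q r \<subseteq> {q \<in> D. f q = 0}" using r(2) by auto
    thus "q \<in> Z" unfolding Z_def using r(1) by (meson interior_maximal open_ball centre_in_ball subsetD)
  qed
  have "U \<subseteq> Z" unfolding Z_def using U zero by (intro interior_maximal) auto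
  hence "Z \<inter> D \<noteq> {}" using U by blast
  moreover have "Z \<inter> D = {} \<or> - closure Z \<inter> D = {}"
    by (rule connectedD[OF D(2) oZ]) (use cl closure_subset[of Z] in auto)
  ultimately have "p \<in> closure Z" using p by blast
  thus ?thesis using cl p Z0 by blast
qed

section \<open>Differentiation of parameter integrals\<close>

lemma second_order_remainder_bound:
  assumes hol: "\<phi> holomorphic_on ball 0 R" and R: "R > 2"
    and bd: "\<And>t. t \<in> ball 0 R \<Longrightarrow> cmod (\<phi> t) \<le> B"
  shows "cmod (\<phi> 1 - \<phi> 0 - deriv \<phi> 0) \<le> 8 * B / R\<^sup>2"
proof -
  have "cmod (\<phi> 1 - (\<Sum>i\<le>1. (deriv ^^ i) \<phi> 0 * (1 - 0) ^ i / fact i)) \<le> (8 * B / R\<^sup>2) * cmod (1 - 0) ^ Suc 1 / fact 1"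
  proof (rule complex_Taylor[of "cball 0 1" 1 "\<lambda>i. (deriv ^^ i) \<phi>" "8 * B / R\<^sup>2" 0 1, simplified funpow_0])
    fix i :: nat and x :: complex
    assume x: "x \<in> cball 0 1"
    hence "x \<in> ball 0 R" using R by auto
    moreover have "(deriv ^^ i) \<phi> holomorphic_on ball 0 R"
      using hol by (intro holomorphic_higher_deriv) auto
    ultimately have "((deriv ^^ i) \<phi> has_field_derivative deriv ((deriv ^^ i) \<phi>) x) (at x)"
      by (intro holomorphic_derivI[of _ "ball 0 R"]) auto
    thus "((deriv ^^ i) \<phi> has_field_derivative (deriv ^^ Suc i) \<phi> x) (at x within cball 0 1)"
      by (simp add: has_field_derivative_at_within)
  next
    fix x :: complex
    assume x: "x \<in> cball 0 1"
    \<comment> \<open>R > 2 gives 1 + R / 2 < R, so Cauchy's estimate for the second derivative can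
      use the radius R / 2 at every point of the unit disc; the constant 8 is 2! divided by (1 /
      2)^2.\<close>
    have sub: "cball x (R / 2) \<subseteq> ball 0 R"
    proof
      fix t assume "t \<in> cball x (R / 2)"
      hence "cmod t \<le> cmod x + R / 2"
        using norm_triangle_ineq2[of t x] by (simp add: dist_norm norm_minus_commute)
      thus "t \<in> ball 0 R" using x R by simp
    qed
    have "cmod ((deriv ^^ 2) \<phi> x) \<le> fact 2 * B / (R / 2) ^ 2"
    proof (rule Cauchy_inequality)
      show "\<phi> holomorphic_on ball x (R / 2)" 
        by (rule holomorphic_on_subset[OF hol]) (use sub in auto)
      show "continuous_on (cball x (R / 2)) \<phi>"
        by (rule continuous_on_subset[OF holomorphic_on_imp_continuous_on[OF hol] sub])
      fix t assume "cmod (x - t) = R / 2"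
      hence "t \<in> cball x (R / 2)" by (simp add: dist_norm)
      thus "cmod (\<phi> t) \<le> B" using sub bd by blast
    qed (use R in auto)
    also have "\<dots> = 8 * B / R\<^sup>2" by (simp add: power2_eq_square)
    finally show "cmod ((deriv ^^ Suc 1) \<phi> x) \<le> 8 * B / R\<^sup>2" by (simp add: numeral_2_eq_2)
  qed auto
  thus ?thesis by (simp add: diff_diff_eq)
qed

text \<open>The bound involves \<open>f\<close> only through its supremum on the ball, so under an
  integral sign it can be integrated along with a dominating function. It is the one-variable
  estimate along the line in direction \<open>h\<close>, rescaled to a disc of radius R = r / norm
  h; \<open>norm h < r / 2\<close> says that R > 2.\<close>

lemma holomorphic2_remainder_bound:
  assumes f: "holomorphic2_on f (ball p r)" and r: "r > 0" and h: "norm h < r / 2"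
    and bd: "\<And>q. q \<in> ball p r \<Longrightarrow> cmod (f q) \<le> B"
    and der: "(f has_derivative (\<lambda>h. u * fst h + v * snd h)) (at p)"
  shows "cmod (f (p + h) - f p - (u * fst h + v * snd h)) \<le> 8 * B / r\<^sup>2 * (norm h)\<^sup>2"
proof (cases "h = 0")
  case False
  define R where "R = r / norm h"
  have R: "R > 2" using h False by (simp add: R_def field_simps)
  have nt: "norm (t * fst h, t * snd h) = cmod t * norm h" for t
    by (cases h) (simp add: norm_Pair norm_mult power_mult_distrib real_sqrt_mult flip: distrib_left)
  have ins: "p + (t * fst h, t * snd h) \<in> ball p r" if "t \<in> ball 0 R" for t
  proof -
    have "cmod t * norm h < R * norm h" using that False by simp
    moreover have "dist p (p + (t * fst h, t * snd h)) = cmod t * norm h"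
      using nt[of t] by (metis add_diff_cancel_left' dist_commute dist_norm)
    ultimately show ?thesis using False by (simp add: R_def)
  qed
  have "((\<lambda>t. p + (t * fst h, t * snd h)) has_derivative (\<lambda>t. (t * fst h, t * snd h))) (at 0)"
    by (auto intro!: derivative_eq_intros)
  moreover have "(f has_derivative (\<lambda>h. u * fst h + v * snd h)) (at (p + (0 * fst h, 0 * snd h)))"
    using der by (cases p) simp
  ultimately have "((\<lambda>t. f (p + (t * fst h, t * snd h))) has_derivative (\<lambda>t. u * (t * fst h) + v * (t * snd h))) (at 0)"
    using has_derivative_compose by fastforce
  hence "((\<lambda>t. f (p + (t * fst h, t * snd h))) has_field_derivative (u * fst h + v * snd h)) (at 0)"
    by (rule has_derivative_imp_has_field_derivative) (simp add: algebra_simps)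
  hence d: "deriv (\<lambda>t. f (p + (t * fst h, t * snd h))) 0 = u * fst h + v * snd h"
    by (rule DERIV_imp_deriv)
  have "cmod (f (p + (1 * fst h, 1 * snd h)) - f (p + (0 * fst h, 0 * snd h)) - deriv (\<lambda>t. f (p + (t * fst h, t * snd h))) 0)
      \<le> 8 * B / R\<^sup>2"
    by (rule second_order_remainder_bound[OF holomorphic2_on_line_holomorphic[OF f] R]) (use ins bd in auto)
  moreover have "p + (1 * fst h, 1 * snd h) = p + h" "p + (0 * fst h, 0 * snd h) = p"
    by (cases p; cases h; simp)+
  ultimately have "cmod (f (p + h) - f p - (u * fst h + v * snd h)) \<le> 8 * B / R\<^sup>2"
    by (simp only: d)
  also have "8 * B / R\<^sup>2 = 8 * B / r\<^sup>2 * (norm h)\<^sup>2"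
    by (simp add: R_def power_divide)
  finally show ?thesis .
qed simp


text \<open>Cauchy's estimates turn a local dominating function for \<open>g\<close> into one for
  the second-order remainder. Integrated, it shows that the integrals of the pointwise derivatives
  are the derivatives of the integral, with an error of order (norm h)^2.\<close>

theorem holomorphic2_on_integral:
  fixes g :: "complex \<times> complex \<Rightarrow> 'a \<Rightarrow> complex"
  assumes meas: "\<And>p. p \<in> D \<Longrightarrow> g p \<in> borel_measurable M"
    and hol: "\<And>x. x \<in> space M \<Longrightarrow> holomorphic2_on (\<lambda>p. g p x) D"
    and dom: "\<And>p. p \<in> D \<Longrightarrow> \<exists>r>0. \<exists>w. integrable M w \<and> ball p r \<subseteq> D \<and> (\<forall>q\<in>ball p r. \<forall>x\<in>space M. cmod (g q x) \<le> w x)"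
  shows "holomorphic2_on (\<lambda>p. \<integral>x. g p x \<partial>M) D"
proof (rule holomorphic2_onI)
  fix p assume p: "p \<in> D"
  obtain r w where r: "r > 0" and w: "integrable M w" and sub: "ball p r \<subseteq> D"
    and bd: "\<And>q x. q \<in> ball p r \<Longrightarrow> x \<in> space M \<Longrightarrow> cmod (g q x) \<le> w x"
    using dom[OF p] by blast
  have "\<forall>x. \<exists>u v. x \<in> space M \<longrightarrow> ((\<lambda>p. g p x) has_derivative (\<lambda>h. u * fst h + v * snd h)) (at p)"
    using hol p holomorphic2_onD by metis
  then obtain u v where der: "\<And>x. x \<in> space M \<Longrightarrow> ((\<lambda>p. g p x) has_derivative (\<lambda>h. u x * fst h + v x * snd h)) (at p)"
    by metis
  have rem: "cmod (g (p + h) x - g p x - (u x * fst h + v x * snd h)) \<le> 8 * w x / r\<^sup>2 * (norm h)\<^sup>2"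
    if "x \<in> space M" "norm h < r / 2" for h x
    by (rule holomorphic2_remainder_bound[OF holomorphic2_on_subset[OF hol[OF that(1)] sub] r that(2) _ der[OF that(1)]])
       (use bd that in blast)
  have inD: "p + h \<in> D" "p + h \<in> ball p r" if "norm h < r / 2" for h
  proof -
    have "dist p (p + h) = norm h" by (metis add_diff_cancel_left' dist_commute dist_norm)
    thus "p + h \<in> ball p r" using that r by simp
    thus "p + h \<in> D" using sub by blast
  qed
  have int_g: "integrable M (g q)" if "q \<in> ball p r" for q
  proof (rule Bochner_Integration.integrable_bound[OF w])
    show "g q \<in> borel_measurable M" using that sub meas by blast
    show "AE x in M. norm (g q x) \<le> norm (w x)"
      using bd[OF that] by (intro AE_I2) force
  qed
  \<comment> \<open>\<open>u\<close> and \<open>v\<close> come from a choice at each point, so their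
    measurability is not automatic. In a direction \<open>d\<close> of norm 1 they combine to a
    limit of the measurable difference quotients \<open>s n\<close>, with steps \<open>e n\<close>
    below r / 2.\<close>
  have int_dir: "integrable M (\<lambda>x. u x * fst d + v x * snd d)" if d: "norm d = 1" for d :: "complex \<times> complex"
  proof -
    define e where "e n = r / (real n + 3)" for n :: nat
    have e: "e n > 0" "e n < r / 2" for n using r by (auto simp: e_def field_simps add_pos_nonneg)
    have ned: "norm (e n *\<^sub>R d) = e n" for n using e(1)[of n] d by simp
    define s where "s n x = (g (p + e n *\<^sub>R d) x - g p x) / of_real (e n)" for n x
    have s: "cmod (s n x - (u x * fst d + v x * snd d)) \<le> 8 * w x / r\<^sup>2 * e n" if "x \<in> space M" for n x
    proof -
      have "s n x - (u x * fst d + v x * snd d)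
          = (g (p + e n *\<^sub>R d) x - g p x - (u x * fst (e n *\<^sub>R d) + v x * snd (e n *\<^sub>R d))) / of_real (e n)"
        using e(1)[of n] by (simp add: s_def field_simps scaleR_conv_of_real)
      moreover have "cmod (g (p + e n *\<^sub>R d) x - g p x - (u x * fst (e n *\<^sub>R d) + v x * snd (e n *\<^sub>R d)))
          \<le> 8 * w x / r\<^sup>2 * (e n)\<^sup>2"
        using rem[OF that, of "e n *\<^sub>R d"] e(2)[of n] unfolding ned by blast
      ultimately have "cmod (s n x - (u x * fst d + v x * snd d)) \<le> (8 * w x / r\<^sup>2 * (e n)\<^sup>2) / e n"
        using e(1)[of n] by (simp only: norm_divide norm_of_real abs_of_pos divide_right_mono less_imp_le)
      also have "\<dots> = 8 * w x / r\<^sup>2 * e n" using e(1)[of n] by (simp add: power2_eq_square)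
      finally show ?thesis .
    qed
    have lim: "(\<lambda>n. s n x) \<longlonglongrightarrow> u x * fst d + v x * snd d" if "x \<in> space M" for x
    proof -
      have "e \<longlonglongrightarrow> 0" unfolding e_def by real_asymp
      hence "(\<lambda>n. 8 * w x / r\<^sup>2 * e n) \<longlonglongrightarrow> 0" by (rule tendsto_mult_right_zero)
      hence "(\<lambda>n. s n x - (u x * fst d + v x * snd d)) \<longlonglongrightarrow> 0"
        by (rule Lim_null_comparison[rotated]) (use s[OF that] in auto)
      thus ?thesis by (simp add: LIM_zero_iff)
    qed
    have "(\<lambda>x. u x * fst d + v x * snd d) \<in> borel_measurable M"
    proof (rule borel_measurable_LIMSEQ_metric[OF _ lim])
      fix n
      have "p + e n *\<^sub>R d \<in> D" using inD(1)[of "e n *\<^sub>R d"] ned[of n] e[of n] by simp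
      from meas[OF this] meas[OF p] show "s n \<in> borel_measurable M"
        unfolding s_def by measurable
    qed
    \<comment> \<open>The first step e 0 = r / 3 already bounds the derivative: the quotient is at
      most 2 w x / (r / 3), and its error at most 8 w x / r^2 times r / 3.\<close>
    moreover have "cmod (u x * fst d + v x * snd d) \<le> norm ((6 / r + 8 / (3 * r)) * w x)" if x: "x \<in> space M" for x
    proof -
      have "cmod (g (p + e 0 *\<^sub>R d) x - g p x) \<le> w x + w x"
        using bd[OF inD(2)[of "e 0 *\<^sub>R d"] x] bd[OF _ x, of p] ned[of 0] e[of 0] r
        by (intro order_trans[OF norm_triangle_ineq4] add_mono) auto
      hence "cmod (s 0 x) \<le> (w x + w x) / e 0"
        using e(1)[of 0] by (simp add: s_def norm_divide divide_right_mono)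
      hence "cmod (u x * fst d + v x * snd d) \<le> (w x + w x) / e 0 + 8 * w x / r\<^sup>2 * e 0"
        using s[OF x, of 0] norm_triangle_ineq2[of "u x * fst d + v x * snd d" "s 0 x"]
        by (simp add: norm_minus_commute)
      also have "\<dots> = (6 / r + 8 / (3 * r)) * w x"
        using r by (simp add: e_def field_simps power2_eq_square)
      also have "\<dots> \<le> norm \<dots>" by (simp only: real_norm_def abs_ge_self)
      finally show ?thesis .
    qed
    ultimately show ?thesis
      using w by (intro Bochner_Integration.integrable_bound[OF integrable_mult_right[OF w, of "6 / r + 8 / (3 * r)"]]) auto
  qed
  have u: "integrable M u" using int_dir[of "(1, 0)"] by simp
  have v: "integrable M v" using int_dir[of "(0, 1)"] by simp
  have bound: "cmod ((\<integral>x. g (p + h) x \<partial>M) - (\<integral>x. g p x \<partial>M) - ((\<integral>x. u x \<partial>M) * fst h + (\<integral>x. v x \<partial>M) * snd h))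
      \<le> (8 * (\<integral>x. w x \<partial>M) / r\<^sup>2) * (norm h)\<^sup>2" if h: "norm h < r / 2" for h
  proof -
    have ints: "integrable M (g (p + h))" "integrable M (g p)"
      using int_g inD(2)[OF h] r by auto
    have "(\<integral>x. g (p + h) x \<partial>M) - (\<integral>x. g p x \<partial>M) - ((\<integral>x. u x \<partial>M) * fst h + (\<integral>x. v x \<partial>M) * snd h)
        = (\<integral>x. g (p + h) x - g p x - (u x * fst h + v x * snd h) \<partial>M)"
      using ints u v by simp
    also have "cmod \<dots> \<le> (\<integral>x. cmod (g (p + h) x - g p x - (u x * fst h + v x * snd h)) \<partial>M)"
      by (rule integral_norm_bound)
    also have "\<dots> \<le> (\<integral>x. (8 / r\<^sup>2 * (norm h)\<^sup>2) * w x \<partial>M)"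
    proof (rule integral_mono)
      show "integrable M (\<lambda>x. cmod (g (p + h) x - g p x - (u x * fst h + v x * snd h)))"
        using ints u v by (intro integrable_norm Bochner_Integration.integrable_diff
            Bochner_Integration.integrable_add integrable_mult_left) auto
    qed (use w rem h in \<open>auto simp: mult_ac\<close>)
    also have "\<dots> = (8 * (\<integral>x. w x \<partial>M) / r\<^sup>2) * (norm h)\<^sup>2" using w by simp
    finally show ?thesis .
  qed
  have "((\<lambda>p. \<integral>x. g p x \<partial>M) has_derivative (\<lambda>h. (\<integral>x. u x \<partial>M) * fst h + (\<integral>x. v x \<partial>M) * snd h)) (at p)"
    unfolding has_derivative_at
  proof (intro conjI)
    show "bounded_linear (\<lambda>h. (\<integral>x. u x \<partial>M) * fst h + (\<integral>x. v x \<partial>M) * snd h)"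
      by (intro bounded_linear_add bounded_linear_compose[OF bounded_linear_mult_right]
          bounded_linear_fst bounded_linear_snd)
    define K where "K = 8 * (\<integral>x. w x \<partial>M) / r\<^sup>2"
    have "((\<lambda>h :: complex \<times> complex. K * norm h) \<longlongrightarrow> K * norm (0 :: complex \<times> complex)) (at 0)"
      by (intro tendsto_intros)
    hence K: "((\<lambda>h :: complex \<times> complex. K * norm h) \<longlongrightarrow> 0) (at 0)" by simp
    have ev: "\<forall>\<^sub>F h in at 0. norm (norm ((\<integral>x. g (p + h) x \<partial>M) - (\<integral>x. g p x \<partial>M) - ((\<integral>x. u x \<partial>M) * fst h + (\<integral>x. v x \<partial>M) * snd h)) / norm h) \<le> K * norm h"
      unfolding eventually_at
    proof (intro exI[of _ "r / 2"] conjI ballI impI)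
      fix h :: "complex \<times> complex"
      assume "h \<noteq> 0 \<and> dist h 0 < r / 2"
      hence h: "h \<noteq> 0" "norm h < r / 2" by auto
      thus "norm (norm ((\<integral>x. g (p + h) x \<partial>M) - (\<integral>x. g p x \<partial>M) - ((\<integral>x. u x \<partial>M) * fst h + (\<integral>x. v x \<partial>M) * snd h)) / norm h) \<le> K * norm h"
        using bound[OF h(2)] by (simp add: K_def field_simps power2_eq_square)
    qed (use r in auto)
    show "(\<lambda>h. norm ((\<integral>x. g (p + h) x \<partial>M) - (\<integral>x. g p x \<partial>M) - ((\<integral>x. u x \<partial>M) * fst h + (\<integral>x. v x \<partial>M) * snd h)) / norm h) \<midarrow>0\<rightarrow> 0"
      by (rule Lim_null_comparison[OF ev K])
  qed
  thus "\<exists>u v. ((\<lambda>p. \<integral>x. g p x \<partial>M) has_derivative (\<lambda>h. u * fst h + v * snd h)) (at p)" by blast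
qed

text \<open>An exponential is monotone in t, so on an interval it is bounded by the larger of its
  end values; their sum serves for both signs of \<open>A\<close> and stays integrable.\<close>

lemma exp_mult_le_corners:
  fixes A c d t :: real
  assumes "c \<le> t" "t \<le> d"
  shows "exp (t * A) \<le> exp (c * A) + exp (d * A)"
proof (cases "A \<ge> 0")
  case True
  hence "t * A \<le> d * A" using assms by (intro mult_right_mono)
  hence "exp (t * A) \<le> exp (d * A)" by simp
  thus ?thesis by (simp add: add_increasing)
next
  case False
  hence "t * A \<le> c * A" using assms by (intro mult_right_mono_neg) auto
  hence "exp (t * A) \<le> exp (c * A)" by simp
  thus ?thesis by (simp add: add_increasing2)
qed

text \<open>Integrability at each point of an open set supplies the domination: near p the modulus
  of the integrand is at most the sum of its moduli at four points, obtained from p by real shifts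
  of both exponents.\<close>

lemma holomorphic2_on_integral_exp:
  fixes A B :: "'a \<Rightarrow> real" and W :: "'a \<Rightarrow> complex"
  assumes D: "open D"
    and int: "\<And>p. p \<in> D \<Longrightarrow> integrable M (\<lambda>x. exp (fst p * of_real (A x) + snd p * of_real (B x)) * W x)"
  shows "holomorphic2_on (\<lambda>p. \<integral>x. exp (fst p * of_real (A x) + snd p * of_real (B x)) * W x \<partial>M) D"
proof (rule holomorphic2_on_integral)
  fix x
  have "holomorphic2_on (\<lambda>p. exp (fst p * of_real (A x) + snd p * of_real (B x))) D"
    by (rule holomorphic2_on_compose[of exp UNIV])
       (auto intro!: holomorphic_intros holomorphic2_intros)
  thus "holomorphic2_on (\<lambda>p. exp (fst p * of_real (A x) + snd p * of_real (B x)) * W x) D"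
    by (intro holomorphic2_intros)
next
  fix p assume p: "p \<in> D"
  show "(\<lambda>x. exp (fst p * of_real (A x) + snd p * of_real (B x)) * W x) \<in> borel_measurable M"
    using int[OF p] by (rule borel_measurable_integrable)
  obtain e where e: "e > 0" "ball p e \<subseteq> D" using D p by (auto elim: openE)
  \<comment> \<open>A quarter of the radius keeps the four shifted points, at distance at most 2
    \<rho> from p, inside \<open>D\<close>.\<close>
  define \<rho> where "\<rho> = e / 4"
  have \<rho>: "\<rho> > 0" "ball p \<rho> \<subseteq> D" using e by (auto simp: \<rho>_def)
  define c where "c s t = p + (complex_of_real s, complex_of_real t)" for s t :: real
  have c: "c s t \<in> D" if "\<bar>s\<bar> = \<rho>" "\<bar>t\<bar> = \<rho>" for s t
  proof -
    have "dist p (c s t) = norm (complex_of_real s, complex_of_real t)"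
      unfolding c_def by (metis add_diff_cancel_left' dist_commute dist_norm)
    also have "\<dots> \<le> \<rho> + \<rho>" using norm_Pair_le[of "complex_of_real s" "complex_of_real t"] that by simp
    also have "\<dots> < e" using e by (simp add: \<rho>_def)
    finally show ?thesis using e by auto
  qed
  define E where "E q x = exp (fst q * complex_of_real (A x) + snd q * of_real (B x)) * W x" for q :: "complex \<times> complex" and x
  define w where "w x = cmod (E (c (-\<rho>) (-\<rho>)) x) + cmod (E (c (-\<rho>) \<rho>) x) + (cmod (E (c \<rho> (-\<rho>)) x) + cmod (E (c \<rho> \<rho>) x))" for x
  have nE: "cmod (E q x) = exp (Re (fst q) * A x) * exp (Re (snd q) * B x) * cmod (W x)" for q x
    by (simp add: E_def norm_mult exp_add)
  have int_w: "integrable M w"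
    unfolding w_def using \<rho>(1)
    by (intro Bochner_Integration.integrable_add integrable_norm int[folded E_def] c) auto
  have "cmod (E q x) \<le> w x" if q: "q \<in> ball p \<rho>" for q x
  proof -
    have "\<bar>Re (fst q) - Re (fst p)\<bar> \<le> dist q p" "\<bar>Re (snd q) - Re (snd p)\<bar> \<le> dist q p"
      using dist_fst_le[of q p] dist_snd_le[of q p] abs_Re_le_cmod[of "fst q - fst p"] abs_Re_le_cmod[of "snd q - snd p"]
      by (auto simp: dist_norm)
    hence le: "Re (fst p) - \<rho> \<le> Re (fst q)" "Re (fst q) \<le> Re (fst p) + \<rho>"
      "Re (snd p) - \<rho> \<le> Re (snd q)" "Re (snd q) \<le> Re (snd p) + \<rho>"
      using q by (auto simp: dist_commute abs_le_iff)
    have "cmod (E q x) \<le> (exp ((Re (fst p) - \<rho>) * A x) + exp ((Re (fst p) + \<rho>) * A x)) *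
        (exp ((Re (snd p) - \<rho>) * B x) + exp ((Re (snd p) + \<rho>) * B x)) * cmod (W x)"
      unfolding nE by (intro mult_mono exp_mult_le_corners le mult_nonneg_nonneg add_nonneg_nonneg) auto
    also have "\<dots> = w x"
      by (simp add: w_def nE c_def algebra_simps)
    finally show ?thesis .
  qed
  thus "\<exists>r>0. \<exists>w. integrable M w \<and> ball p r \<subseteq> D \<and>
      (\<forall>q\<in>ball p r. \<forall>x\<in>space M. cmod (exp (fst q * complex_of_real (A x) + snd q * complex_of_real (B x)) * W x) \<le> w x)"
    using \<rho> int_w unfolding E_def by blast
qed

text \<open>A path in \<open>D\<close> from \<open>R\<close> to \<open>T\<close> is bounded, so that it stays in a half-space \<open>Re \<alpha> > - M\<close>, where a
  multiple of \<open>J\<close> is known to be \<open>Hp\<close>; poles of \<open>J\<close> further to the left do not matter.\<close>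

lemma continuation_unique:
  assumes D: "open D" "connected D" and J: "holomorphic2_on J D"
    and R: "open R" "R \<noteq> {}" "R \<subseteq> D" and T: "connected T" "bounded T" "T \<noteq> {}" "T \<subseteq> D"
  shows "\<exists>M0. \<forall>M\<ge>M0. \<forall>Q Hp. holomorphic2_on (\<lambda>p. Q (fst p)) {p. Re (fst p) > - M} \<longrightarrow>
      holomorphic2_on Hp {p. Re (fst p) > - M} \<longrightarrow>
      (\<forall>p\<in>R. Re (fst p) > - M \<longrightarrow> Q (fst p) * J p = Hp p) \<longrightarrow>
      (\<forall>p\<in>T. Re (fst p) > - M \<and> Q (fst p) * J p = Hp p)"
proof -
  obtain a t where a: "a \<in> R" and t: "t \<in> T" using R T by blast
  have "path_connected D" using D connected_open_path_connected by blast
  then obtain \<gamma> where \<gamma>: "path \<gamma>" "path_image \<gamma> \<subseteq> D" "pathstart \<gamma> = a" "pathfinish \<gamma> = t"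
    using a t R T unfolding path_connected_def by blast
  define K where "K = path_image \<gamma> \<union> T"
  have at: "a \<in> path_image \<gamma>" "t \<in> path_image \<gamma>" using \<gamma> by (metis pathstart_in_path_image, metis pathfinish_in_path_image)
  have K: "connected K" "K \<subseteq> D" "a \<in> K" "bounded K"
    unfolding K_def using \<gamma> T at t
    by (auto intro!: connected_Un connected_path_image bounded_path_image)
  obtain B where B: "\<And>p. p \<in> K \<Longrightarrow> norm p \<le> B" using K(4) by (auto simp: bounded_iff)
  show ?thesis
  proof (intro exI[of _ "B + 1"] allI impI ballI)
    fix M Q Hp p
    assume M: "B + 1 \<le> M" and Q: "holomorphic2_on (\<lambda>p. Q (fst p)) {p. Re (fst p) > - M}"
      and Hp: "holomorphic2_on Hp {p. Re (fst p) > - M}"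
      and eq: "\<forall>p\<in>R. Re (fst p) > - M \<longrightarrow> Q (fst p) * J p = Hp p" and p: "p \<in> T"
    define U where "U = {p :: complex \<times> complex. Re (fst p) > - M}"
    have U: "open U" unfolding U_def by (intro open_Collect_less continuous_intros)
    have KU: "K \<subseteq> U"
    proof
      fix q assume "q \<in> K"
      hence "norm q < M" using B[of q] M by simp
      hence "\<bar>Re (fst q)\<bar> < M"
        using abs_Re_le_cmod[of "fst q"] norm_fst_le[of "fst q" "snd q"] by simp
      thus "q \<in> U" by (simp add: U_def)
    qed
    \<comment> \<open>The part of \<open>D\<close> in the half-space need not be connected, but the
      path and \<open>T\<close> form a connected set through \<open>a\<close> and so lie in a single
      component, where the identity theorem applies.\<close>
    define C where "C = connected_component_set (D \<inter> U) a"
    have C: "open C" "connected C"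
      unfolding C_def using D(1) U by (auto intro!: open_connected_component)
    have CDU: "C \<subseteq> D \<inter> U" unfolding C_def by (rule connected_component_subset)
    have KC: "K \<subseteq> C" unfolding C_def
      using K KU by (intro connected_component_maximal) auto
    note C = C CDU KC
    have "Q (fst p) * J p - Hp p = 0"
    proof (rule holomorphic2_on_identity[OF C(1,2), of "\<lambda>p. Q (fst p) * J p - Hp p" "C \<inter> R"])
      show "holomorphic2_on (\<lambda>p. Q (fst p) * J p - Hp p) C"
        using C(3) by (intro holomorphic2_intros holomorphic2_on_subset[OF J]
            holomorphic2_on_subset[OF Q] holomorphic2_on_subset[OF Hp]) (auto simp: U_def)
      show "C \<inter> R \<noteq> {}" using a K C by blast
      show "Q (fst q) * J q - Hp q = 0" if "q \<in> C \<inter> R" for q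
        using that eq C(3) by (auto simp: U_def)
      show "p \<in> C" using p C(4) by (auto simp: K_def)
    qed (use C R in auto)
    moreover have "p \<in> U" using p KU by (auto simp: K_def)
    ultimately show "Re (fst p) > - M \<and> Q (fst p) * J p = Hp p" by (simp add: U_def)
  qed
qed


section \<open>Finite parts at a simple pole\<close>

lemma has_FP_simple_pole:
  assumes H: "H holomorphic_on ball 0 \<delta>" and \<delta>: "\<delta> > 0"
    and eq: "\<And>z. z \<in> ball 0 \<delta> \<Longrightarrow> z \<noteq> 0 \<Longrightarrow> z * f z = H z"
  shows "has_FP f (deriv H 0)"
proof -
  have "H has_fps_expansion fps_expansion H 0"
    using \<delta> by (intro has_fps_expansion_fps_expansion[OF open_ball _ H]) auto
  \<comment> \<open>Division by z shifts the Taylor series by one place, so that the linear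
    coefficient of \<open>H\<close> becomes the constant one.\<close>
  from has_laurent_expansion_shift'[OF has_laurent_expansion_fps[OF this], of 1]
  have "(\<lambda>z. H z * z powi (-1)) has_laurent_expansion fls_shift 1 (fps_to_fls (fps_expansion H 0))" .
  note L = this
  have ev: "\<forall>\<^sub>F z in at 0. H z * z powi (-1) = f z"
    unfolding eventually_at
    by (intro exI[of _ \<delta>]) (use \<delta> eq in \<open>auto simp: power_int_minus field_simps simp flip: eq\<close>)
  have "f has_laurent_expansion fls_shift 1 (fps_to_fls (fps_expansion H 0))"
    using L unfolding has_laurent_expansion_cong[OF ev refl] .
  moreover have "fls_nth (fls_shift 1 (fps_to_fls (fps_expansion H 0))) 0 = deriv H 0"
    by (simp add: fps_expansion_def)
  ultimately show ?thesis unfolding has_FP_def by blast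
qed

lemma has_FP_unique: "has_FP f c \<Longrightarrow> has_FP f d \<Longrightarrow> c = d"
  unfolding has_FP_def using has_laurent_expansion_unique by blast

lemma has_FP_cong:
  assumes "has_FP f c" "\<forall>\<^sub>F z in at 0. f z = g z"
  shows "has_FP g c"
  using assms has_laurent_expansion_cong[OF _ refl] unfolding has_FP_def by blast

lemma has_FP_add: "has_FP f c \<Longrightarrow> has_FP g d \<Longrightarrow> has_FP (\<lambda>z. f z + g z) (c + d)"
  unfolding has_FP_def using has_laurent_expansion_add by fastforce

lemma has_FP_cmult: "has_FP f c \<Longrightarrow> has_FP (\<lambda>z. k * f z) (k * c)"
  unfolding has_FP_def using has_laurent_expansion_cmult_left by fastforce

lemma has_FP_analytic:
  assumes "f holomorphic_on ball 0 \<delta>" "\<delta> > 0"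
  shows "has_FP f (f 0)"
proof -
  have d: "(f has_field_derivative deriv f 0) (at 0)"
    by (rule holomorphic_derivI[OF assms(1)]) (use assms in auto)
  have "((\<lambda>z. z * f z) has_field_derivative f 0) (at 0)"
    by (rule derivative_eq_intros d refl)+ simp
  hence "deriv (\<lambda>z. z * f z) 0 = f 0" by (rule DERIV_imp_deriv)
  moreover have "has_FP f (deriv (\<lambda>z. z * f z) 0)"
    by (rule has_FP_simple_pole[of _ \<delta>]) (use assms in \<open>auto intro!: holomorphic_intros\<close>)
  ultimately show ?thesis by simp
qed

lemma has_FP_sum_list:
  assumes "\<And>x. x \<in> set xs \<Longrightarrow> has_FP (f x) (c x)"
  shows "has_FP (\<lambda>z. \<Sum>x\<leftarrow>xs. f x z) (\<Sum>x\<leftarrow>xs. c x)"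
  using assms
proof (induction xs)
  case Nil
  show ?case using has_FP_analytic[of "\<lambda>_. 0" 1] by simp
qed (auto intro!: has_FP_add)

section \<open>Iterated finite parts of a sum with separate simple poles\<close>

lemma pair_mem_ball_0:
  assumes "z \<in> ball 0 (\<delta> / 2)" "w \<in> ball 0 (\<delta> / 2)"
  shows "(z, w) \<in> ball (0 :: complex \<times> complex) \<delta>"
  using assms norm_Pair_le[of z w] by auto

lemma holomorphic2_on_slice:
  assumes "holomorphic2_on f (ball 0 \<delta>)"
  shows "w \<in> ball 0 (\<delta> / 2) \<Longrightarrow> (\<lambda>z. f (z, w)) holomorphic_on ball 0 (\<delta> / 2)"
    and "z \<in> ball 0 (\<delta> / 2) \<Longrightarrow> (\<lambda>w. f (z, w)) holomorphic_on ball 0 (\<delta> / 2)"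
proof -
  show "(\<lambda>z. f (z, w)) holomorphic_on ball 0 (\<delta> / 2)" if "w \<in> ball 0 (\<delta> / 2)"
    using holomorphic2_on_line_holomorphic[OF assms, of "ball 0 (\<delta> / 2)" "(0, w)" "(1, 0)"]
      pair_mem_ball_0[OF _ that] by simp
  show "(\<lambda>w. f (z, w)) holomorphic_on ball 0 (\<delta> / 2)" if "z \<in> ball 0 (\<delta> / 2)"
    using holomorphic2_on_line_holomorphic[OF assms, of "ball 0 (\<delta> / 2)" "(z, 0)" "(0, 1)"]
      pair_mem_ball_0[OF that] by simp
qed

text \<open>The inner finite part contains this derivative as a function of the outer variable, and
  the outer finite part needs a Laurent expansion of it. The derivative is a locally uniform limit
  of difference quotients in the first variable, each holomorphic in the second.\<close>

lemma holomorphic_partial_deriv: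
  assumes H: "holomorphic2_on H (ball 0 \<delta>)" and \<delta>: "\<delta> > 0"
  shows "(\<lambda>w. deriv (\<lambda>z. H (z, w)) 0) holomorphic_on ball 0 (\<delta> / 4)"
proof -
  define r where "r = \<delta> / 4"
  have r: "r > 0" using \<delta> by (simp add: r_def)
  \<comment> \<open>\<open>H\<close> may be unbounded on the open ball, so a bound is taken on the
    closed ball of half the radius. This contains the ball of radius r = \<delta> / 4 around (0, w)
    whenever cmod w < r.\<close>
  have "cball 0 (\<delta> / 2) \<subseteq> ball (0 :: complex \<times> complex) \<delta>" using \<delta> by auto
  hence "continuous_on (cball 0 (\<delta> / 2)) H"
    by (rule continuous_on_subset[OF holomorphic2_on_imp_continuous_on[OF H]])
  hence "bounded (H ` cball 0 (\<delta> / 2))"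
    by (intro compact_imp_bounded compact_continuous_image) auto
  then obtain B where "\<forall>x\<in>H ` cball 0 (\<delta> / 2). cmod x \<le> B"
    unfolding bounded_iff ..
  hence B: "cmod (H p) \<le> B" if "p \<in> cball 0 (\<delta> / 2)" for p
    using that by blast
  define G where "G w = deriv (\<lambda>z. H (z, w)) 0" for w
  define e where "e n = r / (real n + 3)" for n :: nat
  have e: "e n > 0" "e n < r / 2" for n using r by (auto simp: e_def field_simps add_pos_nonneg)
  have e0: "e \<longlonglongrightarrow> 0" unfolding e_def by real_asymp
  define s where "s n w = (H (of_real (e n), w) - H (0, w)) / of_real (e n)" for n w
  have bound: "cmod (s n w - G w) \<le> 8 * B / r\<^sup>2 * e n" if w: "w \<in> ball 0 r" for n w
  proof -
    have sub: "ball (0 :: complex, w) r \<subseteq> cball 0 (\<delta> / 2)"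
    proof
      fix q :: "complex \<times> complex" assume "q \<in> ball (0, w) r"
      moreover have "norm q \<le> dist (0, w) q + cmod w"
        using norm_triangle_ineq[of "q - (0, w)" "(0, w)"] by (simp add: dist_norm norm_minus_commute norm_Pair)
      ultimately show "q \<in> cball 0 (\<delta> / 2)" using w by (simp add: r_def)
    qed
    moreover have "cball 0 (\<delta> / 2) \<subseteq> ball (0 :: complex \<times> complex) \<delta>" using \<delta> by auto
    ultimately have sub': "ball (0 :: complex, w) r \<subseteq> ball 0 \<delta>" by (rule subset_trans)
    have "(0, w) \<in> ball (0 :: complex, w) r" using r by (simp only: centre_in_ball)
    with sub' have "(0 :: complex, w) \<in> ball 0 \<delta>" by (rule subsetD)
    then obtain u v where uv: "(H has_derivative (\<lambda>h. u * fst h + v * snd h)) (at (0, w))"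
      using holomorphic2_onD[OF H] by blast
    have "((\<lambda>z. (z, w)) has_derivative (\<lambda>z. (z, 0))) (at 0)"
      by (auto intro!: derivative_eq_intros)
    from has_derivative_compose[OF this uv]
    have "((\<lambda>z. H (z, w)) has_field_derivative u) (at 0)"
      by (rule has_derivative_imp_has_field_derivative) (simp add: mult.commute)
    hence u: "u = G w" unfolding G_def by (rule DERIV_imp_deriv[symmetric])
    have "cmod (H ((0, w) + (of_real (e n), 0)) - H (0, w) - (u * fst (complex_of_real (e n), 0 :: complex) + v * snd (complex_of_real (e n), 0 :: complex)))
        \<le> 8 * B / r\<^sup>2 * (norm (complex_of_real (e n), 0 :: complex))\<^sup>2"
      by (rule holomorphic2_remainder_bound[OF holomorphic2_on_subset[OF H sub'] r _ _ uv])
         (use e[of n] sub B in \<open>auto simp: norm_Pair\<close>)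
    hence "cmod (H (of_real (e n), w) - H (0, w) - G w * of_real (e n)) \<le> 8 * B / r\<^sup>2 * (e n)\<^sup>2"
      by (simp add: u norm_Pair)
    hence "cmod (H (of_real (e n), w) - H (0, w) - G w * of_real (e n)) / e n \<le> 8 * B / r\<^sup>2 * (e n)\<^sup>2 / e n"
      using e(1)[of n] by (intro divide_right_mono) auto
    moreover have "cmod (s n w - G w) = cmod ((H (of_real (e n), w) - H (0, w) - G w * of_real (e n)) / of_real (e n))"
      using e(1)[of n] by (simp add: s_def field_simps)
    ultimately show ?thesis using e(1)[of n] by (simp add: norm_divide power2_eq_square)
  qed
  have "G holomorphic_on ball 0 r"
  proof (rule holomorphic_uniform_sequence[OF open_ball])
    fix n
    have "complex_of_real (e n) \<in> ball 0 (\<delta> / 2)" using e[of n] r by (auto simp: r_def)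
    hence "(\<lambda>w. H (of_real (e n), w)) holomorphic_on ball 0 (\<delta> / 2)" "(\<lambda>w. H (0, w)) holomorphic_on ball 0 (\<delta> / 2)"
      using holomorphic2_on_slice(2)[OF H] \<delta> by auto
    hence "s n holomorphic_on ball 0 (\<delta> / 2)"
      unfolding s_def using e(1)[of n] by (intro holomorphic_intros) auto
    thus "s n holomorphic_on ball 0 r"
      by (rule holomorphic_on_subset) (use \<delta> in \<open>auto simp: r_def\<close>)
  next
    fix x :: complex assume x: "x \<in> ball 0 r"
    obtain d where d: "d > 0" "cball x d \<subseteq> ball 0 r"
      using x open_contains_cball[of "ball (0::complex) r"] by (metis open_ball)
    have "uniform_limit (cball x d) s G sequentially"
    proof (rule uniform_limitI)
      fix \<epsilon> :: real assume "\<epsilon> > 0"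
      have "(\<lambda>n. 8 * B / r\<^sup>2 * e n) \<longlonglongrightarrow> 0" by (rule tendsto_mult_right_zero[OF e0])
      hence "\<forall>\<^sub>F n in sequentially. 8 * B / r\<^sup>2 * e n < \<epsilon>"
        using \<open>\<epsilon> > 0\<close> by (rule order_tendstoD)
      thus "\<forall>\<^sub>F n in sequentially. \<forall>w\<in>cball x d. dist (s n w) (G w) < \<epsilon>"
        by eventually_elim (metis bound d(2) dist_norm le_less_trans subsetD)
    qed
    thus "\<exists>d>0. cball x d \<subseteq> ball 0 r \<and> uniform_limit (cball x d) s G sequentially"
      using d by blast
  qed
  thus ?thesis by (simp add: G_def[abs_def] r_def)
qed

text \<open>With \<beta> fixed and nonzero only the first summand can have a pole in \<alpha>. Its
  finite part is holomorphic in \<beta>, so the outer finite part sees only the pole of the second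
  summand. No product of the two poles appears, which makes the result symmetric.\<close>

lemma has_iterated_FP_sum:
  assumes \<delta>: "\<delta> > 0"
    and H1: "holomorphic2_on H1 (ball 0 \<delta>)" and H2: "holomorphic2_on H2 (ball 0 \<delta>)"
    and J3: "holomorphic2_on J3 (ball 0 \<delta>)"
    and J1: "\<And>\<alpha> \<beta>. (\<alpha>, \<beta>) \<in> ball 0 \<delta> \<Longrightarrow> \<alpha> \<noteq> 0 \<Longrightarrow> \<alpha> * J1 (\<alpha>, \<beta>) = H1 (\<alpha>, \<beta>)"
    and J2: "\<And>\<alpha> \<beta>. (\<alpha>, \<beta>) \<in> ball 0 \<delta> \<Longrightarrow> \<beta> \<noteq> 0 \<Longrightarrow> \<beta> * J2 (\<alpha>, \<beta>) = H2 (\<alpha>, \<beta>)"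
  shows "has_iterated_FP (\<lambda>\<beta> \<alpha>. J1 (\<alpha>, \<beta>) + J2 (\<alpha>, \<beta>) + J3 (\<alpha>, \<beta>))
    (deriv (\<lambda>\<alpha>. H1 (\<alpha>, 0)) 0 + deriv (\<lambda>\<beta>. H2 (0, \<beta>)) 0 + J3 (0, 0))"
proof -
  define r where "r = \<delta> / 4"
  have r: "r > 0" using \<delta> by (simp add: r_def)
  have sub: "ball 0 r \<subseteq> ball (0::complex) (\<delta> / 2)" using \<delta> by (auto simp: r_def)
  have mem: "(\<alpha>, \<beta>) \<in> ball 0 \<delta>" if "\<alpha> \<in> ball 0 r" "\<beta> \<in> ball 0 r" for \<alpha> \<beta> :: complex
    using that sub by (intro pair_mem_ball_0) auto
  have sl: "(\<lambda>\<alpha>. f (\<alpha>, \<beta>)) holomorphic_on ball 0 r" "(\<lambda>\<alpha>. f (\<beta>, \<alpha>)) holomorphic_on ball 0 r"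
    if "holomorphic2_on f (ball 0 \<delta>)" "\<beta> \<in> ball 0 r" for f \<beta>
    using holomorphic2_on_slice[OF that(1)] that(2) sub holomorphic_on_subset[OF _ sub] by blast+
  have dsl: "((\<lambda>\<alpha>. f (\<alpha>, \<beta>)) has_field_derivative deriv (\<lambda>\<alpha>. f (\<alpha>, \<beta>)) 0) (at 0)"
    "((\<lambda>\<alpha>. f (\<beta>, \<alpha>)) has_field_derivative deriv (\<lambda>\<alpha>. f (\<beta>, \<alpha>)) 0) (at 0)"
    if "holomorphic2_on f (ball 0 \<delta>)" "\<beta> \<in> ball 0 r" for f \<beta>
    using sl[OF that] r by (auto intro!: holomorphic_derivI[of _ "ball 0 r"])
  define G where "G \<beta> = deriv (\<lambda>\<alpha>. H1 (\<alpha>, \<beta>)) 0" for \<beta>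
  have G: "G holomorphic_on ball 0 r"
    unfolding G_def r_def by (rule holomorphic_partial_deriv[OF H1 \<delta>])
  define h where "h \<beta> = G \<beta> + (H2 (0, \<beta>) / \<beta> + J3 (0, \<beta>))" for \<beta>
  have inner: "has_FP (\<lambda>\<alpha>. J1 (\<alpha>, \<beta>) + J2 (\<alpha>, \<beta>) + J3 (\<alpha>, \<beta>)) (h \<beta>)"
    if \<beta>: "\<beta> \<in> ball 0 r" "\<beta> \<noteq> 0" for \<beta>
  proof -
    \<comment> \<open>\<alpha> times the sum, extended over \<alpha> = 0; its linear coefficient is
      the inner finite part.\<close>
    define P where "P \<alpha> = H1 (\<alpha>, \<beta>) + \<alpha> * (H2 (\<alpha>, \<beta>) / \<beta> + J3 (\<alpha>, \<beta>))" for \<alpha>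
    have "P holomorphic_on ball 0 r"
      unfolding P_def using \<beta> by (intro holomorphic_intros sl H1 H2 J3) auto
    moreover have "\<alpha> * (J1 (\<alpha>, \<beta>) + J2 (\<alpha>, \<beta>) + J3 (\<alpha>, \<beta>)) = P \<alpha>" if "\<alpha> \<in> ball 0 r" "\<alpha> \<noteq> 0" for \<alpha>
    proof -
      have "J2 (\<alpha>, \<beta>) = H2 (\<alpha>, \<beta>) / \<beta>"
        using J2[OF mem[OF that(1) \<beta>(1)] \<beta>(2)] \<beta>(2) by (simp add: field_simps)
      thus ?thesis using J1[OF mem[OF that(1) \<beta>(1)] that(2)] by (simp add: P_def algebra_simps)
    qed
    ultimately have "has_FP (\<lambda>\<alpha>. J1 (\<alpha>, \<beta>) + J2 (\<alpha>, \<beta>) + J3 (\<alpha>, \<beta>)) (deriv P 0)"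
      using r by (intro has_FP_simple_pole[of P r]) auto
    moreover have "(P has_field_derivative h \<beta>) (at 0)"
      unfolding P_def
      by (rule derivative_eq_intros dsl[OF H1 \<beta>(1)] dsl[OF H2 \<beta>(1)] dsl[OF J3 \<beta>(1)] refl \<beta>(2))+
         (simp add: h_def G_def)
    hence "deriv P 0 = h \<beta>" by (rule DERIV_imp_deriv)
    ultimately show ?thesis by simp
  qed
  have z: "0 \<in> ball (0::complex) r" using r by simp
  \<comment> \<open>\<beta> times the inner finite part, again extended over 0.\<close>
  define P where "P \<beta> = \<beta> * (G \<beta> + J3 (0, \<beta>)) + H2 (0, \<beta>)" for \<beta>
  have "P holomorphic_on ball 0 r"
    unfolding P_def by (intro holomorphic_intros sl G H2 J3 z)
  hence "has_FP h (deriv P 0)"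
    using r by (rule has_FP_simple_pole) (auto simp: P_def h_def algebra_simps)
  moreover have "(P has_field_derivative (deriv (\<lambda>\<alpha>. H1 (\<alpha>, 0)) 0 + deriv (\<lambda>\<beta>. H2 (0, \<beta>)) 0 + J3 (0, 0))) (at 0)"
    unfolding P_def
    by (rule derivative_eq_intros dsl[OF H2 z] dsl[OF J3 z] holomorphic_derivI[OF G open_ball z] refl)+
       (simp add: G_def)
  hence "deriv P 0 = deriv (\<lambda>\<alpha>. H1 (\<alpha>, 0)) 0 + deriv (\<lambda>\<beta>. H2 (0, \<beta>)) 0 + J3 (0, 0)"
    by (rule DERIV_imp_deriv)
  moreover have "\<forall>\<^sub>F \<beta> in at 0. has_FP (\<lambda>\<alpha>. J1 (\<alpha>, \<beta>) + J2 (\<alpha>, \<beta>) + J3 (\<alpha>, \<beta>)) (h \<beta>)"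
    unfolding eventually_at using inner r by (intro exI[of _ r]) auto
  ultimately show ?thesis unfolding has_iterated_FP_def by auto
qed

lemma mem_swap_ball: "prod.swap p \<in> ball (0 :: complex \<times> complex) \<delta> \<longleftrightarrow> p \<in> ball 0 \<delta>"
  by (cases p) (simp add: norm_Pair add.commute)

lemma holomorphic2_on_swap:
  assumes "holomorphic2_on f D"
  shows "holomorphic2_on (\<lambda>p. f (prod.swap p)) (prod.swap -` D)"
proof (rule holomorphic2_onI)
  fix p assume p: "p \<in> prod.swap -` D"
  obtain u v where f: "(f has_derivative (\<lambda>h. u * fst h + v * snd h)) (at (prod.swap p))"
    using assms p holomorphic2_onD by blast
  have "(prod.swap has_derivative prod.swap) (at p)"
    unfolding prod.swap_def by (auto intro!: derivative_eq_intros)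
  from has_derivative_compose[OF this f]
  have "((\<lambda>p. f (prod.swap p)) has_derivative (\<lambda>h. v * fst h + u * snd h)) (at p)"
    by (simp add: add.commute)
  thus "\<exists>u v. ((\<lambda>p. f (prod.swap p)) has_derivative (\<lambda>h. u * fst h + v * snd h)) (at p)" by blast
qed

lemma holomorphic2_on_swap_ball:
  assumes "holomorphic2_on f (ball 0 \<delta>)"
  shows "holomorphic2_on (\<lambda>p. f (prod.swap p)) (ball 0 \<delta>)"
proof -
  have "prod.swap -` ball (0 :: complex \<times> complex) \<delta> = ball 0 \<delta>"
    using mem_swap_ball by blast
  thus ?thesis using holomorphic2_on_swap[OF assms] by simp
qed

text \<open>The hypotheses and \<open>c\<close> are preserved when the two variables are exchanged
  together with the first two summands, so the second order of finite parts is an instance of the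
  first.\<close>

lemma has_iterated_FP_sum_both:
  assumes "\<delta> > 0"
    and "holomorphic2_on H1 (ball 0 \<delta>)" and "holomorphic2_on H2 (ball 0 \<delta>)"
    and "holomorphic2_on J3 (ball 0 \<delta>)"
    and "\<And>\<alpha> \<beta>. (\<alpha>, \<beta>) \<in> ball 0 \<delta> \<Longrightarrow> \<alpha> \<noteq> 0 \<Longrightarrow> \<alpha> * J1 (\<alpha>, \<beta>) = H1 (\<alpha>, \<beta>)"
    and "\<And>\<alpha> \<beta>. (\<alpha>, \<beta>) \<in> ball 0 \<delta> \<Longrightarrow> \<beta> \<noteq> 0 \<Longrightarrow> \<beta> * J2 (\<alpha>, \<beta>) = H2 (\<alpha>, \<beta>)"
  defines "c \<equiv> deriv (\<lambda>\<alpha>. H1 (\<alpha>, 0)) 0 + deriv (\<lambda>\<beta>. H2 (0, \<beta>)) 0 + J3 (0, 0)"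
  shows "has_iterated_FP (\<lambda>\<beta> \<alpha>. J1 (\<alpha>, \<beta>) + J2 (\<alpha>, \<beta>) + J3 (\<alpha>, \<beta>)) c"
    and "has_iterated_FP (\<lambda>\<alpha> \<beta>. J1 (\<alpha>, \<beta>) + J2 (\<alpha>, \<beta>) + J3 (\<alpha>, \<beta>)) c"
proof -
  show "has_iterated_FP (\<lambda>\<beta> \<alpha>. J1 (\<alpha>, \<beta>) + J2 (\<alpha>, \<beta>) + J3 (\<alpha>, \<beta>)) c"
    unfolding c_def by (rule has_iterated_FP_sum[OF assms(1-6)])
  have sw: "(\<beta>, \<alpha>) \<in> ball 0 \<delta>" if "(\<alpha>, \<beta>) \<in> ball (0 :: complex \<times> complex) \<delta>" for \<alpha> \<beta>
    using that mem_swap_ball[of "(\<alpha>, \<beta>)" \<delta>] by simp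
  have "has_iterated_FP (\<lambda>\<beta> \<alpha>. J2 (prod.swap (\<alpha>, \<beta>)) + J1 (prod.swap (\<alpha>, \<beta>)) + J3 (prod.swap (\<alpha>, \<beta>)))
     (deriv (\<lambda>\<alpha>. H2 (prod.swap (\<alpha>, 0))) 0 + deriv (\<lambda>\<beta>. H1 (prod.swap (0, \<beta>))) 0 + J3 (prod.swap (0, 0)))"
    by (rule has_iterated_FP_sum[OF assms(1) holomorphic2_on_swap_ball[OF assms(3)]
         holomorphic2_on_swap_ball[OF assms(2)] holomorphic2_on_swap_ball[OF assms(4)]])
       (use assms(5,6) sw in auto)
  thus "has_iterated_FP (\<lambda>\<alpha> \<beta>. J1 (\<alpha>, \<beta>) + J2 (\<alpha>, \<beta>) + J3 (\<alpha>, \<beta>)) c"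
    by (simp add: c_def add.commute)
qed

subsection \<open>Expansions at a singular point\<close>

abbreviation dir :: "real ^ 3 \<Rightarrow> real ^ 3 \<Rightarrow> real ^ 3" where
  "dir y x \<equiv> (x - y) /\<^sub>R norm (x - y)"

lemma norm_dir: "x \<noteq> y \<Longrightarrow> norm (dir y x) = 1"
  by simp

lemma finite_exponents:
  assumes "strict_mono a" "filterlim a at_top sequentially"
  shows "finite {c \<in> range a. c \<le> (B :: real)}"
proof -
  have "\<forall>\<^sub>F n in sequentially. a n > B"
    using assms(2) by (simp add: filterlim_at_top_dense)
  then obtain N where N: "\<And>n. n \<ge> N \<Longrightarrow> a n > B"
    by (auto simp: eventually_sequentially)
  have "{c \<in> range a. c \<le> B} \<subseteq> a ` {..<N}"
    using N by (force simp: not_less[symmetric])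
  thus ?thesis by (rule finite_subset) simp
qed

text \<open>Lagrange interpolation at the points \<open>2 powr (- c)\<close> isolates a single power.\<close>

lemma exists_power_separation:
  assumes "finite C" "c0 \<in> C"
  shows "\<exists>(m :: nat \<Rightarrow> real) K. \<forall>c\<in>C. (\<Sum>j\<le>K. m j * (2 powr (- real j)) powr c) = (if c = c0 then 1 else 0)"
proof -
  define z where "z c = 2 powr (- c)" for c :: real
  have inj: "z c = z c' \<longleftrightarrow> c = c'" for c c' by (simp add: z_def powr_inj)
  define p where "p = (\<Prod>c\<in>C - {c0}. smult (inverse (z c0 - z c)) [:- z c, 1:])"
  have p: "poly p (z c) = (if c = c0 then 1 else 0)" if c: "c \<in> C" for c
  proof (cases "c = c0")
    case True
    have "poly (smult (inverse (z c0 - z c')) [:- z c', 1:]) (z c0) = 1" if "c' \<noteq> c0" for c'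
    proof -
      have "poly (smult (inverse (z c0 - z c')) [:- z c', 1:]) (z c0) = inverse (z c0 - z c') * (z c0 - z c')"
        by (simp add: algebra_simps)
      thus ?thesis using inj[of c0 c'] that by simp
    qed
    hence "poly p (z c0) = (\<Prod>c\<in>C - {c0}. 1)"
      unfolding p_def poly_prod by (intro prod.cong) auto
    thus ?thesis using True by simp
  next
    case False
    hence "\<exists>c'\<in>C - {c0}. poly (smult (inverse (z c0 - z c')) [:- z c', 1:]) (z c) = 0"
      using c by (intro bexI[of _ c]) auto
    hence "poly p (z c) = 0"
      unfolding p_def poly_prod using assms(1) by (intro prod_zero) auto
    thus ?thesis using False by simp
  qed
  \<comment> \<open>A power of a node is the value of a power r powr c at the scale r = 2 powr (-
    j), so a polynomial in the node is a combination of samples at these scales, with the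
    coefficients of \<open>p\<close> as weights.\<close>
  have "(z c) ^ j = (2 powr (- real j)) powr c" for j c
  proof -
    have "(z c) ^ j = z c powr real j" by (simp add: powr_realpow z_def)
    thus ?thesis by (simp add: z_def powr_powr mult.commute)
  qed
  hence "(\<Sum>j\<le>degree p. coeff p j * (2 powr (- real j)) powr c) = (if c = c0 then 1 else 0)" if "c \<in> C" for c
    using p[OF that] by (simp add: poly_altdef)
  thus ?thesis by blast
qed

lemma expansion_remainder_near:
  assumes "singular_expansion F y a f"
  shows "\<exists>\<delta>>0. \<forall>x. 0 < norm (x - y) \<and> norm (x - y) < \<delta> \<longrightarrow>
    \<bar>F x - (\<Sum>c\<in>{c \<in> range a. c \<le> real N}. norm (x - y) powr c * f c (dir y x))\<bar> \<le> norm (x - y) ^ N"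
proof -
  have "(\<lambda>x. F x - (\<Sum>c\<in>{c \<in> range a. c \<le> real N}. norm (x - y) powr c * f c (dir y x)))
      \<in> o[at y](\<lambda>x. norm (x - y) ^ N)"
    using assms by (simp add: singular_expansion_def)
  from landau_o.smallD[OF this, of 1] show ?thesis
    unfolding eventually_at by (auto simp: dist_norm)
qed

text \<open>Regularity of the coefficients has to come from \<open>F\<close>. Weighted samples of
  \<open>F\<close> at the distances t 2 powr (- j) cancel every exponent up to N except c0. Divided
  by t powr c0 they are continuous in the direction and converge uniformly to \<open>f c0\<close>,
  because the remainder is uniform; N > c0 makes the error of order t powr (N - c0) tend to
  0.\<close>

lemma expansion_coeff_continuous:
  assumes exp: "singular_expansion F y a f" and d: "d > 0" and F: "continuous_on (ball y d - {y}) F"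
  shows "continuous_on (sphere 0 1) (f c0)"
proof (cases "c0 \<in> range a")
  case False
  hence "f c0 n = 0" if "n \<in> sphere 0 1" for n
    using exp that by (auto simp: singular_expansion_def)
  thus ?thesis using continuous_on_cong[of "sphere 0 1" "sphere 0 1" "f c0" "\<lambda>_. 0"] by simp
next
  case True
  obtain N :: nat where N: "c0 < real N" using reals_Archimedean2 by blast
  define C where "C = {c \<in> range a. c \<le> real N}"
  have C: "finite C" "c0 \<in> C"
    using exp True N by (auto simp: C_def singular_expansion_def intro!: finite_exponents)
  obtain m :: "nat \<Rightarrow> real" and K where m: "\<And>c. c \<in> C \<Longrightarrow> (\<Sum>j\<le>K. m j * (2 powr (- real j)) powr c) = (if c = c0 then 1 else 0)"
    using exists_power_separation[OF C] by blast
  obtain \<delta> where \<delta>: "\<delta> > 0" and E: "\<And>x. 0 < norm (x - y) \<Longrightarrow> norm (x - y) < \<delta> \<Longrightarrow>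
      \<bar>F x - (\<Sum>c\<in>C. norm (x - y) powr c * f c (dir y x))\<bar> \<le> norm (x - y) ^ N"
    using expansion_remainder_near[OF exp, of N] unfolding C_def by blast
  \<comment> \<open>Adding 2 to the index keeps every sample, from k = 0 on, strictly inside both
    balls.\<close>
  define t where "t k = min d \<delta> / (real k + 2)" for k :: nat
  have t: "t k > 0" "t k < d" "t k < \<delta>" for k
  proof -
    have md: "min d \<delta> > 0" using d \<delta> by simp
    show "t k > 0" unfolding t_def by (intro divide_pos_pos md) simp
    have "min d \<delta> * 1 < min d \<delta> * (real k + 2)" by (rule mult_strict_left_mono[OF _ md]) simp
    hence "t k < min d \<delta>" unfolding t_def by (subst pos_divide_less_eq) (linarith, simp only: mult_1_right)
    thus "t k < d" "t k < \<delta>" by auto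
  qed
  define x where "x k j n = y + (t k * 2 powr (- real j)) *\<^sub>R n" for k j and n :: "real ^ 3"
  have xn: "norm (x k j n - y) = t k * 2 powr (- real j)" "dir y (x k j n) = n" if "n \<in> sphere 0 1" for k j n
  proof -
    have "t k * 2 powr (- real j) > 0" using t(1)[of k] by simp
    moreover have "norm (y + \<tau> *\<^sub>R n - y) = \<tau>" "dir y (y + \<tau> *\<^sub>R n) = n" if "\<tau> > 0" for \<tau> :: real
      using that \<open>n \<in> sphere 0 1\<close> by auto
    ultimately show "norm (x k j n - y) = t k * 2 powr (- real j)" "dir y (x k j n) = n"
      unfolding x_def by blast+
  qed
  have x_le: "0 < t k * 2 powr (- real j)" "t k * 2 powr (- real j) \<le> t k" for k j
  proof -
    have "2 powr (- real j) \<le> 2 powr (0 :: real)" by (intro powr_mono) auto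
    thus "t k * 2 powr (- real j) \<le> t k" using t(1)[of k] by (simp add: mult_left_le)
  qed (use t(1)[of k] in simp)
  define G where "G k n = t k powr (- c0) * (\<Sum>j\<le>K. m j * F (x k j n))" for k n
  have contG: "continuous_on (sphere 0 1) (G k)" for k
    unfolding G_def
  proof (intro continuous_intros continuous_on_compose2[OF F])
    fix j
    show "continuous_on (sphere 0 1) (x k j)" unfolding x_def by (intro continuous_intros)
    show "x k j ` sphere 0 1 \<subseteq> ball y d - {y}"
    proof (rule image_subsetI)
      fix n :: "real ^ 3" assume n: "n \<in> sphere 0 1"
      show "x k j n \<in> ball y d - {y}"
        using xn(1)[OF n, of k j] x_le[of k j] t(2)[of k] by (auto simp: dist_norm norm_minus_commute)
    qed
  qed
  define S where "S = (\<Sum>j\<le>K. \<bar>m j\<bar>)"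
  have bound: "\<bar>G k n - f c0 n\<bar> \<le> S * t k powr (real N - c0)" if n: "n \<in> sphere 0 1" for k n
  proof -
    define R where "R j = F (x k j n) - (\<Sum>c\<in>C. norm (x k j n - y) powr c * f c (dir y (x k j n)))" for j
    have R: "\<bar>R j\<bar> \<le> t k ^ N" for j
    proof -
      have "\<bar>R j\<bar> \<le> norm (x k j n - y) ^ N"
        unfolding R_def using x_le[of k j] t(3)[of k] xn(1)[OF n, of k j] by (intro E) linarith+
      also have "\<dots> \<le> t k ^ N"
        using x_le[of k j] xn(1)[OF n, of k j] by (intro power_mono) auto
      finally show ?thesis .
    qed
    have "(\<Sum>j\<le>K. m j * F (x k j n)) = (\<Sum>j\<le>K. m j * (\<Sum>c\<in>C. (t k * 2 powr (- real j)) powr c * f c n)) + (\<Sum>j\<le>K. m j * R j)"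
      unfolding R_def xn(2)[OF n] unfolding xn(1)[OF n] by (simp add: algebra_simps sum.distrib sum_subtractf)
    \<comment> \<open>Once t powr c is split off, the sum over the scales is the separating
      combination, and only c0 survives.\<close>
    also have "(\<Sum>j\<le>K. m j * (\<Sum>c\<in>C. (t k * 2 powr (- real j)) powr c * f c n))
        = (\<Sum>c\<in>C. (t k powr c * f c n) * (\<Sum>j\<le>K. m j * (2 powr (- real j)) powr c))"
      unfolding sum_distrib_left using t(1)[of k]
      by (subst sum.swap) (intro sum.cong refl, simp add: powr_mult mult_ac)
    also have "\<dots> = (\<Sum>c\<in>C. if c = c0 then t k powr c * f c n else 0)"
      by (rule sum.cong) (auto simp: m)
    also have "\<dots> = t k powr c0 * f c0 n" using C by simp
    finally have "G k n - f c0 n = t k powr (- c0) * (\<Sum>j\<le>K. m j * R j)"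
      using t(1)[of k] by (simp add: G_def algebra_simps powr_minus)
    also have "\<bar>\<dots>\<bar> \<le> t k powr (- c0) * (\<Sum>j\<le>K. \<bar>m j\<bar> * t k ^ N)"
      unfolding abs_mult
      by (intro mult_mono order_trans[OF sum_abs] sum_mono) (auto simp: abs_mult intro!: mult_left_mono R)
    also have "\<dots> = S * t k powr (real N - c0)"
      using t(1)[of k] by (simp add: S_def sum_distrib_right[symmetric] powr_diff powr_minus powr_realpow field_simps)
    finally show ?thesis .
  qed
  have "t \<longlonglongrightarrow> 0" unfolding t_def by real_asymp
  hence "(\<lambda>k. t k powr (real N - c0)) \<longlonglongrightarrow> 0 powr (real N - c0)"
    by (intro tendsto_powr') (use N t(1) in \<open>auto intro!: always_eventually less_imp_le\<close>)
  hence lim: "(\<lambda>k. S * t k powr (real N - c0)) \<longlonglongrightarrow> 0"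
    by (intro tendsto_mult_right_zero) simp
  have "uniform_limit (sphere 0 1) G (f c0) sequentially"
  proof (rule uniform_limitI)
    fix e :: real assume "e > 0"
    with lim have "\<forall>\<^sub>F k in sequentially. S * t k powr (real N - c0) < e"
      by (rule order_tendstoD)
    thus "\<forall>\<^sub>F k in sequentially. \<forall>n\<in>sphere 0 1. dist (G k n) (f c0 n) < e"
    proof eventually_elim
      case (elim k)
      show ?case
      proof
        fix n :: "real ^ 3" assume "n \<in> sphere 0 1"
        from bound[OF this, of k] elim show "dist (G k n) (f c0 n) < e" by (simp add: dist_real_def)
      qed
    qed
  qed
  thus ?thesis
    by (rule uniform_limit_theorem[rotated]) (auto intro!: always_eventually contG)
qed

section \<open>Finite expansions with a remainder bound on a whole ball\<close>

definition sph_term :: "real ^ 3 \<Rightarrow> real \<times> (real ^ 3 \<Rightarrow> real) \<Rightarrow> real ^ 3 \<Rightarrow> real" where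
  "sph_term y e x = norm (x - y) powr fst e * snd e (dir y x)"

text \<open>A list rather than a set of exponents, because multiplication by a polynomial in x - y
  produces several terms with the same exponent. The remainder is bounded on the whole punctured
  ball, so that it can be integrated there.\<close>

definition fin_expansion ::
  "(real ^ 3 \<Rightarrow> real) \<Rightarrow> real ^ 3 \<Rightarrow> real \<Rightarrow> real \<Rightarrow> nat \<Rightarrow> (real \<times> (real ^ 3 \<Rightarrow> real)) list \<Rightarrow> bool" where
  "fin_expansion G y s a0 N xs \<longleftrightarrow>
     (\<forall>e\<in>set xs. fst e \<ge> a0 \<and> continuous_on (sphere 0 1) (snd e)) \<and>
     (\<exists>B. \<forall>x. 0 < norm (x - y) \<longrightarrow> norm (x - y) \<le> s \<longrightarrow>
        \<bar>G x - (\<Sum>e\<leftarrow>xs. sph_term y e x)\<bar> \<le> B * norm (x - y) ^ N)"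

definition coeff_list :: "(nat \<Rightarrow> real) \<Rightarrow> (real \<Rightarrow> real ^ 3 \<Rightarrow> real) \<Rightarrow> nat \<Rightarrow> (real \<times> (real ^ 3 \<Rightarrow> real)) list" where
  "coeff_list a f N = map (\<lambda>c. (c, f c)) (sorted_list_of_set {c \<in> range a. c \<le> real N})"

lemma sum_list_coeff_list:
  assumes "finite {c \<in> range a. c \<le> real N}"
  shows "(\<Sum>e\<leftarrow>coeff_list a f N. \<phi> e) = (\<Sum>c\<in>{c \<in> range a. c \<le> real N}. \<phi> (c, f c))"
  unfolding coeff_list_def map_map comp_def
  using sum_list_distinct_conv_sum_set[of "sorted_list_of_set {c \<in> range a. c \<le> real N}" "\<lambda>c. \<phi> (c, f c)"] assms
  by simp

lemma sph_term_continuous_on: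
  assumes "continuous_on (sphere 0 1) (snd e)" "y \<notin> S"
  shows "continuous_on S (sph_term y e)"
  unfolding sph_term_def
proof (intro continuous_intros continuous_on_compose2[OF assms(1)])
  show "dir y ` S \<subseteq> sphere 0 1"
    using assms(2) norm_dir[of _ y] by (intro image_subsetI) (metis mem_sphere_0)
qed (use assms(2) in auto)

lemma sum_list_continuous_on:
  fixes f :: "'b \<Rightarrow> 'a::topological_space \<Rightarrow> 'c::topological_monoid_add"
  assumes "\<And>e. e \<in> set xs \<Longrightarrow> continuous_on S (f e)"
  shows "continuous_on S (\<lambda>x. \<Sum>e\<leftarrow>xs. f e x)"
  using assms by (induction xs) (auto intro!: continuous_intros)

text \<open>Close to y the little-o bound holds with constant 1. The rest of the ball is a compact
  shell on which the remainder is continuous, hence bounded, and where norm (x - y) is at least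
  \<delta>.\<close>

lemma fin_expansion_coeff_list:
  assumes exp: "singular_expansion F y a f" and s: "s > 0"
    and d: "d > s" and F: "continuous_on (ball y d - {y}) F"
  shows "fin_expansion F y s (a 0) N (coeff_list a f N)"
proof -
  have fin: "finite {c \<in> range a. c \<le> real N}"
    using exp by (auto simp: singular_expansion_def intro!: finite_exponents)
  have cont: "continuous_on (sphere 0 1) (f c)" for c
    by (rule expansion_coeff_continuous[OF exp _ F]) (use s d in auto)
  have a0: "a 0 \<le> a n" for n
    using exp by (auto simp: singular_expansion_def intro: strict_mono_less_eq[THEN iffD2])
  define R where "R x = F x - (\<Sum>e\<leftarrow>coeff_list a f N. sph_term y e x)" for x
  have R: "R x = F x - (\<Sum>c\<in>{c \<in> range a. c \<le> real N}. norm (x - y) powr c * f c (dir y x))" for x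
    unfolding R_def sum_list_coeff_list[OF fin] by (simp add: sph_term_def)
  obtain \<delta> where \<delta>: "\<delta> > 0" and near: "\<And>x. 0 < norm (x - y) \<Longrightarrow> norm (x - y) < \<delta> \<Longrightarrow> \<bar>R x\<bar> \<le> norm (x - y) ^ N"
    using expansion_remainder_near[OF exp, of N] unfolding R by blast
  have set_cl: "fst e \<ge> a 0 \<and> continuous_on (sphere 0 1) (snd e)" if "e \<in> set (coeff_list a f N)" for e
    using that fin a0 cont by (auto simp: coeff_list_def)
  define T where "T = cball y s - ball y \<delta>"
  have "continuous_on T R"
    unfolding R_def
  proof (intro continuous_intros sum_list_continuous_on sph_term_continuous_on)
    show "continuous_on T F"
      by (rule continuous_on_subset[OF F]) (use d \<delta> in \<open>auto simp: T_def\<close>)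
  qed (use set_cl \<delta> in \<open>auto simp: T_def\<close>)
  hence "bounded (R ` T)"
    by (intro compact_imp_bounded compact_continuous_image) (auto simp: T_def compact_diff)
  then obtain B where "\<forall>z\<in>R ` T. norm z \<le> B" unfolding bounded_iff ..
  hence B: "\<bar>R x\<bar> \<le> B" if "x \<in> T" for x using that by auto
  have "\<bar>R x\<bar> \<le> (1 + \<bar>B\<bar> / \<delta> ^ N) * norm (x - y) ^ N" if x: "0 < norm (x - y)" "norm (x - y) \<le> s" for x
  proof (cases "norm (x - y) < \<delta>")
    case True
    have "\<bar>R x\<bar> \<le> 1 * norm (x - y) ^ N" using near x True by simp
    also have "\<dots> \<le> (1 + \<bar>B\<bar> / \<delta> ^ N) * norm (x - y) ^ N"
      using \<delta> by (intro mult_right_mono) auto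
    finally show ?thesis .
  next
    case False
    hence "x \<in> T" using x by (auto simp: T_def dist_norm norm_minus_commute)
    hence "\<bar>R x\<bar> \<le> \<bar>B\<bar>" using B by fastforce
    also have "\<dots> = (\<bar>B\<bar> / \<delta> ^ N) * \<delta> ^ N" using \<delta> by simp
    also have "\<dots> \<le> (1 + \<bar>B\<bar> / \<delta> ^ N) * norm (x - y) ^ N"
      using False \<delta> by (intro mult_mono power_mono) auto
    finally show ?thesis .
  qed
  thus ?thesis unfolding fin_expansion_def R_def using set_cl by blast
qed

text \<open>The square makes this a polynomial in x - y, with a linear and a quadratic part and no
  constant term; the distance to y' itself would not be one. The power \<beta> of the distance ratio
  is the power \<beta> / 2 of 1 plus this quantity.\<close>

definition ratio_excess :: "real ^ 3 \<Rightarrow> real ^ 3 \<Rightarrow> real ^ 3 \<Rightarrow> real" where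
  "ratio_excess y y' x = (norm (x - y') / norm (y - y'))\<^sup>2 - 1"

lemma ratio_excess_eq:
  assumes "y \<noteq> y'"
  shows "ratio_excess y y' x = ((norm (x - y))\<^sup>2 + 2 * ((x - y) \<bullet> (y - y'))) / (norm (y - y'))\<^sup>2"
proof -
  have "(norm (x - y'))\<^sup>2 = (norm ((x - y) + (y - y')))\<^sup>2" by simp
  also have "\<dots> = (norm (x - y))\<^sup>2 + 2 * ((x - y) \<bullet> (y - y')) + (norm (y - y'))\<^sup>2"
    by (simp only: power2_norm_eq_inner inner_add_left inner_add_right) (simp add: inner_commute)
  finally show ?thesis
    using assms by (simp add: ratio_excess_def power_divide field_simps)
qed

lemma ratio_excess_bound:
  assumes "y \<noteq> y'" "norm (x - y) \<le> s"
  shows "\<bar>ratio_excess y y' x\<bar> \<le> (s + 2 * norm (y - y')) / (norm (y - y'))\<^sup>2 * norm (x - y)"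
proof -
  have "\<bar>(norm (x - y))\<^sup>2 + 2 * ((x - y) \<bullet> (y - y'))\<bar> \<le> (norm (x - y))\<^sup>2 + 2 * (norm (x - y) * norm (y - y'))"
    using Cauchy_Schwarz_ineq2[of "x - y" "y - y'"] by (intro order_trans[OF abs_triangle_ineq]) simp
  also have "\<dots> = (norm (x - y) + 2 * norm (y - y')) * norm (x - y)"
    by (simp add: algebra_simps power2_eq_square)
  also have "\<dots> \<le> (s + 2 * norm (y - y')) * norm (x - y)"
    using assms by (intro mult_right_mono) auto
  finally have "\<bar>(norm (x - y))\<^sup>2 + 2 * ((x - y) \<bullet> (y - y'))\<bar> / (norm (y - y'))\<^sup>2
      \<le> (s + 2 * norm (y - y')) * norm (x - y) / (norm (y - y'))\<^sup>2"
    by (intro divide_right_mono) auto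
  thus ?thesis by (simp add: ratio_excess_eq[OF assms(1)])
qed

text \<open>The linear part of the factor raises an exponent by 1 and multiplies the angular
  function by an inner product; the quadratic part raises it by 2. Exponents never decrease, so the
  lower bound a0 persists, and so does the order N because the factor is bounded on the
  ball.\<close>

lemma fin_expansion_mult_ratio_excess:
  assumes yy: "y \<noteq> y'" and G: "fin_expansion G y s a0 N xs"
  shows "\<exists>xs'. fin_expansion (\<lambda>x. ratio_excess y y' x * G x) y s a0 N xs'"
proof -
  define D where "D = (norm (y - y'))\<^sup>2"
  have D: "D > 0" using yy by (simp add: D_def)
  define xs' where "xs' = map (\<lambda>e. (fst e + 1, \<lambda>n. 2 * (n \<bullet> (y - y')) / D * snd e n)) xs @
     map (\<lambda>e. (fst e + 2, \<lambda>n. snd e n / D)) xs"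
  obtain B where B: "\<And>x. 0 < norm (x - y) \<Longrightarrow> norm (x - y) \<le> s \<Longrightarrow>
        \<bar>G x - (\<Sum>e\<leftarrow>xs. sph_term y e x)\<bar> \<le> B * norm (x - y) ^ N"
    using G unfolding fin_expansion_def by blast
  have sum: "(\<Sum>e\<leftarrow>xs'. sph_term y e x) = ratio_excess y y' x * (\<Sum>e\<leftarrow>xs. sph_term y e x)" if x: "0 < norm (x - y)" for x
  proof -
    have *: "sph_term y (fst e + 1, \<lambda>n. 2 * (n \<bullet> (y - y')) / D * snd e n) x + sph_term y (fst e + 2, \<lambda>n. snd e n / D) x
        = ratio_excess y y' x * sph_term y e x" for e
    proof -
      define w g r where "w = dir y x \<bullet> (y - y')" and "g = snd e (dir y x)" and "r = norm (x - y)"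
      have "(x - y) \<bullet> (y - y') = r * w"
        using x unfolding w_def r_def by (simp only: inner_scaleR_left) simp
      moreover have "r powr (fst e + 1) = r powr fst e * r" "r powr (fst e + 2) = r powr fst e * r\<^sup>2"
        using x by (simp_all add: r_def powr_add)
      ultimately show ?thesis
        unfolding sph_term_def fst_conv snd_conv ratio_excess_eq[OF yy] D_def[symmetric]
        unfolding w_def[symmetric] g_def[symmetric] unfolding r_def[symmetric]
        using D by (simp add: field_simps power2_eq_square)
    qed
    show ?thesis
      unfolding xs'_def map_append map_map comp_def sum_list_append sum_list_addf[symmetric] * sum_list_const_mult ..
  qed
  define U where "U = (s + 2 * norm (y - y')) / D * s"
  have "\<bar>ratio_excess y y' x * G x - (\<Sum>e\<leftarrow>xs'. sph_term y e x)\<bar> \<le> (U * B) * norm (x - y) ^ N"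
    if x: "0 < norm (x - y)" "norm (x - y) \<le> s" for x
  proof -
    have "\<bar>ratio_excess y y' x\<bar> \<le> (s + 2 * norm (y - y')) / D * norm (x - y)"
      unfolding D_def by (rule ratio_excess_bound[OF yy x(2)])
    also have "\<dots> \<le> U" unfolding U_def using x D order_trans[OF norm_ge_zero x(2)]
      by (intro mult_left_mono divide_nonneg_nonneg add_nonneg_nonneg) auto
    finally have U: "\<bar>ratio_excess y y' x\<bar> \<le> U" .
    have "\<bar>ratio_excess y y' x * G x - (\<Sum>e\<leftarrow>xs'. sph_term y e x)\<bar> = \<bar>ratio_excess y y' x\<bar> * \<bar>G x - (\<Sum>e\<leftarrow>xs. sph_term y e x)\<bar>"
      unfolding sum[OF x(1)] by (simp only: abs_mult[symmetric] right_diff_distrib)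
    also have "\<dots> \<le> U * (B * norm (x - y) ^ N)"
      using U B[OF x] by (intro mult_mono) auto
    finally show ?thesis by (simp add: mult_ac)
  qed
  moreover have "fst e \<ge> a0 \<and> continuous_on (sphere 0 1) (snd e)" if "e \<in> set xs'" for e
    using that G D unfolding xs'_def fin_expansion_def
    by (auto intro!: continuous_intros add_increasing2)
  ultimately show ?thesis unfolding fin_expansion_def by blast
qed

lemma fin_expansion_power_ratio_excess:
  assumes "y \<noteq> y'" and "fin_expansion F y s a0 N xs"
  shows "\<exists>xs'. fin_expansion (\<lambda>x. ratio_excess y y' x ^ k * F x) y s a0 N xs'"
proof (induction k)
  case 0
  show ?case using assms(2) by auto
next
  case (Suc k)
  then obtain xs' where "fin_expansion (\<lambda>x. ratio_excess y y' x ^ k * F x) y s a0 N xs'" ..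
  from fin_expansion_mult_ratio_excess[OF assms(1) this] show ?case by (simp add: mult.assoc)
qed

lemma sph_term_bound:
  assumes "continuous_on (sphere 0 1) (snd e)" "fst e \<ge> L"
  shows "\<exists>B\<ge>0. \<forall>x. 0 < norm (x - y) \<longrightarrow> norm (x - y) \<le> s \<longrightarrow> \<bar>sph_term y e x\<bar> \<le> B * norm (x - y) powr L"
proof -
  have "bounded (snd e ` sphere 0 1)"
    using assms(1) by (intro compact_imp_bounded compact_continuous_image) auto
  then obtain b where b: "\<forall>z\<in>snd e ` sphere 0 1. norm z \<le> b" unfolding bounded_iff ..
  show ?thesis
  proof (intro exI[of _ "\<bar>b\<bar> * s powr (fst e - L)"] conjI allI impI)
    fix x assume x: "0 < norm (x - y)" "norm (x - y) \<le> s"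
    have "\<bar>snd e (dir y x)\<bar> \<le> b" using b x norm_dir[of x y] by (metis imageI mem_sphere_0 norm_eq_zero real_norm_def right_minus_eq less_irrefl)
    hence "\<bar>sph_term y e x\<bar> \<le> norm (x - y) powr fst e * \<bar>b\<bar>"
      by (auto simp: sph_term_def abs_mult intro!: mult_left_mono)
    also have "norm (x - y) powr fst e = norm (x - y) powr (fst e - L) * norm (x - y) powr L"
      by (simp add: powr_add[symmetric])
    also have "\<dots> * \<bar>b\<bar> \<le> s powr (fst e - L) * norm (x - y) powr L * \<bar>b\<bar>"
      using x assms(2) by (intro mult_right_mono powr_mono2) auto
    finally show "\<bar>sph_term y e x\<bar> \<le> \<bar>b\<bar> * s powr (fst e - L) * norm (x - y) powr L" by (simp add: mult_ac)
  qed auto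
qed

lemma sum_list_sph_term_bound:
  assumes "\<And>e. e \<in> set xs \<Longrightarrow> fst e \<ge> L \<and> continuous_on (sphere 0 1) (snd e)"
  shows "\<exists>B\<ge>0. \<forall>x. 0 < norm (x - y) \<longrightarrow> norm (x - y) \<le> s \<longrightarrow> \<bar>\<Sum>e\<leftarrow>xs. sph_term y e x\<bar> \<le> B * norm (x - y) powr L"
  using assms
proof (induction xs)
  case Nil
  show ?case by (intro exI[of _ 0]) auto
next
  case (Cons e xs)
  obtain B where B: "B \<ge> 0" "\<And>x. 0 < norm (x - y) \<Longrightarrow> norm (x - y) \<le> s \<Longrightarrow> \<bar>\<Sum>e\<leftarrow>xs. sph_term y e x\<bar> \<le> B * norm (x - y) powr L"
    using Cons by auto
  obtain B' where B': "B' \<ge> 0" "\<And>x. 0 < norm (x - y) \<Longrightarrow> norm (x - y) \<le> s \<Longrightarrow> \<bar>sph_term y e x\<bar> \<le> B' * norm (x - y) powr L"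
    using sph_term_bound[of e L y s] Cons.prems[of e] by auto
  show ?case
  proof (intro exI[of _ "B + B'"] conjI allI impI)
    fix x assume x: "0 < norm (x - y)" "norm (x - y) \<le> s"
    show "\<bar>\<Sum>e\<leftarrow>e # xs. sph_term y e x\<bar> \<le> (B + B') * norm (x - y) powr L"
      using B(2)[OF x] B'(2)[OF x] by (simp add: algebra_simps)
  qed (use B B' in auto)
qed

text \<open>L lies below the exponents of all terms and below the order of the remainder; the excess
  powers of the distance are bounded on the ball by powers of s.\<close>

lemma fin_expansion_imp_bound:
  assumes "fin_expansion F y s a0 N xs" "L \<le> a0" "L \<le> real N" and s: "s > 0"
  shows "\<exists>B\<ge>0. \<forall>x. 0 < norm (x - y) \<longrightarrow> norm (x - y) \<le> s \<longrightarrow> \<bar>F x\<bar> \<le> B * norm (x - y) powr L"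
proof -
  obtain B where B: "B \<ge> 0" "\<And>x. 0 < norm (x - y) \<Longrightarrow> norm (x - y) \<le> s \<Longrightarrow> \<bar>\<Sum>e\<leftarrow>xs. sph_term y e x\<bar> \<le> B * norm (x - y) powr L"
  proof -
    have "\<exists>B\<ge>0. \<forall>x. 0 < norm (x - y) \<longrightarrow> norm (x - y) \<le> s \<longrightarrow> \<bar>\<Sum>e\<leftarrow>xs. sph_term y e x\<bar> \<le> B * norm (x - y) powr L"
      by (rule sum_list_sph_term_bound) (use assms(1,2) in \<open>auto simp: fin_expansion_def intro: order_trans\<close>)
    thus ?thesis using that by blast
  qed
  obtain b where b: "\<And>x. 0 < norm (x - y) \<Longrightarrow> norm (x - y) \<le> s \<Longrightarrow> \<bar>F x - (\<Sum>e\<leftarrow>xs. sph_term y e x)\<bar> \<le> b * norm (x - y) ^ N"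
    using assms(1) unfolding fin_expansion_def by blast
  show ?thesis
  proof (intro exI[of _ "\<bar>b\<bar> * s powr (real N - L) + B"] conjI allI impI)
    fix x assume x: "0 < norm (x - y)" "norm (x - y) \<le> s"
    have "b * norm (x - y) ^ N \<le> \<bar>b\<bar> * (norm (x - y) powr (real N - L) * norm (x - y) powr L)"
      using x by (simp add: powr_add[symmetric] powr_realpow mult_right_mono)
    also have "\<dots> \<le> \<bar>b\<bar> * (s powr (real N - L) * norm (x - y) powr L)"
      using x assms(3) by (intro mult_left_mono mult_right_mono powr_mono2) auto
    finally show "\<bar>F x\<bar> \<le> (\<bar>b\<bar> * s powr (real N - L) + B) * norm (x - y) powr L"
      using b[OF x] B(2)[OF x] by (simp add: algebra_simps)
  qed (use B in auto)
qed


section \<open>The binomial series with a complex exponent\<close>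

definition falling :: "complex \<Rightarrow> nat \<Rightarrow> complex" where
  "falling b k = (\<Prod>j<k. b - of_nat j)"

lemma falling_Suc: "falling b (Suc k) = falling b k * (b - of_nat k)"
  by (simp add: falling_def)

text \<open>All terms of the binomial series but the first disappear for exponent 0; this is how the
  expansion collapses on the line \<beta> = 0.\<close>

lemma falling_0_left: "falling 0 k = (if k = 0 then 1 else 0)"
  by (cases k) (auto simp: falling_def prod.lessThan_Suc_shift)

lemma norm_falling_le:
  assumes "cmod b \<le> A"
  shows "cmod (falling b k) \<le> (\<Prod>j<k. A + real j)"
  unfolding falling_def prod_norm[symmetric]
  by (intro prod_mono) (use assms in \<open>auto intro!: order_trans[OF norm_triangle_ineq4]\<close>)

text \<open>Holomorphy in \<beta> will need bounds that are uniform in the exponent. The interval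
  stays away from -1, so the logarithm of 1 + v is bounded on it, and with it each derivative of the
  power while b ranges over a disc.\<close>

lemma binomial_taylor:
  assumes lo: "- 1 < lo" "lo \<le> 0" and hi: "0 \<le> hi" and A: "A \<ge> 0"
  shows "\<exists>B\<ge>0. \<forall>b v. cmod b \<le> A \<longrightarrow> lo \<le> v \<longrightarrow> v \<le> hi \<longrightarrow>
    cmod (of_real (1 + v) powr b - (\<Sum>k\<le>n. falling b k / fact k * of_real v ^ k)) \<le> B * \<bar>v\<bar> ^ Suc n"
proof -
  define L where "L = max \<bar>ln (1 + lo)\<bar> \<bar>ln (1 + hi)\<bar>"
  define Q where "Q = (\<Prod>j<Suc n. A + real j) * exp ((A + real (Suc n)) * L)"
  have Q: "Q \<ge> 0" unfolding Q_def using A by (intro mult_nonneg_nonneg prod_nonneg) auto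
  show ?thesis
  proof (intro exI[of _ "Q / fact n"] conjI allI impI)
    show "0 \<le> Q / fact n" using Q by simp
    fix b :: complex and v :: real
    assume b: "cmod b \<le> A" and v: "lo \<le> v" "v \<le> hi"
    \<comment> \<open>The interval of real arguments as a segment in the complex plane: convex, as
      the Taylor estimate requires, and off the branch cut after adding 1.\<close>
    define S where "S = complex_of_real ` {lo..hi}"
    define f where "f i z = falling b i * (1 + z) powr (b - of_nat i)" for i z
    have "cmod (f 0 (of_real v) - (\<Sum>i\<le>n. f i 0 * (of_real v - 0) ^ i / fact i)) \<le> Q * cmod (of_real v - 0) ^ Suc n / fact n"
    proof (rule complex_Taylor)
      show "convex S" unfolding S_def
        by (intro convex_linear_image bounded_linear.linear[OF bounded_linear_of_real] convex_real_interval)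
      show "0 \<in> S" unfolding S_def using lo hi by (intro image_eqI[of _ _ 0]) auto
      show "of_real v \<in> S" unfolding S_def using v by (intro imageI) auto
    next
      fix i z assume z: "z \<in> S"
      then obtain t where t: "z = of_real t" "lo \<le> t" "t \<le> hi" by (auto simp: S_def)
      have nz: "1 + z \<notin> \<real>\<^sub>\<le>\<^sub>0"
        using t lo by (auto simp: complex_nonpos_Reals_iff)
      have "((\<lambda>z. (1 + z) powr (b - of_nat i)) has_field_derivative ((b - of_nat i) * (1 + z) powr (b - of_nat i - 1)) * (0 + 1)) (at z)"
        by (rule DERIV_chain2[where f = "\<lambda>w. w powr (b - of_nat i)" and g = "\<lambda>z. 1 + z", OF has_field_derivative_powr[OF nz]])
           (rule derivative_intros)+
      hence "(f i has_field_derivative falling b i * ((b - of_nat i) * (1 + z) powr (b - of_nat i - 1))) (at z)"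
        unfolding f_def[abs_def] mult_1_right add_0_left by (rule DERIV_cmult)
      thus "(f i has_field_derivative f (Suc i) z) (at z within S)"
        by (rule has_field_derivative_at_within[OF DERIV_cong]) (simp add: f_def falling_Suc diff_diff_eq add.commute mult.assoc)
    next
      fix z assume z: "z \<in> S"
      then obtain t where t: "z = of_real t" "lo \<le> t" "t \<le> hi" by (auto simp: S_def)
      have t1: "1 + t > 0" using t lo by simp
      have "ln (1 + lo) \<le> ln (1 + t)" "ln (1 + t) \<le> ln (1 + hi)" using t lo t1 by auto
      hence L: "\<bar>ln (1 + t)\<bar> \<le> L" by (auto simp: L_def)
      have "cmod ((1 + z) powr (b - of_nat (Suc n))) = exp (Re (b - of_nat (Suc n)) * ln (1 + t))"
        using norm_powr_real_powr[of "1 + z" "b - of_nat (Suc n)"] t1 unfolding t(1)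
        by (subst norm_powr_real) auto
      also have "Re (b - of_nat (Suc n)) * ln (1 + t) \<le> \<bar>Re (b - of_nat (Suc n))\<bar> * \<bar>ln (1 + t)\<bar>"
        by (metis abs_ge_self abs_mult)
      also have "\<dots> \<le> (A + real (Suc n)) * L"
      proof (rule mult_mono)
        have "\<bar>Re (b - of_nat (Suc n))\<bar> \<le> cmod (b - of_nat (Suc n))" by (rule abs_Re_le_cmod)
        also have "\<dots> \<le> cmod b + cmod (of_nat (Suc n))" by (rule norm_triangle_ineq4)
        also have "\<dots> \<le> A + real (Suc n)" using b by (simp only: norm_of_nat add_right_mono)
        finally show "\<bar>Re (b - of_nat (Suc n))\<bar> \<le> A + real (Suc n)" .
      qed (use L A in auto)
      finally have "cmod ((1 + z) powr (b - of_nat (Suc n))) \<le> exp ((A + real (Suc n)) * L)" by simp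
      thus "cmod (f (Suc n) z) \<le> Q"
        unfolding f_def Q_def norm_mult
        using norm_falling_le[OF b, of "Suc n"] A by (intro mult_mono prod_nonneg) auto
    qed
    moreover have "f i 0 = falling b i" for i by (simp add: f_def)
    ultimately show "cmod (of_real (1 + v) powr b - (\<Sum>k\<le>n. falling b k / fact k * of_real v ^ k)) \<le> Q / fact n * \<bar>v\<bar> ^ Suc n"
      by (simp add: f_def falling_def[of _ 0] field_simps)
  qed
qed

lemma of_real_powr_eq_exp:
  assumes "x > 0"
  shows "complex_of_real x powr z = exp (z * of_real (ln x))"
  using assms by (simp add: powr_def Ln_of_real)

lemma sum_list_concat_map_upt:
  "(\<Sum>z\<leftarrow>concat (map (\<lambda>k. map (g k) (xs k)) [0..<K]). h z) = (\<Sum>k<K. \<Sum>e\<leftarrow>xs k. h (g k e))"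
  by (induction K) (simp_all add: comp_def)

lemma of_real_sum_list: "of_real (\<Sum>e\<leftarrow>xs. f e) = (\<Sum>e\<leftarrow>xs. complex_of_real (f e))"
  by (induction xs) simp_all

text \<open>The binomial expansion of \<open>r\<^sub>2 powr \<beta>\<close> in powers of \<open>ratio_excess\<close> separates the variables
  \<open>\<beta>\<close> and \<open>x\<close> up to a remainder of high order at \<open>y\<close>.\<close>

lemma expansion_with_parameter:
  assumes yy: "y \<noteq> y'" and s: "s > 0" "s < norm (y - y')" and s': "s' > 0"
    and F: "fin_expansion F y s a0 M xs0"
  shows "\<exists>zs :: (real \<times> (real ^ 3 \<Rightarrow> real) \<times> (complex \<Rightarrow> complex)) list.
    (\<forall>(c, g, e)\<in>set zs. c \<ge> a0 \<and> continuous_on (sphere 0 1) g \<and> e holomorphic_on UNIV) \<and>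
    (\<forall>A. \<exists>B\<ge>0. \<forall>\<beta> x. cmod \<beta> \<le> A \<longrightarrow> 0 < norm (x - y) \<longrightarrow> norm (x - y) \<le> s \<longrightarrow>
       cmod (of_real (norm (x - y') / s') powr \<beta> * of_real (F x) - (\<Sum>(c, g, e)\<leftarrow>zs. e \<beta> * of_real (sph_term y (c, g) x)))
         \<le> B * norm (x - y) ^ M) \<and>
    (\<forall>\<phi> :: real \<times> (real ^ 3 \<Rightarrow> real) \<Rightarrow> complex. (\<Sum>(c, g, e)\<leftarrow>zs. e 0 * \<phi> (c, g)) = (\<Sum>e\<leftarrow>xs0. \<phi> e))"
proof -
  define d where "d = norm (y - y')"
  have d: "d > 0" "s < d" using yy s by (auto simp: d_def)
  define u where "u = ratio_excess y y'"
  define L where "L = min a0 (real M)"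
  obtain BF where BF: "BF \<ge> 0" "\<And>x. 0 < norm (x - y) \<Longrightarrow> norm (x - y) \<le> s \<Longrightarrow> \<bar>F x\<bar> \<le> BF * norm (x - y) powr L"
    using fin_expansion_imp_bound[OF F, of L] s by (auto simp: L_def)
  \<comment> \<open>K = n + 1 powers of \<open>u\<close>, each of order 1 in the distance, bring the
    Taylor remainder times \<open>F\<close> to order M, although \<open>F\<close> itself is only
    bounded by the power L, which may be negative.\<close>
  obtain n :: nat where n: "real M - L \<le> real n" using real_arch_simple by blast
  define K where "K = Suc n"
  have K: "real K + L \<ge> real M" using n by (simp add: K_def)
  \<comment> \<open>For k = 0 the list is fixed to be \<open>xs0\<close>, so that at \<beta> = 0 the
    given expansion of \<open>F\<close> is recovered term by term.\<close>
  have "\<forall>k. \<exists>xs'. fin_expansion (\<lambda>x. u x ^ k * F x) y s a0 M xs' \<and> (k = 0 \<longrightarrow> xs' = xs0)"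
  proof
    fix k show "\<exists>xs'. fin_expansion (\<lambda>x. u x ^ k * F x) y s a0 M xs' \<and> (k = 0 \<longrightarrow> xs' = xs0)"
      using F fin_expansion_power_ratio_excess[OF yy F, of k] by (cases k) (auto simp: u_def)
  qed
  then obtain xs where xs: "\<And>k. fin_expansion (\<lambda>x. u x ^ k * F x) y s a0 M (xs k)" and xs0: "xs 0 = xs0"
    by metis
  \<comment> \<open>The value at y of the power to be expanded, since the distance from y to y' is
    d; the other factor is a power of 1 + u.\<close>
  define P where "P \<beta> = of_real (d / s') powr \<beta>" for \<beta> :: complex
  define cf where "cf k \<beta> = falling (\<beta> / 2) k / fact k" for k \<beta>
  define zs where "zs = concat (map (\<lambda>k. map (\<lambda>e. (fst e, snd e, \<lambda>\<beta>. P \<beta> * cf k \<beta>)) (xs k)) [0..<K])"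
  have P: "P \<beta> = exp (\<beta> * of_real (ln (d / s')))" for \<beta>
    unfolding P_def using d s' by (intro of_real_powr_eq_exp) simp
  have hol: "(\<lambda>\<beta>. P \<beta> * cf k \<beta>) holomorphic_on UNIV" for k
    unfolding P cf_def falling_def by (intro holomorphic_intros) auto
  have zs_sum: "(\<Sum>(c, g, e)\<leftarrow>zs. h c g (e \<beta>)) = (\<Sum>k<K. \<Sum>e\<leftarrow>xs k. h (fst e) (snd e) (P \<beta> * cf k \<beta>))"
    for h :: "real \<Rightarrow> (real ^ 3 \<Rightarrow> real) \<Rightarrow> complex \<Rightarrow> complex" and \<beta> :: complex
    unfolding zs_def sum_list_concat_map_upt by simp
  have "\<forall>(c, g, e)\<in>set zs. c \<ge> a0 \<and> continuous_on (sphere 0 1) g \<and> e holomorphic_on UNIV"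
    using xs hol unfolding zs_def fin_expansion_def by auto
  moreover have "(\<Sum>(c, g, e)\<leftarrow>zs. e 0 * \<phi> (c, g)) = (\<Sum>e\<leftarrow>xs0. \<phi> e)" for \<phi> :: "real \<times> (real ^ 3 \<Rightarrow> real) \<Rightarrow> complex"
  proof -
    have "(\<Sum>(c, g, e)\<leftarrow>zs. e 0 * \<phi> (c, g)) = (\<Sum>k<K. if k = 0 then \<Sum>e\<leftarrow>xs 0. \<phi> e else 0)"
      unfolding zs_sum[of "\<lambda>c g z. z * \<phi> (c, g)"]
      by (intro sum.cong) (auto simp: P cf_def falling_0_left sum_list_const_mult)
    also have "\<dots> = (\<Sum>e\<leftarrow>xs 0. \<phi> e)" by (simp add: K_def)
    finally show ?thesis by (simp add: xs0)
  qed
  moreover have "\<exists>B\<ge>0. \<forall>\<beta> x. cmod \<beta> \<le> A \<longrightarrow> 0 < norm (x - y) \<longrightarrow> norm (x - y) \<le> s \<longrightarrow>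
       cmod (of_real (norm (x - y') / s') powr \<beta> * of_real (F x) - (\<Sum>(c, g, e)\<leftarrow>zs. e \<beta> * of_real (sph_term y (c, g) x)))
         \<le> B * norm (x - y) ^ M" for A
  proof -
    define A' where "A' = \<bar>A\<bar> / 2"
    \<comment> \<open>On the ball the distance to y' lies between d - s and d + s; s < d keeps 1 + u
      away from 0.\<close>
    define lo hi where "lo = ((d - s) / d)\<^sup>2 - 1" and "hi = ((d + s) / d)\<^sup>2 - 1"
    have "((d - s) / d)\<^sup>2 > 0" using d by simp
    moreover have "((d - s) / d)\<^sup>2 \<le> 1" using d s by (intro power_le_one) auto
    moreover have "1 \<le> ((d + s) / d)\<^sup>2" using d s by (intro one_le_power) auto
    ultimately have lohi: "- 1 < lo" "lo \<le> 0" "0 \<le> hi" by (auto simp: lo_def hi_def)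
    obtain B1 where B1: "B1 \<ge> 0" "\<And>b v. cmod b \<le> A' \<Longrightarrow> lo \<le> v \<Longrightarrow> v \<le> hi \<Longrightarrow>
        cmod (of_real (1 + v) powr b - (\<Sum>k\<le>n. falling b k / fact k * of_real v ^ k)) \<le> B1 * \<bar>v\<bar> ^ Suc n"
      using binomial_taylor[OF lohi, of A' n] by (auto simp: A'_def)
    define U where "U = (s + 2 * d) / d\<^sup>2"
    have U: "U \<ge> 0" using s d by (simp add: U_def)
    have "\<forall>k. \<exists>B. \<forall>x. 0 < norm (x - y) \<longrightarrow> norm (x - y) \<le> s \<longrightarrow>
        \<bar>u x ^ k * F x - (\<Sum>e\<leftarrow>xs k. sph_term y e x)\<bar> \<le> B * norm (x - y) ^ M"
      using xs unfolding fin_expansion_def by blast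
    then obtain BK where BK: "\<And>k x. 0 < norm (x - y) \<Longrightarrow> norm (x - y) \<le> s \<Longrightarrow>
        \<bar>u x ^ k * F x - (\<Sum>e\<leftarrow>xs k. sph_term y e x)\<bar> \<le> BK k * norm (x - y) ^ M"
      by metis
    define P0 where "P0 = exp (\<bar>A\<bar> * \<bar>ln (d / s')\<bar>)"
    define Q where "Q k = (\<Prod>j<k. A' + real j) / fact k" for k
    have Q: "Q k \<ge> 0" for k unfolding Q_def A'_def by (intro divide_nonneg_nonneg prod_nonneg) auto
    define B where "B = P0 * (B1 * U ^ K * BF * s powr (real K + L - real M) + (\<Sum>k<K. Q k * \<bar>BK k\<bar>))"
    show ?thesis
    proof (intro exI[of _ B] conjI allI impI)
      show "B \<ge> 0" unfolding B_def P0_def using B1(1) U BF(1) Q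
        by (intro mult_nonneg_nonneg add_nonneg_nonneg sum_nonneg) auto
      fix \<beta> x assume \<beta>: "cmod \<beta> \<le> A" and x: "0 < norm (x - y)" "norm (x - y) \<le> s"
      define r where "r = norm (x - y)"
      have r: "0 < r" "r \<le> s" using x by (auto simp: r_def)
      have r2: "d - s \<le> norm (x - y')" "norm (x - y') \<le> d + s"
        using norm_triangle_ineq[of "x - y" "y - y'"] norm_triangle_ineq2[of "y - y'" "y - x"] x
        by (auto simp: d_def norm_minus_commute)
      have r2p: "norm (x - y') > 0" using r2(1) d(2) by linarith
      have u1: "1 + u x = (norm (x - y') / d)\<^sup>2" by (simp add: u_def ratio_excess_def d_def)
      have ux: "lo \<le> u x" "u x \<le> hi"
      proof -
        have "((d - s) / d)\<^sup>2 \<le> (norm (x - y') / d)\<^sup>2" "(norm (x - y') / d)\<^sup>2 \<le> ((d + s) / d)\<^sup>2"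
          using r2 d s by (auto intro!: power_mono divide_right_mono)
        thus "lo \<le> u x" "u x \<le> hi" using u1 by (auto simp: lo_def hi_def)
      qed
      have E: "of_real (norm (x - y') / s') powr \<beta> = P \<beta> * of_real (1 + u x) powr (\<beta> / 2)"
      proof -
        have "ln (norm (x - y') / s') = ln (d / s') + ln (norm (x - y') / d)"
          using r2p d s' by (simp add: ln_div)
        moreover have "ln (1 + u x) = 2 * ln (norm (x - y') / d)"
          unfolding u1 using r2p d by (subst ln_realpow) auto
        moreover have "1 + u x > 0" unfolding u1 using r2p d by simp
        ultimately show ?thesis using r2p s' d
          by (simp only: P of_real_powr_eq_exp divide_pos_pos exp_add[symmetric]) (simp add: algebra_simps)
      qed
      define T where "T = of_real (1 + u x) powr (\<beta> / 2) - (\<Sum>k<K. cf k \<beta> * of_real (u x) ^ k)"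
      have b2: "cmod (\<beta> / 2) \<le> A'" using \<beta> by (simp add: A'_def norm_divide)
      have ab: "\<bar>u x\<bar> \<le> U * r"
        unfolding u_def U_def d_def r_def by (rule ratio_excess_bound[OF yy x(2)])
      have T: "cmod T \<le> B1 * (U * r) ^ K"
      proof -
        have "cmod T \<le> B1 * \<bar>u x\<bar> ^ K"
          using B1(2)[OF b2 ux] unfolding T_def K_def cf_def lessThan_Suc_atMost .
        also have "\<dots> \<le> B1 * (U * r) ^ K"
          using ab B1(1) by (intro mult_left_mono power_mono) auto
        finally show ?thesis .
      qed
      have PP: "cmod (P \<beta>) \<le> P0"
      proof -
        have "cmod (P \<beta>) = exp (Re \<beta> * ln (d / s'))" by (simp add: P)
        moreover have "Re \<beta> * ln (d / s') \<le> \<bar>A\<bar> * \<bar>ln (d / s')\<bar>"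
          using abs_Re_le_cmod[of \<beta>] \<beta>
          by (intro order_trans[OF abs_ge_self[of "Re \<beta> * ln (d / s')"]]) (auto simp: abs_mult intro!: mult_right_mono)
        ultimately show ?thesis by (simp add: P0_def)
      qed
      \<comment> \<open>There are two sources of error: the Taylor remainder \<open>T\<close> times
        \<open>F\<close>, and the remainders in the expansions of
        \<open>u x ^ k * F x\<close>.\<close>
      have eq: "of_real (norm (x - y') / s') powr \<beta> * of_real (F x) - (\<Sum>(c, g, e)\<leftarrow>zs. e \<beta> * of_real (sph_term y (c, g) x))
         = P \<beta> * (T * of_real (F x) + (\<Sum>k<K. cf k \<beta> * of_real (u x ^ k * F x - (\<Sum>e\<leftarrow>xs k. sph_term y e x))))"
      proof -
        have "(\<Sum>(c, g, e)\<leftarrow>zs. e \<beta> * of_real (sph_term y (c, g) x))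
            = (\<Sum>k<K. \<Sum>e\<leftarrow>xs k. P \<beta> * cf k \<beta> * of_real (sph_term y (fst e, snd e) x))"
          by (rule zs_sum[of "\<lambda>c g z. z * of_real (sph_term y (c, g) x)"])
        also have "\<dots> = (\<Sum>k<K. P \<beta> * (cf k \<beta> * of_real (\<Sum>e\<leftarrow>xs k. sph_term y e x)))"
          by (intro sum.cong refl) (simp only: sum_list_const_mult of_real_sum_list prod.collapse mult.assoc)
        finally have zs: "(\<Sum>(c, g, e)\<leftarrow>zs. e \<beta> * of_real (sph_term y (c, g) x))
            = P \<beta> * (\<Sum>k<K. cf k \<beta> * of_real (\<Sum>e\<leftarrow>xs k. sph_term y e x))"
          by (simp only: sum_distrib_left)
        have "(\<Sum>k<K. cf k \<beta> * of_real (u x ^ k * F x - (\<Sum>e\<leftarrow>xs k. sph_term y e x)))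
            = (\<Sum>k<K. cf k \<beta> * of_real (u x) ^ k) * of_real (F x) - (\<Sum>k<K. cf k \<beta> * of_real (\<Sum>e\<leftarrow>xs k. sph_term y e x))"
          by (simp only: of_real_diff of_real_mult of_real_power right_diff_distrib sum_subtractf sum_distrib_right mult.assoc)
        thus ?thesis
          unfolding E T_def zs by (simp only:) (simp add: algebra_simps)
      qed
      have rr: "r ^ K * r powr L = r powr (real K + L - real M) * r ^ M"
        using r by (simp add: powr_realpow[symmetric] powr_add[symmetric] add.commute)
      have "cmod (T * of_real (F x)) \<le> B1 * (U * r) ^ K * (BF * r powr L)"
        unfolding norm_mult using T BF(2)[OF x] B1(1) U r by (intro mult_mono) (auto simp: r_def)
      also have "\<dots> = B1 * U ^ K * BF * (r ^ K * r powr L)"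
        by (simp add: power_mult_distrib mult_ac)
      also have "\<dots> = B1 * U ^ K * BF * (r powr (real K + L - real M) * r ^ M)"
        unfolding rr ..
      also have "\<dots> \<le> B1 * U ^ K * BF * (s powr (real K + L - real M) * r ^ M)"
        using r B1(1) U BF(1) K by (intro mult_left_mono mult_right_mono powr_mono2) auto
      finally have t1: "cmod (T * of_real (F x)) \<le> B1 * U ^ K * BF * s powr (real K + L - real M) * r ^ M"
        by (simp add: mult_ac)
      have "cmod (\<Sum>k<K. cf k \<beta> * of_real (u x ^ k * F x - (\<Sum>e\<leftarrow>xs k. sph_term y e x))) \<le> (\<Sum>k<K. Q k * (\<bar>BK k\<bar> * r ^ M))"
      proof (rule sum_norm_le)
        fix k
        have "cmod (cf k \<beta>) \<le> Q k"
          using norm_falling_le[OF b2, of k] by (simp add: cf_def Q_def norm_divide divide_right_mono)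
        moreover have "\<bar>u x ^ k * F x - (\<Sum>e\<leftarrow>xs k. sph_term y e x)\<bar> \<le> \<bar>BK k\<bar> * r ^ M"
          by (rule order_trans[OF BK[OF x, of k]]) (auto simp: r_def intro!: mult_right_mono)
        ultimately show "cmod (cf k \<beta> * of_real (u x ^ k * F x - (\<Sum>e\<leftarrow>xs k. sph_term y e x))) \<le> Q k * (\<bar>BK k\<bar> * r ^ M)"
          unfolding norm_mult norm_of_real using Q by (intro mult_mono) auto
      qed
      also have "\<dots> = (\<Sum>k<K. Q k * \<bar>BK k\<bar>) * r ^ M" by (simp only: sum_distrib_right mult.assoc)
      finally have "cmod (T * of_real (F x) + (\<Sum>k<K. cf k \<beta> * of_real (u x ^ k * F x - (\<Sum>e\<leftarrow>xs k. sph_term y e x))))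
          \<le> (B1 * U ^ K * BF * s powr (real K + L - real M) + (\<Sum>k<K. Q k * \<bar>BK k\<bar>)) * r ^ M"
        using t1 by (intro order_trans[OF norm_triangle_ineq[of "T * of_real (F x)"]]) (simp add: distrib_right)
      hence "cmod (P \<beta>) * cmod (T * of_real (F x) + (\<Sum>k<K. cf k \<beta> * of_real (u x ^ k * F x - (\<Sum>e\<leftarrow>xs k. sph_term y e x))))
          \<le> P0 * ((B1 * U ^ K * BF * s powr (real K + L - real M) + (\<Sum>k<K. Q k * \<bar>BK k\<bar>)) * r ^ M)"
        using PP by (intro mult_mono) (auto simp: P0_def)
      thus "cmod (of_real (norm (x - y') / s') powr \<beta> * of_real (F x) - (\<Sum>(c, g, e)\<leftarrow>zs. e \<beta> * of_real (sph_term y (c, g) x)))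
          \<le> B * norm (x - y) ^ M"
        unfolding eq norm_mult B_def r_def[symmetric] by (simp only: mult.assoc)
    qed
  qed
  ultimately show ?thesis by blast
qed

subsection \<open>Integrals of the terms of an expansion\<close>

lemma continuous_on_of_real_powr:
  "continuous_on {0<..} (\<lambda>r. complex_of_real r powr w)"
  by (intro continuous_on_powr_complex) (auto intro!: continuous_intros simp: complex_nonpos_Reals_iff)

lemma of_real_powr_measurable [measurable]:
  assumes [measurable]: "h \<in> borel_measurable M" and "\<And>x. h x \<ge> 0"
  shows "(\<lambda>x. complex_of_real (h x) powr w) \<in> borel_measurable M"
proof -
  have [measurable]: "(exp :: complex \<Rightarrow> complex) \<in> borel_measurable borel"
    by (intro borel_measurable_continuous_onI continuous_intros)
  have "complex_of_real (h x) powr w = (if h x = 0 then 0 else exp (w * of_real (ln (h x))))" for x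
    using assms(2)[of x] by (simp add: of_real_powr_eq_exp)
  thus ?thesis by simp
qed

lemma norm_of_real_powr: "r \<ge> 0 \<Longrightarrow> cmod (complex_of_real r powr w) = r powr Re w"
  by (cases "r = 0") (simp_all add: of_real_powr_eq_exp powr_def)

lemma of_real_powr_mult_of_real_powr:
  assumes "r \<ge> 0"
  shows "complex_of_real r powr w * of_real (r powr c) = of_real r powr (w + of_real c)"
proof (cases "r = 0")
  case False
  hence r: "r > 0" using assms by simp
  have "complex_of_real (r powr c) = exp (of_real c * of_real (ln r))"
    using r by (simp add: powr_def flip: exp_of_real)
  thus ?thesis using r by (simp only: of_real_powr_eq_exp distrib_right exp_add)
qed simp

lemma of_real_square_mult_powr:
  assumes "r > 0"
  shows "complex_of_real (r\<^sup>2) * of_real r powr w = of_real r powr (w + 2)"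
  using of_real_powr_mult_of_real_powr[of r w 2] assms by (simp add: mult.commute)

lemma of_real_powr_divide:
  assumes "r \<ge> 0" "s > 0"
  shows "complex_of_real (r / s) powr w = of_real s powr (- w) * of_real r powr w"
proof (cases "r = 0")
  case False
  hence "ln (r / s) = ln r - ln s" "r / s > 0" "r > 0" using assms by (auto simp: ln_div)
  thus ?thesis using assms
    by (simp only: of_real_powr_eq_exp exp_add[symmetric]) (simp add: algebra_simps)
qed simp

text \<open>For a nonnegative function gauge integrability is absolute, which turns explicit
  improper integrals into Lebesgue integrals.\<close>

lemma set_integrable_lborelI_nonneg:
  fixes f :: "real \<Rightarrow> real"
  assumes "f integrable_on A" "\<And>x. x \<in> A \<Longrightarrow> f x \<ge> 0" "A \<in> sets borel" "f \<in> borel_measurable borel"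
  shows "set_integrable lborel A f"
proof -
  have "f absolutely_integrable_on A"
    by (rule nonnegative_absolutely_integrable_1[OF assms(1,2)])
  moreover have "(\<lambda>x. indicator A x *\<^sub>R f x) \<in> borel_measurable lborel"
    using assms(3,4) by measurable
  ultimately show ?thesis
    unfolding set_integrable_def by (simp only: integrable_completion)
qed

lemma set_integrable_cong_strong:
  assumes "\<And>x. x \<in> A \<Longrightarrow> f x = g x"
  shows "set_integrable M A f \<longleftrightarrow> set_integrable M A g"
  unfolding set_integrable_def
  by (intro Bochner_Integration.integrable_cong) (use assms in \<open>auto simp: indicator_def\<close>)

lemma set_lebesgue_integral_cong_strong:
  assumes "\<And>x. x \<in> A \<Longrightarrow> f x = g x"
  shows "set_lebesgue_integral M A f = set_lebesgue_integral M A g"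
  unfolding set_lebesgue_integral_def
  by (intro Bochner_Integration.integral_cong) (use assms in \<open>auto simp: indicator_def\<close>)

text \<open>Re w > - 3 makes the primitive r powr (w + 3) / (w + 3) continuous at 0 with value 0.
  The division by w + 3 is the origin of every pole of the continuation.\<close>

lemma radial_integral_ball:
  assumes w: "Re w > - 3" and s: "s > 0"
  shows "set_integrable lborel {0<..s} (\<lambda>r. of_real (r\<^sup>2) * of_real r powr w)"
    and "(LINT r:{0<..s}|lborel. of_real (r\<^sup>2) * of_real r powr w) = of_real s powr (w + 3) / (w + 3)"
proof -
  have "set_integrable lborel {0<..s} (\<lambda>r. r powr (Re w + 2))"
    using w s by (intro set_integrable_lborelI_nonneg integrable_on_powr_from_0') auto
  moreover have "set_borel_measurable lborel {0<..s} (\<lambda>r. of_real (r\<^sup>2) * of_real r powr w)"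
  proof -
    have "continuous_on {0<..s} (\<lambda>r. of_real (r\<^sup>2) * complex_of_real r powr w)"
      by (intro continuous_intros continuous_on_subset[OF continuous_on_of_real_powr]) auto
    from borel_measurable_continuous_on_indicator[OF _ this] show ?thesis
      unfolding set_borel_measurable_def by simp
  qed
  ultimately show int: "set_integrable lborel {0<..s} (\<lambda>r. of_real (r\<^sup>2) * of_real r powr w)"
  proof (rule set_integrable_bound, intro AE_I2 impI)
    fix r :: real assume r: "r \<in> {0<..s}"
    thus "norm (of_real (r\<^sup>2) * complex_of_real r powr w) \<le> norm (r powr (Re w + 2))"
      by (simp only: of_real_square_mult_powr norm_of_real_powr greaterThanAtMost_iff less_imp_le) simp
  qed
  have nz: "w + 3 \<noteq> 0" using w by (auto simp: complex_eq_iff)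
  have "((\<lambda>r. complex_of_real r powr (w + 2)) has_integral
      (complex_of_real s powr (w + 3) / (w + 3) - complex_of_real 0 powr (w + 3) / (w + 3))) {0..s}"
  proof (rule fundamental_theorem_of_calculus_interior)
    show "continuous_on {0..s} (\<lambda>r. complex_of_real r powr (w + 3) / (w + 3))"
      using w nz by (auto intro!: continuous_intros)
    fix x assume x: "x \<in> {0<..<s}"
    show "((\<lambda>r. complex_of_real r powr (w + 3) / (w + 3)) has_vector_derivative complex_of_real x powr (w + 2)) (at x)"
      using x nz by (auto intro!: derivative_eq_intros has_vector_derivative_real_field simp: complex_nonpos_Reals_iff add.commute)
  qed (use s in auto)
  hence "((\<lambda>r. complex_of_real r powr (w + 2)) has_integral (complex_of_real s powr (w + 3) / (w + 3))) {0..s}"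
    by simp
  moreover have "negligible ({0..s} - {0<..s})" "negligible ({0<..s} - {0..s})"
    by (rule negligible_subset[of "{0}"], auto)+
  ultimately have "((\<lambda>r. complex_of_real r powr (w + 2)) has_integral (complex_of_real s powr (w + 3) / (w + 3))) {0<..s}"
    by (subst has_integral_spike_set_eq[of "{0..s}" "{0<..s}", symmetric])
       (auto elim: negligible_subset)
  hence "((\<lambda>r. of_real (r\<^sup>2) * complex_of_real r powr w) has_integral (complex_of_real s powr (w + 3) / (w + 3))) {0<..s}"
    by (rule has_integral_eq[rotated]) (simp only: of_real_square_mult_powr greaterThanAtMost_iff)
  thus "(LINT r:{0<..s}|lborel. of_real (r\<^sup>2) * of_real r powr w) = of_real s powr (w + 3) / (w + 3)"
    using set_borel_integral_eq_integral(2)[OF int] by (simp add: integral_unique)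
qed

text \<open>Shells enter only through the partie finie, where exponents are real; the complex values
  merely fit the polar formula. At exponent - 3 the primitive is the logarithm.\<close>

lemma radial_integral_shell:
  assumes t: "0 < t" "t \<le> s"
  shows "set_integrable lborel {t<..s} (\<lambda>r. of_real (r\<^sup>2) * complex_of_real (r powr c))"
    and "(LINT r:{t<..s}|lborel. of_real (r\<^sup>2) * complex_of_real (r powr c))
      = of_real (if c = - 3 then ln (s / t) else (s powr (c + 3) - t powr (c + 3)) / (c + 3))"
proof -
  have cont: "continuous_on {t..s} (\<lambda>r. r\<^sup>2 * r powr c)"
    using t by (auto intro!: continuous_intros)
  have "set_integrable lborel {t..s} (\<lambda>r. r\<^sup>2 * r powr c)"
    unfolding set_integrable_def by (rule borel_integrable_compact[OF compact_Icc cont])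
  hence int_r: "set_integrable lborel {t<..s} (\<lambda>r. r\<^sup>2 * r powr c)"
    by (rule set_integrable_subset) auto
  thus "set_integrable lborel {t<..s} (\<lambda>r. of_real (r\<^sup>2) * complex_of_real (r powr c))"
    unfolding set_integrable_def
    using integrable_of_real[of lborel "\<lambda>r. indicator {t<..s} r *\<^sub>R (r\<^sup>2 * r powr c)"]
    by (simp add: scaleR_conv_of_real)
  define P where "P r = (if c = - 3 then ln r else r powr (c + 3) / (c + 3))" for r
  have "(\<integral>r. indicator {t..s} r *\<^sub>R (r\<^sup>2 * r powr c) \<partial>lborel) = P s - P t"
  proof (rule integral_FTC_atLeastAtMost[OF t(2) _ cont])
    fix r assume r: "t \<le> r" "r \<le> s"
    hence r0: "r > 0" using t by simp
    have e: "r\<^sup>2 * r powr c = r powr (c + 2)" using r0 by (simp add: powr_add)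
    have "(P has_real_derivative r\<^sup>2 * r powr c) (at r)"
    proof (cases "c = - 3")
      case True
      have "r powr (-1) = 1 / r" using r0 by (simp add: powr_minus_divide)
      thus ?thesis using r0 True unfolding e P_def by (auto intro!: derivative_eq_intros)
    next
      case False
      hence "c + 3 \<noteq> 0" by simp
      thus ?thesis
        using DERIV_cdivide[OF has_real_derivative_powr[OF r0, of "c + 3"], of "c + 3"] False
        unfolding e P_def by (simp add: add_diff_eq[symmetric])
    qed
    thus "(P has_vector_derivative r\<^sup>2 * r powr c) (at r within {t..s})"
      by (simp add: has_real_derivative_iff_has_vector_derivative has_vector_derivative_at_within)
  qed
  moreover have "(\<integral>r. indicator {t<..s} r *\<^sub>R (r\<^sup>2 * r powr c) \<partial>lborel) = (\<integral>r. indicator {t..s} r *\<^sub>R (r\<^sup>2 * r powr c) \<partial>lborel)"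
    by (intro integral_cong_AE eventually_mono[OF AE_lborel_singleton[of t]])
       (auto simp: indicator_def)
  moreover have "P s - P t = (if c = - 3 then ln (s / t) else (s powr (c + 3) - t powr (c + 3)) / (c + 3))"
    using t by (auto simp: P_def ln_div diff_divide_distrib)
  ultimately have "(\<integral>r. indicator {t<..s} r *\<^sub>R (r\<^sup>2 * r powr c) \<partial>lborel) = (if c = - 3 then ln (s / t) else (s powr (c + 3) - t powr (c + 3)) / (c + 3))"
    by simp
  thus "(LINT r:{t<..s}|lborel. of_real (r\<^sup>2) * complex_of_real (r powr c))
      = of_real (if c = - 3 then ln (s / t) else (s powr (c + 3) - t powr (c + 3)) / (c + 3))"
    unfolding set_lebesgue_integral_def
    using integral_complex_of_real[of lborel "\<lambda>r. indicator {t<..s} r *\<^sub>R (r\<^sup>2 * r powr c)"]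
    by (simp add: scaleR_conv_of_real)
qed

lemma ball_integral_sph_term:
  assumes w: "Re w > - 3" and s: "s > 0" and g: "continuous_on (sphere 0 1) g"
  shows "set_integrable lborel (cball y s) (\<lambda>x. of_real (norm (x - y)) powr w * of_real (g (dir y x)))"
    and "(LINT x:cball y s|lborel. of_real (norm (x - y)) powr w * of_real (g (dir y x)))
       = of_real s powr (w + 3) / (w + 3) * of_real (solid_angle_integral g)"
proof -
  \<comment> \<open>Set to 0 for negative radii, so that only powers of nonnegative numbers have to
    be measurable.\<close>
  define k where "k r = (if r \<ge> 0 then complex_of_real r powr w else 0)" for r
  have km: "k \<in> borel_measurable borel"
  proof -
    have "k = (\<lambda>r. if r \<ge> 0 then complex_of_real (max 0 r) powr w else 0)"
      by (auto simp: k_def)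
    thus ?thesis by simp
  qed
  have "set_integrable lborel {0<..s} (\<lambda>r. of_real (r\<^sup>2) * k r)
      \<longleftrightarrow> set_integrable lborel {0<..s} (\<lambda>r. of_real (r\<^sup>2) * of_real r powr w)"
    by (rule set_integrable_cong_strong) (simp add: k_def)
  hence int: "set_integrable lborel {0<..s} (\<lambda>r. of_real (r\<^sup>2) * k r)"
    using radial_integral_ball(1)[OF w s] by (simp only:)
  have "(LINT r:{0<..s}|lborel. of_real (r\<^sup>2) * k r) = (LINT r:{0<..s}|lborel. of_real (r\<^sup>2) * of_real r powr w)"
    by (rule set_lebesgue_integral_cong_strong) (simp add: k_def)
  hence val: "(LINT r:{0<..s}|lborel. of_real (r\<^sup>2) * k r) = of_real s powr (w + 3) / (w + 3)"
    using radial_integral_ball(2)[OF w s] by (simp only:)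
  have eq: "indicator {x. norm (x - y) \<in> {0<..s}} x *\<^sub>R (k (norm (x - y)) * of_real (g (dir y x)))
     = indicator (cball y s) x *\<^sub>R (of_real (norm (x - y)) powr w * of_real (g (dir y x)))" for x
    by (auto simp: indicator_def k_def dist_norm norm_minus_commute)
  have T: "{0<..s} \<in> sets borel" "{0<..s} \<subseteq> {0<..}" by auto
  note P = set_integral_polar_shell[OF km T int g, of y]
  show "set_integrable lborel (cball y s) (\<lambda>x. of_real (norm (x - y)) powr w * of_real (g (dir y x)))"
    using P(1) unfolding set_integrable_def eq .
  show "(LINT x:cball y s|lborel. of_real (norm (x - y)) powr w * of_real (g (dir y x)))
       = of_real s powr (w + 3) / (w + 3) * of_real (solid_angle_integral g)"
    using P(2) unfolding set_lebesgue_integral_def eq val[unfolded set_lebesgue_integral_def] .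
qed

lemma ball_integrable_powr:
  assumes c: "c > - 3" and s: "s > 0"
  shows "set_integrable lborel (cball y s) (\<lambda>x :: real ^ 3. norm (x - y) powr c)"
proof -
  have "set_integrable lborel (cball y s) (\<lambda>x. complex_of_real (norm (x - y)) powr of_real c * of_real ((\<lambda>_. 1) (dir y x)))"
    by (rule ball_integral_sph_term(1)) (use c s in auto)
  hence "integrable lborel (\<lambda>x. norm (indicator (cball y s) x *\<^sub>R (complex_of_real (norm (x - y)) powr of_real c * of_real ((\<lambda>_. 1) (dir y x)))))"
    unfolding set_integrable_def by (rule integrable_norm)
  thus ?thesis unfolding set_integrable_def
    by (simp add: norm_of_real_powr)
qed

lemma shell_integral_sph_term:
  assumes t: "0 < t" "t \<le> s" and g: "continuous_on (sphere 0 1) g"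
  shows "set_integrable lborel (cball y s - cball y t) (sph_term y (c, g))"
    and "(LINT x:cball y s - cball y t|lborel. sph_term y (c, g) x)
       = (if c = - 3 then ln (s / t) else (s powr (c + 3) - t powr (c + 3)) / (c + 3)) * solid_angle_integral g"
proof -
  have eq: "indicator {x. norm (x - y) \<in> {t<..s}} x *\<^sub>R (complex_of_real (norm (x - y) powr c) * of_real (g (dir y x)))
     = of_real (indicator (cball y s - cball y t) x *\<^sub>R sph_term y (c, g) x)" for x
    by (auto simp: indicator_def sph_term_def dist_norm norm_minus_commute)
  have T: "{t<..s} \<in> sets borel" "{t<..s} \<subseteq> {0<..}" using t by auto
  have m: "(\<lambda>r. complex_of_real (r powr c)) \<in> borel_measurable borel" by measurable
  note P = set_integral_polar_shell[OF m T radial_integral_shell(1)[OF t, of c] g, of y]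
  show "set_integrable lborel (cball y s - cball y t) (sph_term y (c, g))"
    using P(1) unfolding set_integrable_def eq by (simp only: complex_of_real_integrable_eq)
  have "complex_of_real (LINT x:cball y s - cball y t|lborel. sph_term y (c, g) x)
      = of_real (if c = - 3 then ln (s / t) else (s powr (c + 3) - t powr (c + 3)) / (c + 3)) * of_real (solid_angle_integral g)"
    using P(2) unfolding radial_integral_shell(2)[OF t, of c]
    unfolding set_lebesgue_integral_def eq integral_complex_of_real .
  thus "(LINT x:cball y s - cball y t|lborel. sph_term y (c, g) x)
       = (if c = - 3 then ln (s / t) else (s powr (c + 3) - t powr (c + 3)) / (c + 3)) * solid_angle_integral g"
    by (simp only: of_real_mult[symmetric] of_real_eq_iff)
qed

text \<open>In polar coordinates this is the convergence of the integral of r powr (w + 2) at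
  infinity.\<close>

lemma tail_integrable_powr:
  assumes w: "w < - 3" and R: "R > 0"
  shows "set_integrable lborel {x :: real ^ 3. R < norm x} (\<lambda>x. norm x powr w)"
proof -
  have "((\<lambda>r. r powr (w + 2)) has_integral -(R powr (w + 2 + 1)) / (w + 2 + 1)) {R..}"
    using w R by (intro has_integral_powr_to_inf) auto
  hence "(\<lambda>r. r powr (w + 2)) integrable_on {R..}" by (rule has_integral_integrable)
  hence "set_integrable lborel {R..} (\<lambda>r. r powr (w + 2))"
    by (rule set_integrable_lborelI_nonneg) simp_all
  hence "set_integrable lborel {R<..} (\<lambda>r. r powr (w + 2))"
    by (rule set_integrable_subset) (simp, rule subsetI, simp)
  moreover have "r powr (w + 2) = r\<^sup>2 * r powr w" if "r \<in> {R<..}" for r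
    using that R by (simp add: powr_add)
  hence "set_integrable lborel {R<..} (\<lambda>r. r powr (w + 2)) \<longleftrightarrow> set_integrable lborel {R<..} (\<lambda>r. r\<^sup>2 * r powr w)"
    by (rule set_integrable_cong_strong)
  ultimately have "set_integrable lborel {R<..} (\<lambda>r. r\<^sup>2 * r powr w)"
    by (simp only:)
  hence "integrable lborel (\<lambda>r. complex_of_real (indicator {R<..} r *\<^sub>R (r\<^sup>2 * r powr w)))"
    unfolding set_integrable_def by (rule integrable_of_real)
  hence int: "set_integrable lborel {R<..} (\<lambda>r. of_real (r\<^sup>2) * complex_of_real (r powr w))"
    unfolding set_integrable_def by (simp add: scaleR_conv_of_real)
  have m: "(\<lambda>r. complex_of_real (r powr w)) \<in> borel_measurable borel" by measurable
  have T: "{R<..} \<in> sets borel" "{R<..} \<subseteq> {0<..}" using R by auto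
  have "continuous_on (sphere 0 1) (\<lambda>_ :: real ^ 3. 1 :: real)" by simp
  from set_integral_polar_shell(1)[OF m T int this, of 0]
  have "integrable lborel (\<lambda>x :: real ^ 3. norm (indicator {x. norm (x - 0) \<in> {R<..}} x *\<^sub>R (complex_of_real (norm (x - 0) powr w) * of_real 1)))"
    unfolding set_integrable_def by (rule integrable_norm)
  thus ?thesis unfolding set_integrable_def by (simp add: greaterThan_def)
qed

subsection \<open>Continuation of the integral over a ball\<close>

lemma sph_term_measurable:
  assumes "continuous_on (sphere 0 1) (snd e)"
  shows "sph_term y e \<in> borel_measurable borel"
  using continuous_on_sphere_measurable[OF assms, of y] unfolding sph_term_def by measurable

lemma sum_list_measurable:
  fixes f :: "'b \<Rightarrow> 'a \<Rightarrow> 'c::{second_countable_topology, topological_monoid_add}"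
  assumes "\<And>e. e \<in> set xs \<Longrightarrow> f e \<in> borel_measurable M"
  shows "(\<lambda>x. \<Sum>e\<leftarrow>xs. f e x) \<in> borel_measurable M"
  using assms by (induction xs) (auto intro!: borel_measurable_add)

lemma set_integrable_sum_list:
  fixes f :: "'b \<Rightarrow> 'a \<Rightarrow> 'c::{second_countable_topology, banach}"
  assumes "\<And>e. e \<in> set xs \<Longrightarrow> set_integrable M A (f e)"
  shows "set_integrable M A (\<lambda>x. \<Sum>e\<leftarrow>xs. f e x)"
  using assms
proof (induction xs)
  case Nil
  show ?case by (simp add: set_integrable_def)
next
  case (Cons e xs)
  show ?case unfolding list.simps sum_list.Cons
    by (rule set_integral_add(1)) (use Cons in auto)
qed

lemma set_integral_sum_list:
  fixes f :: "'b \<Rightarrow> 'a \<Rightarrow> 'c::{second_countable_topology, banach}"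
  assumes "\<And>e. e \<in> set xs \<Longrightarrow> set_integrable M A (f e)"
  shows "(LINT x:A|M. (\<Sum>e\<leftarrow>xs. f e x)) = (\<Sum>e\<leftarrow>xs. LINT x:A|M. f e x)"
  using assms
proof (induction xs)
  case Nil
  show ?case by (simp add: set_lebesgue_integral_def)
next
  case (Cons e xs)
  have "(LINT x:A|M. f e x + (\<Sum>e\<leftarrow>xs. f e x)) = (LINT x:A|M. f e x) + (LINT x:A|M. (\<Sum>e\<leftarrow>xs. f e x))"
    by (rule set_integral_add(2)) (use Cons set_integrable_sum_list[of xs M A f] in auto)
  thus ?case using Cons by simp
qed

text \<open>A factor of order M in the distance moves the boundary of convergence to Re \<alpha> = -
  M - 3. Around a point p the modulus of the power of r / s1 is dominated by the sum of its values
  at the two extreme real parts \<open>c\<close> and \<open>d\<close>.\<close>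

lemma holomorphic2_on_ball_integral:
  fixes W :: "complex \<Rightarrow> real ^ 3 \<Rightarrow> complex"
  assumes s: "s > 0" and s1: "s1 > 0"
    and hol: "\<And>x. x \<noteq> y \<Longrightarrow> (\<lambda>\<beta>. W \<beta> x) holomorphic_on UNIV"
    and meas: "\<And>\<beta>. W \<beta> \<in> borel_measurable borel"
    and bound: "\<And>A. \<exists>B\<ge>0. \<forall>\<beta> x. cmod \<beta> \<le> A \<longrightarrow> 0 < norm (x - y) \<longrightarrow> norm (x - y) \<le> s \<longrightarrow> cmod (W \<beta> x) \<le> B * norm (x - y) ^ M"
  shows "holomorphic2_on (\<lambda>p. LINT x:cball y s|lborel. of_real (norm (x - y) / s1) powr fst p * W (snd p) x) {p. Re (fst p) > - real M - 3}"
    and "Re (fst p) > - real M - 3 \<Longrightarrow> set_integrable lborel (cball y s) (\<lambda>x. of_real (norm (x - y) / s1) powr fst p * W (snd p) x)"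
proof -
  define D where "D = {p :: complex \<times> complex. Re (fst p) > - real M - 3}"
  define g where "g p x = indicator (cball y s) x *\<^sub>R (of_real (norm (x - y) / s1) powr fst p * W (snd p) x)" for p x
  have D: "open D" unfolding D_def by (intro open_Collect_less continuous_intros)
  have meas_g: "g p \<in> borel_measurable lborel" for p
  proof -
    have [measurable]: "(\<lambda>x. complex_of_real (norm (x - y) / s1) powr fst p) \<in> borel_measurable borel"
      by (rule of_real_powr_measurable) (use s1 in auto)
    have [measurable]: "cball y s \<in> sets borel" by simp
    note meas[of "snd p", measurable]
    show ?thesis unfolding g_def by measurable
  qed
  have dom: "\<exists>r>0. \<exists>w. integrable lborel w \<and> ball p r \<subseteq> D \<and> (\<forall>q\<in>ball p r. \<forall>x\<in>space lborel. cmod (g q x) \<le> w x)"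
    if p: "p \<in> D" for p
  proof -
    \<comment> \<open>Half the distance of Re (fst p) from the boundary, so that even the smaller
      exponent c stays in the half-plane.\<close>
    define \<rho> where "\<rho> = (Re (fst p) + real M + 3) / 2"
    have \<rho>: "\<rho> > 0" using p by (simp add: D_def \<rho>_def)
    define c d where "c = Re (fst p) - \<rho>" and "d = Re (fst p) + \<rho>"
    have c: "c > - real M - 3" using p unfolding c_def \<rho>_def by (simp add: D_def field_simps)
    have d: "d > - real M - 3" using c \<rho> by (simp add: c_def d_def)
    have re: "c \<le> Re (fst q)" "Re (fst q) \<le> d" "cmod (snd q) \<le> cmod (snd p) + \<rho>" if q: "q \<in> ball p \<rho>" for q
    proof -
      have "\<bar>Re (fst q) - Re (fst p)\<bar> \<le> dist q p"
        using dist_fst_le[of q p] abs_Re_le_cmod[of "fst q - fst p"] by (simp add: dist_norm)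
      moreover have "cmod (snd q) - cmod (snd p) \<le> dist q p"
        using dist_snd_le[of q p] norm_triangle_ineq2[of "snd q" "snd p"] by (simp add: dist_norm)
      ultimately show "c \<le> Re (fst q)" "Re (fst q) \<le> d" "cmod (snd q) \<le> cmod (snd p) + \<rho>"
        using q unfolding c_def d_def mem_ball dist_commute[of p q] by linarith+
    qed
    obtain B where B: "B \<ge> 0" "\<And>\<beta> x. cmod \<beta> \<le> cmod (snd p) + \<rho> \<Longrightarrow> 0 < norm (x - y) \<Longrightarrow> norm (x - y) \<le> s \<Longrightarrow> cmod (W \<beta> x) \<le> B * norm (x - y) ^ M"
      using bound[of "cmod (snd p) + \<rho>"] by blast
    define w where "w x = indicator (cball y s) x *\<^sub>R (B * s1 powr (- c) * norm (x - y) powr (c + real M))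
        + indicator (cball y s) x *\<^sub>R (B * s1 powr (- d) * norm (x - y) powr (d + real M))" for x
    have "integrable lborel w"
      unfolding w_def
    proof (intro Bochner_Integration.integrable_add)
      show "integrable lborel (\<lambda>x. indicator (cball y s) x *\<^sub>R (B * s1 powr (- c) * norm (x - y) powr (c + real M)))"
        unfolding set_integrable_def[symmetric]
        by (rule set_integrable_mult_right, rule ball_integrable_powr) (use c s in auto)
      show "integrable lborel (\<lambda>x. indicator (cball y s) x *\<^sub>R (B * s1 powr (- d) * norm (x - y) powr (d + real M)))"
        unfolding set_integrable_def[symmetric]
        by (rule set_integrable_mult_right, rule ball_integrable_powr) (use d s in auto)
    qed
    moreover have "ball p \<rho> \<subseteq> D" using re(1) c by (force simp: D_def)
    moreover have "cmod (g q x) \<le> w x" if q: "q \<in> ball p \<rho>" for q x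
    proof (cases "x \<in> cball y s \<and> x \<noteq> y")
      case True
      define r where "r = norm (x - y)"
      have r: "r > 0" "r \<le> s" using True by (auto simp: r_def dist_norm norm_minus_commute)
      have rs: "r / s1 > 0" using r s1 by simp
      have "cmod (of_real (r / s1) powr fst q) = (r / s1) powr Re (fst q)"
        by (rule norm_of_real_powr) (use rs in simp)
      also have "\<dots> = exp (Re (fst q) * ln (r / s1))" using r s1 by (simp add: powr_def)
      also have "\<dots> \<le> exp (c * ln (r / s1)) + exp (d * ln (r / s1))"
        by (rule exp_mult_le_corners[OF re(1,2)[OF q]])
      also have "exp (c * ln (r / s1)) = s1 powr (- c) * r powr c"
        using r s1 by (simp add: powr_def ln_div exp_add[symmetric] algebra_simps)
      also have "exp (d * ln (r / s1)) = s1 powr (- d) * r powr d"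
        using r s1 by (simp add: powr_def ln_div exp_add[symmetric] algebra_simps)
      finally have "cmod (of_real (r / s1) powr fst q * W (snd q) x) \<le> (s1 powr (- c) * r powr c + s1 powr (- d) * r powr d) * (B * r ^ M)"
        unfolding norm_mult using B(2)[OF re(3)[OF q], of x] r by (intro mult_mono) (auto simp: r_def)
      also have "\<dots> = B * s1 powr (- c) * r powr (c + real M) + B * s1 powr (- d) * r powr (d + real M)"
        using r by (simp add: powr_add powr_realpow algebra_simps)
      finally show ?thesis using True unfolding g_def w_def r_def by simp
    next
      case False
      \<comment> \<open>At the centre the power of 0 is 0 whatever the exponent, so a singularity of
        \<open>W\<close> there does no harm.\<close>
      hence "g q x = 0" by (auto simp: g_def)
      moreover have "w x \<ge> 0" unfolding w_def using B(1) by (intro add_nonneg_nonneg scaleR_nonneg_nonneg mult_nonneg_nonneg) auto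
      ultimately show ?thesis by simp
    qed
    ultimately show ?thesis using \<rho> by blast
  qed
  have "holomorphic2_on (\<lambda>p. \<integral>x. g p x \<partial>lborel) D"
  proof (rule holomorphic2_on_integral)
    fix x
    show "holomorphic2_on (\<lambda>p. g p x) D"
    proof (cases "x \<in> cball y s \<and> x \<noteq> y")
      case True
      hence rs: "norm (x - y) / s1 > 0" using s1 by simp
      have "holomorphic2_on (\<lambda>p. exp (fst p * of_real (ln (norm (x - y) / s1))) * W (snd p) x) D"
      proof (intro holomorphic2_on_mult)
        show "holomorphic2_on (\<lambda>p. exp (fst p * of_real (ln (norm (x - y) / s1)))) D"
          by (rule holomorphic2_on_fst_compose) (intro holomorphic_intros)
        show "holomorphic2_on (\<lambda>p. W (snd p) x) D"
          by (rule holomorphic2_on_snd_compose[OF hol]) (use True in auto)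
      qed
      thus ?thesis using True unfolding g_def of_real_powr_eq_exp[OF rs] by simp
    next
      case False
      hence "(\<lambda>p. g p x) = (\<lambda>_. 0)" by (auto simp: g_def)
      thus ?thesis by (simp add: holomorphic2_on_const)
    qed
  qed (use meas_g dom in auto)
  thus "holomorphic2_on (\<lambda>p. LINT x:cball y s|lborel. of_real (norm (x - y) / s1) powr fst p * W (snd p) x) {p. Re (fst p) > - real M - 3}"
    unfolding g_def D_def set_lebesgue_integral_def .
  assume "Re (fst p) > - real M - 3"
  then obtain r w where rw: "r > 0" "integrable lborel w" "\<forall>q\<in>ball p r. \<forall>x\<in>space lborel. cmod (g q x) \<le> w x"
    using dom[of p] by (auto simp: D_def)
  have "integrable lborel (g p)"
  proof (rule Bochner_Integration.integrable_bound[OF rw(2) meas_g])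
    have "cmod (g p x) \<le> norm (w x)" for x
    proof -
      have "cmod (g p x) \<le> w x" using rw by simp
      thus ?thesis by simp
    qed
    thus "AE x in lborel. norm (g p x) \<le> norm (w x)" by simp
  qed
  thus "set_integrable lborel (cball y s) (\<lambda>x. of_real (norm (x - y) / s1) powr fst p * W (snd p) x)"
    unfolding set_integrable_def g_def .
qed

text \<open>The primitive of r^2 r powr c at s, with the constant of integration fixed by s1 in the
  logarithmic case. It is the finite part at \<alpha> = 0 of the radial integral up to s, and for c
  at most - 3 also what remains of a shell integral after adding the counterterm at the inner
  radius.\<close>

definition shell_value :: "real \<Rightarrow> real \<Rightarrow> real \<Rightarrow> real" where
  "shell_value s s1 c = (if c = - 3 then ln (s / s1) else s powr (c + 3) / (c + 3))"

text \<open>The finite part at \<open>\<alpha> = 0\<close> of the integral of \<open>(r / s1) powr \<alpha> * F\<close> over \<open>cball y s\<close>,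
  computed from the expansion of \<open>F\<close> to order \<open>N\<close>.\<close>

definition ball_FP :: "(real ^ 3 \<Rightarrow> real) \<Rightarrow> real ^ 3 \<Rightarrow> real \<Rightarrow> real \<Rightarrow> (real \<times> (real ^ 3 \<Rightarrow> real)) list \<Rightarrow> real" where
  "ball_FP F y s s1 xs = (\<Sum>e\<leftarrow>xs. shell_value s s1 (fst e) * solid_angle_integral (snd e))
     + (LINT x:cball y s|lborel. F x - (\<Sum>e\<leftarrow>xs. sph_term y e x))"

text \<open>The numerator is entire. For c = - 3 it is divided by \<alpha>, and its derivative ln s
  - ln s1 at 0 is the finite part: this is how the scale s1 enters the logarithm. Otherwise the
  quotient is regular at 0 and s1 drops out.\<close>

lemma has_FP_shell_value:
  assumes s: "s > 0" "s1 > 0"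
  shows "has_FP (\<lambda>\<alpha>. of_real s1 powr (- \<alpha>) * of_real s powr (\<alpha> + of_real c + 3) / (\<alpha> + of_real c + 3))
    (of_real (shell_value s s1 c))"
proof -
  define N where "N \<alpha> = of_real s1 powr (- \<alpha>) * of_real s powr (\<alpha> + of_real c + 3)" for \<alpha> :: complex
  have N: "N \<alpha> = exp (- \<alpha> * of_real (ln s1) + (\<alpha> + of_real c + 3) * of_real (ln s))" for \<alpha>
    unfolding N_def of_real_powr_eq_exp[OF s(1)] of_real_powr_eq_exp[OF s(2)] exp_add ..
  have holN: "N holomorphic_on A" for A
    unfolding N by (intro holomorphic_intros)
  show ?thesis
  proof (cases "c = - 3")
    case True
    have "has_FP (\<lambda>\<alpha>. N \<alpha> / \<alpha>) (deriv N 0)"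
      by (rule has_FP_simple_pole[OF holN, of 1]) auto
    moreover have "(N has_field_derivative (of_real (ln s) - of_real (ln s1))) (at 0)"
      unfolding N True by (auto intro!: derivative_eq_intros)
    hence "deriv N 0 = of_real (shell_value s s1 c)"
      using s True by (simp add: DERIV_imp_deriv shell_value_def ln_div)
    ultimately show ?thesis using True by (simp add: N_def)
  next
    case False
    \<comment> \<open>The distance from 0 to the only pole, \<alpha> = - c - 3.\<close>
    define d where "d = \<bar>c + 3\<bar>"
    have d: "d > 0" using False by (simp add: d_def)
    have nz: "\<alpha> + of_real c + 3 \<noteq> 0" if "\<alpha> \<in> ball 0 d" for \<alpha> :: complex
    proof
      assume "\<alpha> + of_real c + 3 = 0"
      hence "\<alpha> = - of_real (c + 3)"
        by (simp only: eq_neg_iff_add_eq_0 add.assoc of_real_add of_real_numeral)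
      hence "cmod \<alpha> = d" by (simp only: d_def norm_minus_cancel norm_of_real)
      thus False using that by simp
    qed
    have "has_FP (\<lambda>\<alpha>. N \<alpha> / (\<alpha> + of_real c + 3)) (N 0 / (0 + of_real c + 3))"
      by (rule has_FP_analytic[of _ d]) (use holN nz d in \<open>auto intro!: holomorphic_intros\<close>)
    moreover have "N 0 = of_real (s powr (c + 3))"
      using s by (simp add: N powr_def flip: exp_of_real)
    ultimately show ?thesis using False by (simp add: N_def shell_value_def)
  qed
qed

text \<open>Clearing denominators turns a meromorphic continuation J into an identity Q J = Hp
  between holomorphic functions, the form in which the identity theorem is applied. Poles repeated
  in the list only give \<open>Q\<close> zeros of higher order.\<close>

lemma partial_fractions_common_denominator:
  fixes ps :: "(complex \<times> (complex \<times> complex \<Rightarrow> complex)) list"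
  assumes "\<And>c e. (c, e) \<in> set ps \<Longrightarrow> holomorphic2_on e U" and "holomorphic2_on h U"
  shows "\<exists>Q Hp. Q holomorphic_on UNIV \<and> (\<forall>z. Q z = 0 \<longleftrightarrow> z \<in> fst ` set ps) \<and> holomorphic2_on Hp U \<and>
    (\<forall>p. fst p \<notin> fst ` set ps \<longrightarrow> Q (fst p) * ((\<Sum>(c, e)\<leftarrow>ps. e p / (fst p - c)) + h p) = Hp p)"
  using assms
proof (induction ps)
  case Nil
  thus ?case by (intro exI[of _ "\<lambda>_. 1"] exI[of _ h]) auto
next
  case (Cons ce ps)
  obtain c e where ce: "ce = (c, e)" by force
  obtain Q Hp where Q: "Q holomorphic_on UNIV" "\<And>z. Q z = 0 \<longleftrightarrow> z \<in> fst ` set ps" and Hp: "holomorphic2_on Hp U"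
    and eq: "\<And>p. fst p \<notin> fst ` set ps \<Longrightarrow> Q (fst p) * ((\<Sum>(c, e)\<leftarrow>ps. e p / (fst p - c)) + h p) = Hp p"
    using Cons by force
  show ?case
  proof (intro exI[of _ "\<lambda>z. (z - c) * Q z"] exI[of _ "\<lambda>p. e p * Q (fst p) + (fst p - c) * Hp p"] conjI allI impI)
    show "(\<lambda>z. (z - c) * Q z) holomorphic_on UNIV" using Q(1) by (intro holomorphic_intros)
    show "(z - c) * Q z = 0 \<longleftrightarrow> z \<in> fst ` set (ce # ps)" for z using Q(2) by (auto simp: ce)
    show "holomorphic2_on (\<lambda>p. e p * Q (fst p) + (fst p - c) * Hp p) U"
      using Cons.prems(1)[of c e] Hp
      by (intro holomorphic2_intros holomorphic2_on_fst_compose[OF Q(1)]) (auto simp: ce)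
    fix p :: "complex \<times> complex" assume p: "fst p \<notin> fst ` set (ce # ps)"
    hence "fst p - c \<noteq> 0" "fst p \<notin> fst ` set ps" by (auto simp: ce)
    thus "(fst p - c) * Q (fst p) * ((\<Sum>(c, e)\<leftarrow>ce # ps. e p / (fst p - c)) + h p) = e p * Q (fst p) + (fst p - c) * Hp p"
      by (simp add: ce eq[symmetric] field_simps)
  qed
qed

lemma continuous_except_measurable:
  fixes F :: "real ^ 3 \<Rightarrow> real"
  assumes "continuous_on (- {y, y'}) F"
  shows "F \<in> borel_measurable borel"
  by (rule borel_measurable_continuous_countable_exceptions[of "{y, y'}"]) (use assms in auto)

text \<open>The terms of the expansion integrate to simple fractions in \<alpha>, and the remainder
  \<open>W\<close> to a function holomorphic for Re \<alpha> > - M - 3. The last conjunct is taken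
  on the line \<beta> = 0, where the expansion with parameter reduces to that of \<open>F\<close>
  and the finite part becomes explicit.\<close>

lemma local_partial_fractions:
  assumes yy: "y \<noteq> y'" and s: "s > 0" "s < norm (y - y')" and s1: "s1 > 0" and s': "s' > 0"
    and cont: "continuous_on (- {y, y'}) F" and F: "fin_expansion F y s a0 M xs"
  shows "\<exists>ps h. (\<forall>(c, e)\<in>set ps. Re c \<le> - a0 - 3 \<and> holomorphic2_on e UNIV) \<and>
    holomorphic2_on h {p. Re (fst p) > - real M - 3} \<and>
    (\<forall>p. Re (fst p) > - a0 - 3 \<longrightarrow> Re (fst p) > - real M - 3 \<longrightarrow>
       set_integrable lborel (cball y s) (regularized y y' s1 s' F p) \<and>
       (LINT x:cball y s|lborel. regularized y y' s1 s' F p x) = (\<Sum>(c, e)\<leftarrow>ps. e p / (fst p - c)) + h p) \<and>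
    has_FP (\<lambda>\<alpha>. (\<Sum>(c, e)\<leftarrow>ps. e (\<alpha>, 0) / (\<alpha> - c)) + h (\<alpha>, 0)) (of_real (ball_FP F y s s1 xs))"
proof -
  obtain zs :: "(real \<times> (real ^ 3 \<Rightarrow> real) \<times> (complex \<Rightarrow> complex)) list" where
    zs: "\<And>c g e. (c, g, e) \<in> set zs \<Longrightarrow> c \<ge> a0 \<and> continuous_on (sphere 0 1) g \<and> e holomorphic_on UNIV"
    and bound: "\<And>A. \<exists>B\<ge>0. \<forall>\<beta> x. cmod \<beta> \<le> A \<longrightarrow> 0 < norm (x - y) \<longrightarrow> norm (x - y) \<le> s \<longrightarrow>
       cmod (of_real (norm (x - y') / s') powr \<beta> * of_real (F x) - (\<Sum>(c, g, e)\<leftarrow>zs. e \<beta> * of_real (sph_term y (c, g) x)))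
         \<le> B * norm (x - y) ^ M"
    and collapse: "\<And>\<phi> :: real \<times> (real ^ 3 \<Rightarrow> real) \<Rightarrow> complex. (\<Sum>(c, g, e)\<leftarrow>zs. e 0 * \<phi> (c, g)) = (\<Sum>e\<leftarrow>xs. \<phi> e)"
    using expansion_with_parameter[OF yy s s' F] by fast
  define T where "T z \<beta> x = (case z of (c, g, e) \<Rightarrow> e \<beta> * of_real (sph_term y (c, g) x))"
    for z :: "real \<times> (real ^ 3 \<Rightarrow> real) \<times> (complex \<Rightarrow> complex)" and \<beta> x
  define W where "W \<beta> x = of_real (norm (x - y') / s') powr \<beta> * of_real (F x) - (\<Sum>z\<leftarrow>zs. T z \<beta> x)" for \<beta> x
  have W': "W \<beta> x = of_real (norm (x - y') / s') powr \<beta> * of_real (F x) - (\<Sum>(c, g, e)\<leftarrow>zs. e \<beta> * of_real (sph_term y (c, g) x))" for \<beta> x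
    unfolding W_def T_def ..
  define h where "h p = (LINT x:cball y s|lborel. of_real (norm (x - y) / s1) powr fst p * W (snd p) x)" for p
  \<comment> \<open>The numerators still depend on \<alpha>, through entire factors; they are
    residues only after evaluation at the pole.\<close>
  define E where "E z p = (case z of (c, g, e) \<Rightarrow>
      e (snd p) * (of_real s1 powr (- fst p) * of_real s powr (fst p + of_real c + 3) * of_real (solid_angle_integral g)))"
    for z :: "real \<times> (real ^ 3 \<Rightarrow> real) \<times> (complex \<Rightarrow> complex)" and p :: "complex \<times> complex"
  define ps where "ps = map (\<lambda>z. (- of_real (fst z) - 3 :: complex, E z)) zs"
  have [measurable]: "F \<in> borel_measurable borel" by (rule continuous_except_measurable[OF cont])
  have far: "norm (x - y') > 0" if "x \<in> cball y s" for x
    using that s by (auto simp: dist_norm norm_minus_commute)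
  have T_meas: "T z \<beta> \<in> borel_measurable borel" if "z \<in> set zs" for z \<beta>
  proof -
    obtain c g e where z: "z = (c, g, e)" by (cases z)
    have "sph_term y (c, g) \<in> borel_measurable borel"
      by (rule sph_term_measurable) (use zs that z in auto)
    thus ?thesis unfolding T_def z prod.case by measurable
  qed
  have W_meas: "W \<beta> \<in> borel_measurable borel" for \<beta>
  proof -
    have [measurable]: "(\<lambda>x. complex_of_real (norm (x - y') / s') powr \<beta>) \<in> borel_measurable borel"
      by (rule of_real_powr_measurable) (use s' in auto)
    have [measurable]: "(\<lambda>x. \<Sum>z\<leftarrow>zs. T z \<beta> x) \<in> borel_measurable borel"
      by (rule sum_list_measurable) (rule T_meas)
    show ?thesis unfolding W_def by measurable
  qed
  have W_bound: "\<exists>B\<ge>0. \<forall>\<beta> x. cmod \<beta> \<le> A \<longrightarrow> 0 < norm (x - y) \<longrightarrow> norm (x - y) \<le> s \<longrightarrow> cmod (W \<beta> x) \<le> B * norm (x - y) ^ M" for A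
    unfolding W' by (rule bound)
  have W_hol: "(\<lambda>\<beta>. W \<beta> x) holomorphic_on UNIV" for x
  proof -
    have "(\<lambda>\<beta>. of_real (norm (x - y') / s') powr \<beta> * of_real (F x)) holomorphic_on UNIV"
      by (cases "norm (x - y') / s' = 0") (auto intro!: holomorphic_intros)
    moreover have "(\<lambda>\<beta>. \<Sum>z\<leftarrow>zs'. T z \<beta> x) holomorphic_on UNIV" if "set zs' \<subseteq> set zs" for zs'
      using that by (induction zs') (auto simp: T_def dest!: zs intro!: holomorphic_intros split: prod.splits)
    ultimately show ?thesis unfolding W_def by (intro holomorphic_intros) auto
  qed
  note hint = holomorphic2_on_ball_integral[OF s(1) s1 W_hol W_meas W_bound]
  have h_hol: "holomorphic2_on h {p. Re (fst p) > - real M - 3}"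
    unfolding h_def by (rule hint(1))
  have ps: "\<forall>(c, e)\<in>set ps. Re c \<le> - a0 - 3 \<and> holomorphic2_on e UNIV"
  proof -
    have "Re (- of_real (fst z) - 3) \<le> - a0 - 3 \<and> holomorphic2_on (E z) UNIV" if "z \<in> set zs" for z
    proof -
      obtain c g e where z: "z = (c, g, e)" by (cases z)
      have e: "c \<ge> a0" "e holomorphic_on UNIV" using zs that z by auto
      have "holomorphic2_on (\<lambda>p. e (snd p) * (exp (- fst p * of_real (ln s1)) * exp ((fst p + of_real c + 3) * of_real (ln s)) * of_real (solid_angle_integral g))) UNIV"
        by (intro holomorphic2_on_mult holomorphic2_on_snd_compose[OF e(2)] holomorphic2_on_const
            holomorphic2_on_fst_compose[of "\<lambda>z. exp (- z * of_real (ln s1))"]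
            holomorphic2_on_fst_compose[of "\<lambda>z. exp ((z + of_real c + 3) * of_real (ln s))"] holomorphic_intros)
      thus ?thesis using e(1) unfolding z E_def prod.case of_real_powr_eq_exp[OF s1] of_real_powr_eq_exp[OF s(1)] by simp
    qed
    thus ?thesis by (auto simp: ps_def)
  qed
  have reg: "regularized y y' s1 s' F p x = of_real (norm (x - y) / s1) powr fst p * W (snd p) x + (\<Sum>z\<leftarrow>zs. of_real (norm (x - y) / s1) powr fst p * T z (snd p) x)" for p x
    unfolding regularized_def W_def case_prod_unfold sum_list_const_mult by (simp add: algebra_simps)
  have Tint: "set_integrable lborel (cball y s) (\<lambda>x. of_real (norm (x - y) / s1) powr fst p * T z (snd p) x) \<and>
      (LINT x:cball y s|lborel. of_real (norm (x - y) / s1) powr fst p * T z (snd p) x) = E z p / (fst p - (- of_real (fst z) - 3))"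
    if z: "z \<in> set zs" and p: "Re (fst p) > - a0 - 3" for z p
  proof -
    obtain c g e where z': "z = (c, g, e)" by (cases z)
    have g: "continuous_on (sphere 0 1) g" and c: "c \<ge> a0" using zs z z' by auto
    have w: "Re (fst p + of_real c) > - 3" using p c by simp
    have "of_real (norm (x - y) / s1) powr fst p * T z (snd p) x
        = (e (snd p) * of_real s1 powr (- fst p)) * (of_real (norm (x - y)) powr (fst p + of_real c) * of_real (g (dir y x)))" for x
    proof -
      have "of_real (norm (x - y) / s1) powr fst p * T z (snd p) x
        = (e (snd p) * of_real s1 powr (- fst p)) * ((of_real (norm (x - y)) powr fst p * of_real (norm (x - y) powr c)) * of_real (g (dir y x)))"
        unfolding of_real_powr_divide[OF norm_ge_zero s1] by (simp add: T_def z' sph_term_def mult_ac)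
      thus ?thesis unfolding of_real_powr_mult_of_real_powr[OF norm_ge_zero] .
    qed
    hence eq: "(\<lambda>x. of_real (norm (x - y) / s1) powr fst p * T z (snd p) x)
        = (\<lambda>x. (e (snd p) * of_real s1 powr (- fst p)) * (of_real (norm (x - y)) powr (fst p + of_real c) * of_real (g (dir y x))))"
      by auto
    note I = ball_integral_sph_term[OF w s(1) g, of y]
    show ?thesis
    proof
      show "set_integrable lborel (cball y s) (\<lambda>x. of_real (norm (x - y) / s1) powr fst p * T z (snd p) x)"
        unfolding eq by (rule set_integrable_mult_right[OF I(1)])
      show "(LINT x:cball y s|lborel. of_real (norm (x - y) / s1) powr fst p * T z (snd p) x) = E z p / (fst p - (- of_real (fst z) - 3))"
      proof -
        have d: "fst p - (- of_real c - 3) = fst p + of_real c + 3" by simp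
        show ?thesis unfolding eq set_integral_mult_right I(2) unfolding z' fst_conv d by (simp add: E_def)
      qed
    qed
  qed
  have main: "set_integrable lborel (cball y s) (regularized y y' s1 s' F p) \<and>
       (LINT x:cball y s|lborel. regularized y y' s1 s' F p x) = (\<Sum>(c, e)\<leftarrow>ps. e p / (fst p - c)) + h p"
    if p: "Re (fst p) > - a0 - 3" "Re (fst p) > - real M - 3" for p
  proof -
    have 1: "set_integrable lborel (cball y s) (\<lambda>x. of_real (norm (x - y) / s1) powr fst p * W (snd p) x)"
      by (rule hint(2)[OF p(2)])
    have 2: "set_integrable lborel (cball y s) (\<lambda>x. \<Sum>z\<leftarrow>zs. of_real (norm (x - y) / s1) powr fst p * T z (snd p) x)"
      by (rule set_integrable_sum_list) (use Tint[OF _ p(1)] in auto)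
    have "(LINT x:cball y s|lborel. (\<Sum>z\<leftarrow>zs. of_real (norm (x - y) / s1) powr fst p * T z (snd p) x))
        = (\<Sum>z\<leftarrow>zs. LINT x:cball y s|lborel. of_real (norm (x - y) / s1) powr fst p * T z (snd p) x)"
      by (rule set_integral_sum_list) (use Tint[OF _ p(1)] in auto)
    also have "\<dots> = (\<Sum>z\<leftarrow>zs. E z p / (fst p - (- of_real (fst z) - 3)))"
      by (intro arg_cong[where f = sum_list] map_cong refl) (use Tint[OF _ p(1)] in auto)
    also have "\<dots> = (\<Sum>(c, e)\<leftarrow>ps. e p / (fst p - c))"
      by (simp add: ps_def comp_def)
    finally have 3: "(LINT x:cball y s|lborel. (\<Sum>z\<leftarrow>zs. of_real (norm (x - y) / s1) powr fst p * T z (snd p) x)) = (\<Sum>(c, e)\<leftarrow>ps. e p / (fst p - c))" .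
    have eq: "regularized y y' s1 s' F p = (\<lambda>x. of_real (norm (x - y) / s1) powr fst p * W (snd p) x + (\<Sum>z\<leftarrow>zs. of_real (norm (x - y) / s1) powr fst p * T z (snd p) x))"
      using reg by blast
    show ?thesis unfolding eq set_integral_add(2)[OF 1 2] 3 h_def
      using set_integral_add(1)[OF 1 2] by simp
  qed
  have FP: "has_FP (\<lambda>\<alpha>. (\<Sum>(c, e)\<leftarrow>ps. e (\<alpha>, 0) / (\<alpha> - c)) + h (\<alpha>, 0)) (of_real (ball_FP F y s s1 xs))"
  proof -
    have "(\<Sum>(c, e)\<leftarrow>ps. e (\<alpha>, 0) / (\<alpha> - c))
      = (\<Sum>(c, g, e)\<leftarrow>zs. e 0 * (\<lambda>(c, g). of_real (solid_angle_integral g) * (of_real s1 powr (- \<alpha>) * of_real s powr (\<alpha> + of_real c + 3) / (\<alpha> + of_real c + 3))) (c, g))" for \<alpha>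
      unfolding ps_def map_map comp_def
      by (intro arg_cong[where f = sum_list] map_cong refl) (auto simp: E_def algebra_simps split: prod.splits)
    hence pole: "(\<Sum>(c, e)\<leftarrow>ps. e (\<alpha>, 0) / (\<alpha> - c))
      = (\<Sum>e\<leftarrow>xs. of_real (solid_angle_integral (snd e)) * (of_real s1 powr (- \<alpha>) * of_real s powr (\<alpha> + of_real (fst e) + 3) / (\<alpha> + of_real (fst e) + 3)))" for \<alpha>
      unfolding collapse by (simp add: case_prod_unfold)
    have 1: "has_FP (\<lambda>\<alpha>. \<Sum>(c, e)\<leftarrow>ps. e (\<alpha>, 0) / (\<alpha> - c)) (\<Sum>e\<leftarrow>xs. of_real (solid_angle_integral (snd e)) * of_real (shell_value s s1 (fst e)))"
      unfolding pole by (intro has_FP_sum_list has_FP_cmult has_FP_shell_value s s1)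
    \<comment> \<open>M is at least 0, so the half-space contains the ball of radius 2, and the
      slice \<beta> = 0 is then holomorphic on the unit disc.\<close>
    have sub: "ball 0 2 \<subseteq> {p :: complex \<times> complex. Re (fst p) > - real M - 3}"
    proof
      fix p :: "complex \<times> complex" assume "p \<in> ball 0 2"
      hence "\<bar>Re (fst p)\<bar> < 2"
        using abs_Re_le_cmod[of "fst p"] norm_fst_le[of "fst p" "snd p"] by simp
      thus "p \<in> {p. Re (fst p) > - real M - 3}" by simp
    qed
    have "(\<lambda>\<alpha>. h (\<alpha>, 0)) holomorphic_on ball 0 (2 / 2)"
      by (rule holomorphic2_on_slice(1)[OF holomorphic2_on_subset[OF h_hol sub]]) simp
    hence 2: "has_FP (\<lambda>\<alpha>. h (\<alpha>, 0)) (h (0, 0))"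
      by (rule has_FP_analytic) simp
    have W0: "W 0 x = of_real (F x - (\<Sum>e\<leftarrow>xs. sph_term y e x))" if "x \<in> cball y s" for x
    proof -
      have "(\<Sum>(c, g, e)\<leftarrow>zs. e 0 * of_real (sph_term y (c, g) x)) = (\<Sum>e\<leftarrow>xs. complex_of_real (sph_term y e x))"
        by (rule collapse)
      thus ?thesis using far[OF that] s' unfolding W' by (simp add: of_real_sum_list powr_def)
    qed
    \<comment> \<open>At \<beta> = 0 the remainder \<open>W\<close> is that of the expansion of
      \<open>F\<close>, and at \<alpha> = 0 the power of r / s1 is 1 except at the centre.\<close>
    have "h (0, 0) = (\<integral>x. of_real (indicator (cball y s) x *\<^sub>R (F x - (\<Sum>e\<leftarrow>xs. sph_term y e x))) \<partial>lborel)"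
      unfolding h_def set_lebesgue_integral_def
    proof (intro integral_cong_AE)
      show "AE x in lborel. indicat_real (cball y s) x *\<^sub>R (of_real (norm (x - y) / s1) powr fst (0, 0) * W (snd (0, 0)) x)
          = of_real (indicator (cball y s) x *\<^sub>R (F x - (\<Sum>e\<leftarrow>xs. sph_term y e x)))"
        using AE_lborel_singleton[of y]
      proof eventually_elim
        case (elim x)
        hence "complex_of_real (norm (x - y) / s1) powr 0 = 1" using s1 by (simp add: powr_def)
        thus ?case using W0[of x] by (auto simp: indicator_def)
      qed
      have [measurable]: "(\<lambda>x. complex_of_real (norm (x - y) / s1) powr 0) \<in> borel_measurable borel"
        by (rule of_real_powr_measurable) (use s1 in auto)
      note W_meas[measurable]
      have [measurable]: "cball y s \<in> sets borel" by simp
      show "(\<lambda>x. indicat_real (cball y s) x *\<^sub>R (of_real (norm (x - y) / s1) powr fst (0, 0) * W (snd (0, 0)) x)) \<in> borel_measurable lborel"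
        unfolding fst_conv snd_conv by measurable
      have [measurable]: "(\<lambda>x. \<Sum>e\<leftarrow>xs. sph_term y e x) \<in> borel_measurable borel"
        using F unfolding fin_expansion_def by (intro sum_list_measurable sph_term_measurable) auto
      show "(\<lambda>x. complex_of_real (indicator (cball y s) x *\<^sub>R (F x - (\<Sum>e\<leftarrow>xs. sph_term y e x)))) \<in> borel_measurable lborel"
        by measurable
    qed
    hence h0: "h (0, 0) = of_real (LINT x:cball y s|lborel. F x - (\<Sum>e\<leftarrow>xs. sph_term y e x))"
      unfolding set_lebesgue_integral_def integral_complex_of_real .
    show ?thesis
      using has_FP_add[OF 1 2] unfolding h0 ball_FP_def by (simp add: of_real_sum_list mult.commute)
  qed
  show ?thesis using ps h_hol main FP by blast
qed

section \<open>Existence of the continuation over a ball, and the finite part of any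
  continuation\<close>

lemma exists_fin_expansion:
  assumes "singular_expansion F y a f" "continuous_on (- {y, y'}) F" "s > 0" "s < norm (y - y')"
  shows "fin_expansion F y s (a 0) M (coeff_list a f M)"
proof (rule fin_expansion_coeff_list[OF assms(1,3,4)])
  show "continuous_on (ball y (norm (y - y')) - {y}) F"
    by (rule continuous_on_subset[OF assms(2)]) (auto simp: dist_norm)
qed

text \<open>The partial fractions define the continuation on a half-space without the poles.
  Removing finitely many values of \<alpha> leaves the half-plane connected, and so is its product
  with the plane of all \<beta>.\<close>

lemma continues_integral_exists:
  assumes yy: "y \<noteq> y'" and s: "s > 0" "s < norm (y - y')" and s1: "s1 > 0" and s': "s' > 0"
    and cont: "continuous_on (- {y, y'}) F" and exp: "singular_expansion F y a f"
  shows "\<exists>J. continues_integral (regularized y y' s1 s' F) (cball y s) {(\<alpha>, \<beta>). Re \<alpha> > - a 0 - 3} fst J"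
proof -
  \<comment> \<open>This order suffices for the region of convergence to lie in the half-space; the
    origin lies in it for every M.\<close>
  obtain M :: nat where M: "a 0 \<le> real M" using real_arch_simple by blast
  obtain ps h where ps: "\<And>c e. (c, e) \<in> set ps \<Longrightarrow> Re c \<le> - a 0 - 3 \<and> holomorphic2_on e UNIV"
    and h: "holomorphic2_on h {p. Re (fst p) > - real M - 3}"
    and eq: "\<And>p. Re (fst p) > - a 0 - 3 \<Longrightarrow> Re (fst p) > - real M - 3 \<Longrightarrow>
       set_integrable lborel (cball y s) (regularized y y' s1 s' F p) \<and>
       (LINT x:cball y s|lborel. regularized y y' s1 s' F p x) = (\<Sum>(c, e)\<leftarrow>ps. e p / (fst p - c)) + h p"
    using local_partial_fractions[OF yy s s1 s' cont exists_fin_expansion[OF exp cont s]] by fast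
  define P where "P = fst ` set ps"
  define A where "A = {z. Re z > - real M - 3} - P"
  define D where "D = A \<times> (UNIV :: complex set)"
  define J where "J p = (\<Sum>(c, e)\<leftarrow>ps. e p / (fst p - c)) + h p" for p
  have "open {z. Re z > - real M - 3}" "connected {z. Re z > - real M - 3}"
    by (auto intro!: convex_connected convex_halfspace_Re_gt open_halfspace_Re_gt)
  hence A: "open A" "connected A"
    unfolding A_def P_def by (auto intro!: open_Diff finite_imp_closed connected_open_delete_finite)
  have D: "open D" "connected D"
    unfolding D_def using A by (auto intro!: open_Times connected_Times)
  have hD: "holomorphic2_on h D" by (rule holomorphic2_on_subset[OF h]) (auto simp: D_def A_def)
  have JD: "holomorphic2_on J D"
    unfolding J_def case_prod_unfold
  proof (intro holomorphic2_on_add holomorphic2_on_sum_list hD)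
    fix ce assume "ce \<in> set ps"
    moreover obtain c e where "ce = (c, e)" by force
    ultimately have ce: "ce = (c, e)" "(c, e) \<in> set ps" by auto
    show "holomorphic2_on (\<lambda>p. snd ce p / (fst p - fst ce)) D"
      using ps[OF ce(2)] ce holomorphic2_on_subset[of e UNIV D]
      by (intro holomorphic2_on_divide holomorphic2_intros) (force simp: D_def A_def P_def)+
  qed
  have R: "{(\<alpha>, \<beta>). Re \<alpha> > - a 0 - 3} \<subseteq> D"
    using ps M by (fastforce simp: D_def A_def P_def)
  have JR: "J p = (LINT x:cball y s|lborel. regularized y y' s1 s' F p x)" and intR: "set_integrable lborel (cball y s) (regularized y y' s1 s' F p)"
    if "p \<in> {(\<alpha>, \<beta>). Re \<alpha> > - a 0 - 3}" for p
    using eq[of p] that M by (auto simp: J_def case_prod_unfold)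
  \<comment> \<open>A radius free of poles other than \<alpha> = 0.\<close>
  obtain d where d: "d > 0" "\<And>c. c \<in> P \<Longrightarrow> c \<noteq> 0 \<Longrightarrow> d \<le> dist 0 c"
    using finite_set_avoid[of P 0] unfolding P_def by auto
  define \<delta> where "\<delta> = min d 1"
  have \<delta>: "\<delta> > 0" using d by (simp add: \<delta>_def)
  have ballre: "Re (fst p) > - real M - 3" "cmod (fst p) < d" if "p \<in> ball 0 \<delta>" for p :: "complex \<times> complex"
    using that abs_Re_le_cmod[of "fst p"] norm_fst_le[of "fst p" "snd p"] by (auto simp: \<delta>_def)
  have ballD: "{p \<in> ball 0 \<delta>. fst p \<noteq> 0} \<subseteq> D"
  proof
    fix p :: "complex \<times> complex" assume p: "p \<in> {p \<in> ball 0 \<delta>. fst p \<noteq> 0}"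
    hence "fst p \<notin> P" using d(2)[of "fst p"] ballre(2)[of p] by auto
    thus "p \<in> D" using ballre(1)[of p] p by (simp add: D_def A_def mem_Times_iff)
  qed
  \<comment> \<open>The product of \<alpha> and \<open>J\<close>, with \<alpha> cancelled in every
    term whose pole is at 0.\<close>
  define H where "H p = (\<Sum>(c, e)\<leftarrow>ps. if c = 0 then e p else fst p * (e p / (fst p - c))) + fst p * h p" for p
  have "holomorphic2_on H (ball 0 \<delta>)"
    unfolding H_def case_prod_unfold
  proof (intro holomorphic2_on_add holomorphic2_on_mult holomorphic2_on_fst holomorphic2_on_sum_list)
    show "holomorphic2_on h (ball 0 \<delta>)"
      by (rule holomorphic2_on_subset[OF h]) (use ballre(1) in blast)
    fix ce assume "ce \<in> set ps"
    moreover obtain c e where "ce = (c, e)" by force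
    ultimately have ce: "ce = (c, e)" "(c, e) \<in> set ps" by auto
    have e: "holomorphic2_on e (ball 0 \<delta>)"
      using ps[OF ce(2)] holomorphic2_on_subset[of e UNIV] by auto
    show "holomorphic2_on (\<lambda>p. if fst ce = 0 then snd ce p else fst p * (snd ce p / (fst p - fst ce))) (ball 0 \<delta>)"
    proof (cases "c = 0")
      case True
      thus ?thesis using e ce by simp
    next
      case False
      have "c \<in> P" using ce(2) by (force simp: P_def)
      hence "d \<le> cmod c" using d(2) False by auto
      hence "fst p - c \<noteq> 0" if "p \<in> ball 0 \<delta>" for p :: "complex \<times> complex"
        using ballre(2)[OF that] by auto
      hence "holomorphic2_on (\<lambda>p. fst p * (e p / (fst p - c))) (ball 0 \<delta>)"
        using e by (intro holomorphic2_on_mult holomorphic2_on_fst holomorphic2_on_divide holomorphic2_on_diff holomorphic2_on_const)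
      thus ?thesis using False ce by simp
    qed
  qed
  moreover have "fst p * J p = H p" if "fst p \<noteq> 0" for p
  proof -
    have "fst p * (\<Sum>(c, e)\<leftarrow>ps. e p / (fst p - c)) = (\<Sum>(c, e)\<leftarrow>ps. if c = 0 then e p else fst p * (e p / (fst p - c)))"
      unfolding sum_list_const_mult[symmetric]
      by (intro arg_cong[where f = sum_list] map_cong refl) (use that in auto)
    thus ?thesis by (simp add: J_def H_def distrib_left)
  qed
  ultimately have "continuation_near_0 (\<lambda>p. LINT x:cball y s|lborel. regularized y y' s1 s' F p x) {(\<alpha>, \<beta>). Re \<alpha> > - a 0 - 3} fst J"
    unfolding continuation_near_0_def using D R JD JR \<delta> ballD by blast
  thus ?thesis unfolding continues_integral_def using intR by blast
qed

text \<open>\<open>J\<close> is an arbitrary continuation on an unknown connected domain, so the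
  order M depends on it. Clearing denominators identifies \<open>J\<close> with the explicit partial
  fractions near 0 on the line \<beta> = 0, where the finite part is known. That
  \<open>ball_FP\<close> takes the same value for all M emerges later from a limit.\<close>

lemma continues_integral_FP:
  assumes yy: "y \<noteq> y'" and s: "s > 0" "s < norm (y - y')" and s1: "s1 > 0" and s': "s' > 0"
    and cont: "continuous_on (- {y, y'}) F" and exp: "singular_expansion F y a f"
    and J: "continues_integral (regularized y y' s1 s' F) (cball y s) {(\<alpha>, \<beta>). Re \<alpha> > - a 0 - 3} fst J"
  shows "\<exists>\<delta> H M. \<delta> > 0 \<and> holomorphic2_on H (ball 0 \<delta>) \<and> (\<forall>p\<in>ball 0 \<delta>. fst p \<noteq> 0 \<longrightarrow> fst p * J p = H p) \<and>
    deriv (\<lambda>\<alpha>. H (\<alpha>, 0)) 0 = of_real (ball_FP F y s s1 (coeff_list a f M))"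
proof -
  define R where "R = {(\<alpha>, \<beta> :: complex). Re \<alpha> > - a 0 - 3}"
  have R': "p \<in> R \<longleftrightarrow> Re (fst p) > - a 0 - 3" for p by (cases p) (simp add: R_def)
  obtain D \<delta> H where D: "open D" "connected D" "R \<subseteq> D" "holomorphic2_on J D"
    and JR: "\<And>p. p \<in> R \<Longrightarrow> J p = (LINT x:cball y s|lborel. regularized y y' s1 s' F p x)"
    and \<delta>: "\<delta> > 0" "{p \<in> ball 0 \<delta>. fst p \<noteq> 0} \<subseteq> D"
    and H: "holomorphic2_on H (ball 0 \<delta>)" "\<forall>p\<in>ball 0 \<delta>. fst p \<noteq> 0 \<longrightarrow> fst p * J p = H p"
    using J unfolding continues_integral_def continuation_near_0_def R_def by blast
  \<comment> \<open>The punctured disc on the line \<beta> = 0 is connected, bounded and contained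
    in the domain of \<open>J\<close>; the finite part is read off on it.\<close>
  define T where "T = (\<lambda>\<alpha> :: complex. (\<alpha>, 0 :: complex)) ` (ball 0 \<delta> - {0})"
  have memT: "(\<alpha>, 0) \<in> T" if "\<alpha> \<in> ball 0 \<delta>" "\<alpha> \<noteq> 0" for \<alpha>
    using that by (auto simp: T_def)
  have T: "connected T" "bounded T" "T \<noteq> {}" "T \<subseteq> D"
  proof -
    have "connected (ball (0 :: complex) \<delta> - {0})"
      by (rule connected_open_delete) auto
    thus "connected T" unfolding T_def
      by (intro connected_continuous_image continuous_intros)
    show "bounded T" unfolding T_def bounded_iff by (intro exI[of _ \<delta>]) (auto simp: norm_Pair)
    have "complex_of_real (\<delta> / 2) \<in> ball 0 \<delta> - {0}" using \<delta>(1) by auto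
    thus "T \<noteq> {}" unfolding T_def by blast
    show "T \<subseteq> D" using \<delta>(2) by (force simp: T_def norm_Pair)
  qed
  have oR: "open R"
  proof -
    have "R = {p. Re (fst p) > - a 0 - 3}" using R' by auto
    thus ?thesis by (simp only:) (intro open_Collect_less continuous_intros)
  qed
  have "(of_real (- a 0 - 2), 0) \<in> R" by (simp add: R')
  hence neR: "R \<noteq> {}" by blast
  obtain M0 where M0: "\<And>M Q Hp p. M \<ge> M0 \<Longrightarrow> holomorphic2_on (\<lambda>p. Q (fst p)) {p. Re (fst p) > - M} \<Longrightarrow>
      holomorphic2_on Hp {p. Re (fst p) > - M} \<Longrightarrow>
      (\<And>p. p \<in> R \<Longrightarrow> Re (fst p) > - M \<Longrightarrow> Q (fst p) * J p = Hp p) \<Longrightarrow>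
      p \<in> T \<Longrightarrow> Re (fst p) > - M \<and> Q (fst p) * J p = Hp p"
    using continuation_unique[OF D(1,2,4) oR neR D(3) T] by metis
  \<comment> \<open>Large enough for the path from the region of convergence to \<open>T\<close>,
    and for that region itself to be covered by the formula.\<close>
  obtain M :: nat where M: "max M0 (a 0) \<le> real M" using real_arch_simple by blast
  define xs where "xs = coeff_list a f M"
  obtain ps h where ps: "\<And>c e. (c, e) \<in> set ps \<Longrightarrow> Re c \<le> - a 0 - 3 \<and> holomorphic2_on e UNIV"
    and h: "holomorphic2_on h {p. Re (fst p) > - real M - 3}"
    and eq: "\<And>p. Re (fst p) > - a 0 - 3 \<Longrightarrow> Re (fst p) > - real M - 3 \<Longrightarrow>
       (LINT x:cball y s|lborel. regularized y y' s1 s' F p x) = (\<Sum>(c, e)\<leftarrow>ps. e p / (fst p - c)) + h p"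
    and FP: "has_FP (\<lambda>\<alpha>. (\<Sum>(c, e)\<leftarrow>ps. e (\<alpha>, 0) / (\<alpha> - c)) + h (\<alpha>, 0)) (of_real (ball_FP F y s s1 xs))"
    using local_partial_fractions[OF yy s s1 s' cont exists_fin_expansion[OF exp cont s, of M]] unfolding xs_def by fast
  have M3: "- (real M + 3) = - real M - 3" by simp
  have psU: "holomorphic2_on e {p. Re (fst p) > - real M - 3}" if "(c, e) \<in> set ps" for c e
    by (rule holomorphic2_on_subset[of e UNIV]) (use ps[OF that] in auto)
  have "\<exists>Q Hp. Q holomorphic_on UNIV \<and> (\<forall>z. Q z = 0 \<longleftrightarrow> z \<in> fst ` set ps) \<and>
      holomorphic2_on Hp {p. Re (fst p) > - real M - 3} \<and>
      (\<forall>p. fst p \<notin> fst ` set ps \<longrightarrow> Q (fst p) * ((\<Sum>(c, e)\<leftarrow>ps. e p / (fst p - c)) + h p) = Hp p)"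
    by (rule partial_fractions_common_denominator[OF _ h]) (rule psU)
  then obtain Q Hp where Q: "Q holomorphic_on UNIV" "\<And>z. Q z = 0 \<longleftrightarrow> z \<in> fst ` set ps"
    and Hp: "holomorphic2_on Hp {p. Re (fst p) > - real M - 3}"
    and QHp: "\<And>p. fst p \<notin> fst ` set ps \<Longrightarrow> Q (fst p) * ((\<Sum>(c, e)\<leftarrow>ps. e p / (fst p - c)) + h p) = Hp p"
    by blast
  have QJ: "Q (fst p) * J p = Hp p" if "p \<in> T" for p
  proof -
    have "Re (fst p) > - (real M + 3) \<and> Q (fst p) * J p = Hp p"
    proof (rule M0[OF _ _ _ _ that])
      show "M0 \<le> real M + 3" using M by simp
      show "holomorphic2_on (\<lambda>p. Q (fst p)) {p. Re (fst p) > - (real M + 3)}"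
        by (rule holomorphic2_on_fst_compose[OF Q(1)])
      show "holomorphic2_on Hp {p. Re (fst p) > - (real M + 3)}" unfolding M3 by (rule Hp)
      fix q assume q: "q \<in> R" "Re (fst q) > - (real M + 3)"
      have "fst q \<notin> fst ` set ps" using ps q(1) unfolding R' by force
      from QHp[OF this] show "Q (fst q) * J q = Hp q"
        using eq[of q] q JR[OF q(1)] unfolding R' by simp
    qed
    thus ?thesis ..
  qed
  obtain d where d: "d > 0" "\<And>c. c \<in> fst ` set ps \<Longrightarrow> c \<noteq> 0 \<Longrightarrow> d \<le> dist 0 c"
    using finite_set_avoid[of "fst ` set ps" 0] by auto
  have "\<forall>\<^sub>F \<alpha> in at 0. (\<Sum>(c, e)\<leftarrow>ps. e (\<alpha>, 0) / (\<alpha> - c)) + h (\<alpha>, 0) = J (\<alpha>, 0)"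
    unfolding eventually_at
  proof (intro exI[of _ "min \<delta> d"] conjI ballI impI)
    fix \<alpha> :: complex assume \<alpha>: "\<alpha> \<noteq> 0 \<and> dist \<alpha> 0 < min \<delta> d"
    \<comment> \<open>Away from the poles \<open>Q\<close> does not vanish and can be divided out; 0
      may be one of them and is excluded.\<close>
    have np: "\<alpha> \<notin> fst ` set ps" using d(2)[of \<alpha>] \<alpha> by (auto simp: dist_commute)
    have "Q \<alpha> * J (\<alpha>, 0) = Hp (\<alpha>, 0)" using QJ[OF memT[of \<alpha>]] \<alpha> by simp
    also have "\<dots> = Q \<alpha> * ((\<Sum>(c, e)\<leftarrow>ps. e (\<alpha>, 0) / (\<alpha> - c)) + h (\<alpha>, 0))"
      using QHp[of "(\<alpha>, 0)"] np by simp
    finally show "(\<Sum>(c, e)\<leftarrow>ps. e (\<alpha>, 0) / (\<alpha> - c)) + h (\<alpha>, 0) = J (\<alpha>, 0)"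
      using Q(2)[of \<alpha>] np by simp
  qed (use \<delta> d in auto)
  hence "has_FP (\<lambda>\<alpha>. J (\<alpha>, 0)) (of_real (ball_FP F y s s1 xs))"
    by (rule has_FP_cong[OF FP])
  moreover have "has_FP (\<lambda>\<alpha>. J (\<alpha>, 0)) (deriv (\<lambda>\<alpha>. H (\<alpha>, 0)) 0)"
  proof (rule has_FP_simple_pole[OF holomorphic2_on_slice(1)[OF H(1)]])
    fix z :: complex assume z: "z \<in> ball 0 (\<delta> / 2)" "z \<noteq> 0"
    have "(z, 0 :: complex) \<in> ball 0 \<delta>" by (rule pair_mem_ball_0) (use z \<delta>(1) in auto)
    thus "z * J (z, 0) = H (z, 0)" using H(2) z(2) by fastforce
  qed (use \<delta> in auto)
  ultimately have "deriv (\<lambda>\<alpha>. H (\<alpha>, 0)) 0 = of_real (ball_FP F y s s1 (coeff_list a f M))"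
    unfolding xs_def by (metis has_FP_unique)
  thus ?thesis using \<delta>(1) H by blast
qed

section \<open>The partie finie at one singular point\<close>

lemma solid_angle_integral_cong_0:
  assumes "\<And>n. norm n = 1 \<Longrightarrow> g n = 0"
  shows "solid_angle_integral g = 0"
  unfolding solid_angle_integral_def set_lebesgue_integral_def
  using assms norm_sphere_point by simp

text \<open>Since M is at least 0, the remainder is bounded on the punctured ball, and its integral
  over a small ball is of the order of the volume.\<close>

lemma ball_remainder_integrable:
  assumes F: "fin_expansion F y s a0 M xs" and [measurable]: "F \<in> borel_measurable borel" and s: "s > 0"
  shows "set_integrable lborel (cball y s) (\<lambda>x. F x - (\<Sum>e\<leftarrow>xs. sph_term y e x))"
    and "\<exists>B. \<forall>t. 0 < t \<longrightarrow> t \<le> s \<longrightarrow> \<bar>LINT x:cball y t|lborel. F x - (\<Sum>e\<leftarrow>xs. sph_term y e x)\<bar> \<le> B * measure lborel (cball y t)"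
proof -
  define R where "R x = F x - (\<Sum>e\<leftarrow>xs. sph_term y e x)" for x
  obtain B where B: "\<And>x. 0 < norm (x - y) \<Longrightarrow> norm (x - y) \<le> s \<Longrightarrow> \<bar>R x\<bar> \<le> B * norm (x - y) ^ M"
    using F unfolding fin_expansion_def R_def by blast
  define b where "b = \<bar>B\<bar> * s ^ M"
  have b: "\<bar>R x\<bar> \<le> b" if x: "x \<in> cball y s" "x \<noteq> y" for x
  proof -
    have n: "0 < norm (x - y)" "norm (x - y) \<le> s" using x by (auto simp: dist_norm norm_minus_commute)
    have "\<bar>R x\<bar> \<le> \<bar>B\<bar> * norm (x - y) ^ M" by (rule order_trans[OF B[OF n]]) (auto intro!: mult_right_mono)
    also have "\<dots> \<le> b" unfolding b_def using n by (intro mult_left_mono power_mono) auto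
    finally show ?thesis .
  qed
  have "(\<lambda>x. \<Sum>e\<leftarrow>xs. sph_term y e x) \<in> borel_measurable borel"
    using F unfolding fin_expansion_def by (intro sum_list_measurable sph_term_measurable) auto
  hence Rm [measurable]: "R \<in> borel_measurable borel" unfolding R_def by measurable
  have ind: "integrable lborel (\<lambda>x. indicator (cball y t) x *\<^sub>R b)" for t
    by (intro integrable_scaleR_left integrable_real_indicator)
       (use emeasure_bounded_finite[OF bounded_cball, of y t] in auto)
  have AE: "AE x in lborel. norm (indicator (cball y t) x *\<^sub>R R x) \<le> indicator (cball y t) x *\<^sub>R b" if "t \<le> s" for t
    using AE_lborel_singleton[of y]
    by eventually_elim (use b that in \<open>auto simp: indicator_def\<close>)
  have meas: "(\<lambda>x. indicator (cball y t) x *\<^sub>R R x) \<in> borel_measurable lborel" for t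
  proof -
    have [measurable]: "cball y t \<in> sets borel" by simp
    show ?thesis by measurable
  qed
  have int: "integrable lborel (\<lambda>x. indicator (cball y t) x *\<^sub>R R x)" if "t \<le> s" for t
  proof (rule Bochner_Integration.integrable_bound[OF ind[of t] meas])
    show "AE x in lborel. norm (indicator (cball y t) x *\<^sub>R R x) \<le> norm (indicator (cball y t) x *\<^sub>R b)"
      using AE[OF that] by eventually_elim auto
  qed
  show "set_integrable lborel (cball y s) (\<lambda>x. F x - (\<Sum>e\<leftarrow>xs. sph_term y e x))"
    using int[of s] unfolding set_integrable_def R_def by simp
  show "\<exists>B. \<forall>t. 0 < t \<longrightarrow> t \<le> s \<longrightarrow> \<bar>LINT x:cball y t|lborel. F x - (\<Sum>e\<leftarrow>xs. sph_term y e x)\<bar> \<le> B * measure lborel (cball y t)"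
  proof (intro exI[of _ b] allI impI)
    fix t assume t: "0 < t" "t \<le> s"
    have "\<bar>\<integral>x. indicator (cball y t) x *\<^sub>R R x \<partial>lborel\<bar> \<le> (\<integral>x. norm (indicator (cball y t) x *\<^sub>R R x) \<partial>lborel)"
      using integral_norm_bound[of lborel "\<lambda>x. indicator (cball y t) x *\<^sub>R R x"] by simp
    also have "\<dots> \<le> (\<integral>x. indicator (cball y t) x *\<^sub>R b \<partial>lborel)"
      by (rule integral_mono_AE[OF integrable_norm[OF int[OF t(2)]] ind AE[OF t(2)]])
    also have "\<dots> = b * measure lborel (cball y t)" by simp
    finally show "\<bar>LINT x:cball y t|lborel. F x - (\<Sum>e\<leftarrow>xs. sph_term y e x)\<bar> \<le> b * measure lborel (cball y t)"
      unfolding set_lebesgue_integral_def R_def .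
  qed
qed

text \<open>The shell integral of a term is a difference of primitives at s and t. The counterterms
  cancel the values at t for exponents up to - 3, the other values at t tend to 0, and so does the
  integral of the remainder over the inner ball. What is left is \<open>ball_FP\<close>, for every
  M.\<close>

lemma ball_FP_limit:
  assumes s: "s > 0" "s < norm (y - y')" and s1: "s1 > 0"
    and cont: "continuous_on (- {y, y'}) F" and exp: "singular_expansion F y a f"
  shows "((\<lambda>t. (LINT x:cball y s - cball y t|lborel. F x) + Pf_counterterm a f s1 t) \<longlongrightarrow> ball_FP F y s s1 (coeff_list a f M)) (at_right 0)"
proof -
  define xs where "xs = coeff_list a f M"
  define R where "R x = F x - (\<Sum>e\<leftarrow>xs. sph_term y e x)" for x
  define C where "C = {c \<in> range a. c \<le> real M}"
  define \<Omega> where "\<Omega> c = solid_angle_integral (f c)" for c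
  have finC: "finite C" unfolding C_def using exp by (auto simp: singular_expansion_def intro!: finite_exponents)
  have F: "fin_expansion F y s (a 0) M xs" unfolding xs_def by (rule exists_fin_expansion[OF exp cont s])
  have Fm: "F \<in> borel_measurable borel" by (rule continuous_except_measurable[OF cont])
  have Rint: "set_integrable lborel (cball y s) R"
    using ball_remainder_integrable(1)[OF F Fm s(1)] unfolding R_def .
  obtain B where B: "\<And>t. 0 < t \<Longrightarrow> t \<le> s \<Longrightarrow> \<bar>LINT x:cball y t|lborel. R x\<bar> \<le> B * measure lborel (cball y t)"
    using ball_remainder_integrable(2)[OF F Fm s(1)] unfolding R_def by blast
  define G where "G t = ball_FP F y s s1 xs - (\<Sum>c\<in>{c\<in>C. c > - 3}. t powr (c + 3) / (c + 3) * \<Omega> c) - (LINT x:cball y t|lborel. R x)" for t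
  have eq: "(LINT x:cball y s - cball y t|lborel. F x) + Pf_counterterm a f s1 t = G t" if t: "0 < t" "t < s" for t
  proof -
    have g: "continuous_on (sphere 0 1) (snd e)" if "e \<in> set xs" for e
      using F that by (auto simp: fin_expansion_def)
    have Tint: "set_integrable lborel (cball y s - cball y t) (sph_term y e)"
      "(LINT x:cball y s - cball y t|lborel. sph_term y e x) = (if fst e = - 3 then ln (s / t) else (s powr (fst e + 3) - t powr (fst e + 3)) / (fst e + 3)) * solid_angle_integral (snd e)"
      if "e \<in> set xs" for e
      using shell_integral_sph_term[OF t(1) less_imp_le[OF t(2)] g[OF that], of y "fst e"] by simp_all
    have sub: "cball y t \<subseteq> cball y s" using t by (simp add: subset_cball)
    have R1: "set_integrable lborel (cball y s - cball y t) R" "set_integrable lborel (cball y t) R"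
      by (rule set_integrable_subset[OF Rint]; use sub in auto)+
    have Rs: "(LINT x:cball y s|lborel. R x) = (LINT x:cball y s - cball y t|lborel. R x) + (LINT x:cball y t|lborel. R x)"
    proof -
      have "(cball y s - cball y t) \<inter> cball y t = {}" by blast
      from set_integral_Un[OF this R1] sub show ?thesis by (simp add: Un_absorb2)
    qed
    have 1: "set_integrable lborel (cball y s - cball y t) (\<lambda>x. \<Sum>e\<leftarrow>xs. sph_term y e x)"
      by (rule set_integrable_sum_list) (rule Tint(1))
    have Feq: "F = (\<lambda>x. R x + (\<Sum>e\<leftarrow>xs. sph_term y e x))" by (simp add: R_def)
    have "(LINT x:cball y s - cball y t|lborel. F x) = (LINT x:cball y s - cball y t|lborel. R x) + (LINT x:cball y s - cball y t|lborel. (\<Sum>e\<leftarrow>xs. sph_term y e x))"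
      by (subst Feq) (rule set_integral_add(2)[OF R1(1) 1])
    also have "(LINT x:cball y s - cball y t|lborel. (\<Sum>e\<leftarrow>xs. sph_term y e x)) = (\<Sum>e\<leftarrow>xs. LINT x:cball y s - cball y t|lborel. sph_term y e x)"
      by (rule set_integral_sum_list) (rule Tint(1))
    also have "\<dots> = (\<Sum>e\<leftarrow>xs. (if fst e = - 3 then ln (s / t) else (s powr (fst e + 3) - t powr (fst e + 3)) / (fst e + 3)) * solid_angle_integral (snd e))"
      by (intro arg_cong[where f = sum_list] map_cong refl Tint(2))
    also have "\<dots> = (\<Sum>c\<in>C. (if c = - 3 then ln (s / t) else (s powr (c + 3) - t powr (c + 3)) / (c + 3)) * \<Omega> c)"
      unfolding xs_def C_def \<Omega>_def by (simp only: sum_list_coeff_list[OF finC[unfolded C_def]] fst_conv snd_conv)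
    finally have S: "(LINT x:cball y s - cball y t|lborel. F x) = (LINT x:cball y s - cball y t|lborel. R x)
        + (\<Sum>c\<in>C. (if c = - 3 then ln (s / t) else (s powr (c + 3) - t powr (c + 3)) / (c + 3)) * \<Omega> c)" .
    have FPv: "ball_FP F y s s1 xs = (\<Sum>c\<in>C. shell_value s s1 c * \<Omega> c) + (LINT x:cball y s|lborel. R x)"
      unfolding ball_FP_def R_def[symmetric] unfolding xs_def C_def \<Omega>_def by (simp only: sum_list_coeff_list[OF finC[unfolded C_def]] fst_conv snd_conv)
    \<comment> \<open>M is at least 0, so the truncation keeps every exponent below - 3.\<close>
    have C3: "{c \<in> range a. c + 3 < 0} = {c \<in> C. c < - 3}" by (auto simp: C_def)
    \<comment> \<open>If - 3 is not an exponent, then \<open>f (- 3)\<close> vanishes on the unit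
      sphere and the logarithmic counterterm is 0.\<close>
    have neg3: "ln (t / s1) * \<Omega> (- 3) = (\<Sum>c\<in>C. if c = - 3 then ln (t / s1) * \<Omega> c else 0)"
    proof (cases "- 3 \<in> C")
      case True
      thus ?thesis using finC by simp
    next
      case False
      hence "- 3 \<notin> range a" by (auto simp: C_def)
      hence "\<Omega> (- 3) = 0" unfolding \<Omega>_def using exp
        by (intro solid_angle_integral_cong_0) (auto simp: singular_expansion_def)
      moreover have "(\<Sum>c\<in>C. if c = - 3 then ln (t / s1) * \<Omega> c else 0) = 0"
        by (rule sum.neutral) (use False in auto)
      ultimately show ?thesis by simp
    qed
    have "Pf_counterterm a f s1 t = (\<Sum>c\<in>C. if c < - 3 then t powr (c + 3) / (c + 3) * \<Omega> c else 0) + (\<Sum>c\<in>C. if c = - 3 then ln (t / s1) * \<Omega> c else 0)"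
      unfolding Pf_counterterm_def C3 \<Omega>_def[symmetric] neg3 by (simp only: sum.inter_filter[OF finC])
    moreover have "(\<Sum>c\<in>{c\<in>C. c > - 3}. t powr (c + 3) / (c + 3) * \<Omega> c) = (\<Sum>c\<in>C. if c > - 3 then t powr (c + 3) / (c + 3) * \<Omega> c else 0)"
      using finC by (rule sum.inter_filter)
    \<comment> \<open>The balance for a single exponent: for c < - 3 and for c = - 3 the
      contributions of t cancel.\<close>
    moreover have "(if c = - 3 then ln (s / t) else (s powr (c + 3) - t powr (c + 3)) / (c + 3)) * \<Omega> c
        + ((if c < - 3 then t powr (c + 3) / (c + 3) * \<Omega> c else 0) + (if c = - 3 then ln (t / s1) * \<Omega> c else 0))
        = shell_value s s1 c * \<Omega> c - (if c > - 3 then t powr (c + 3) / (c + 3) * \<Omega> c else 0)" for c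
      using t s s1 by (auto simp: shell_value_def ln_div algebra_simps diff_divide_distrib)
    hence "(\<Sum>c\<in>C. (if c = - 3 then ln (s / t) else (s powr (c + 3) - t powr (c + 3)) / (c + 3)) * \<Omega> c)
        + ((\<Sum>c\<in>C. if c < - 3 then t powr (c + 3) / (c + 3) * \<Omega> c else 0) + (\<Sum>c\<in>C. if c = - 3 then ln (t / s1) * \<Omega> c else 0))
        = (\<Sum>c\<in>C. shell_value s s1 c * \<Omega> c) - (\<Sum>c\<in>C. if c > - 3 then t powr (c + 3) / (c + 3) * \<Omega> c else 0)"
      by (simp only: sum.distrib[symmetric] sum_subtractf[symmetric])
    ultimately show ?thesis unfolding G_def S FPv Rs by linarith
  qed
  have ev: "\<forall>\<^sub>F t in at_right 0. 0 < t \<and> t < s"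
    unfolding eventually_at_right_field using s(1) by blast
  have "(G \<longlongrightarrow> ball_FP F y s s1 xs - (\<Sum>c\<in>{c\<in>C. c > - 3}. 0 / (c + 3) * \<Omega> c) - 0) (at_right 0)"
    unfolding G_def
  proof (intro tendsto_diff tendsto_const tendsto_sum tendsto_mult tendsto_divide)
    fix c assume c: "c \<in> {c \<in> C. - 3 < c}"
    have "((\<lambda>t. t powr (c + 3)) \<longlongrightarrow> 0 powr (c + 3)) (at_right 0)"
      using c eventually_at_right_less[of "0::real"]
      by (intro tendsto_powr' tendsto_const tendsto_ident_at) (auto elim!: eventually_mono)
    thus "((\<lambda>t. t powr (c + 3)) \<longlongrightarrow> 0) (at_right 0)" using c by simp
    show "c + 3 \<noteq> 0" using c by auto
  next
    have ev': "\<forall>\<^sub>F t in at_right 0. norm (LINT x:cball y t|lborel. R x) \<le> B * (unit_ball_vol 3 * t ^ 3)"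
      using ev
    proof eventually_elim
      case (elim t)
      thus ?case using B[of t] by (simp add: content_cball)
    qed
    have "((\<lambda>t. B * (unit_ball_vol 3 * t ^ 3)) \<longlongrightarrow> B * (unit_ball_vol 3 * 0 ^ 3)) (at_right (0 :: real))"
      by (intro tendsto_intros)
    hence "((\<lambda>t. B * (unit_ball_vol 3 * t ^ 3)) \<longlongrightarrow> 0) (at_right (0 :: real))" by simp
    thus "((\<lambda>t. LINT x:cball y t|lborel. R x) \<longlongrightarrow> 0) (at_right 0)"
      by (rule Lim_null_comparison[OF ev'])
  qed
  hence "(G \<longlongrightarrow> ball_FP F y s s1 xs) (at_right 0)" by simp
  thus ?thesis unfolding xs_def[symmetric]
    by (rule Lim_transform_eventually) (use ev eq in \<open>auto elim!: eventually_mono\<close>)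
qed

subsection \<open>The exterior integral and the main theorem\<close>

lemma powr_le_of_ratio:
  fixes q a :: real
  assumes "1 / 2 \<le> q" "q \<le> 2"
  shows "q powr a \<le> 2 powr \<bar>a\<bar>"
proof (cases "a \<ge> 0")
  case True
  thus ?thesis using assms by (simp add: powr_mono2)
next
  case False
  hence "q powr a \<le> (1 / 2) powr a" using assms by (intro powr_mono2') auto
  thus ?thesis using False by (simp add: powr_divide powr_minus_divide)
qed

text \<open>So far out the ratio of norm (x - y) to norm x lies between 1 / 2 and 2, so powers of
  either sign are comparable up to the factor \<open>2 powr \<bar>a\<bar>\<close>.\<close>

lemma norm_diff_powr_bound:
  fixes x y :: "real ^ 3"
  assumes "2 * norm y \<le> norm x" "norm x > 0" "s > 0"
  shows "(norm (x - y) / s) powr a \<le> 2 powr \<bar>a\<bar> * s powr (- a) * norm x powr a"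
proof -
  have "1 / 2 \<le> norm (x - y) / norm x" "norm (x - y) / norm x \<le> 2"
    using norm_triangle_ineq2[of x y] norm_triangle_ineq4[of x y] assms by (auto simp: field_simps)
  hence "(norm (x - y) / norm x) powr a \<le> 2 powr \<bar>a\<bar>" by (rule powr_le_of_ratio)
  hence "(norm (x - y) / norm x) powr a * (s powr (- a) * norm x powr a) \<le> 2 powr \<bar>a\<bar> * (s powr (- a) * norm x powr a)"
    by (rule mult_right_mono) simp
  moreover have "(norm (x - y) / norm x) powr a * (s powr (- a) * norm x powr a) = (norm (x - y) / s) powr a"
    using assms by (simp add: powr_divide powr_minus field_simps)
  ultimately show ?thesis by (simp add: mult_ac)
qed

lemma regularized_measurable:
  assumes "s1 > 0" "s2 > 0" and [measurable]: "F \<in> borel_measurable borel"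
  shows "regularized y1 y2 s1 s2 F p \<in> borel_measurable borel"
proof -
  have [measurable]: "(\<lambda>x. complex_of_real (norm (x - y1) / s1) powr fst p) \<in> borel_measurable borel"
    "(\<lambda>x. complex_of_real (norm (x - y2) / s2) powr snd p) \<in> borel_measurable borel"
    by (rule of_real_powr_measurable; use assms in auto)+
  show ?thesis unfolding regularized_def case_prod_unfold by measurable
qed

lemma exterior_measurable: "exterior y1 y2 s \<in> sets borel"
  unfolding exterior_def by (intro borel_open open_Compl closed_Un closed_cball)

text \<open>On a compact part the integrand is continuous. Far out it is bounded by a multiple of
  norm x powr (Re (\<alpha> + \<beta>) - 3 - \<epsilon>), and this exponent is below - 3 exactly
  under the condition on p.\<close>

lemma exterior_integrable:
  assumes s: "s > 0" and s1: "s1 > 0" and s2: "s2 > 0"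
    and cont: "continuous_on (- {y1, y2}) F"
    and O: "F \<in> O[at_infinity](\<lambda>x. norm x powr (- 3 - \<epsilon>))"
    and p: "Re (fst p + snd p) < \<epsilon>"
  shows "set_integrable lborel (exterior y1 y2 s) (regularized y1 y2 s1 s2 F p)"
proof -
  have Fm: "F \<in> borel_measurable borel" by (rule continuous_except_measurable[OF cont])
  note rm = regularized_measurable[OF s1 s2 Fm, of y1 y2 p]
  obtain c where c: "c > 0" "\<forall>\<^sub>F x in at_infinity. norm (F x) \<le> c * norm (norm x powr (- 3 - \<epsilon>))"
    using O by (rule landau_o.bigE)
  then obtain b where b: "\<And>x. norm x \<ge> b \<Longrightarrow> \<bar>F x\<bar> \<le> c * norm x powr (- 3 - \<epsilon>)"
    unfolding eventually_at_infinity by auto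
  \<comment> \<open>Beyond the threshold \<open>b\<close> for the decay of \<open>F\<close> and
    beyond twice the norms of both singular points.\<close>
  define R where "R = \<bar>b\<bar> + 2 * norm y1 + 2 * norm y2 + 1"
  have R: "R > 0" "R \<ge> b" "R \<ge> 2 * norm y1" "R \<ge> 2 * norm y2"
    unfolding R_def using norm_ge_zero[of y1] norm_ge_zero[of y2] by linarith+
  \<comment> \<open>Open balls are removed, to obtain a compact set; it contains the bounded part of
    the exterior and still avoids both singular points.\<close>
  define K where "K = cball 0 R - (ball y1 s \<union> ball y2 s)"
  have "compact K" unfolding K_def by (intro compact_diff open_Un) auto
  moreover have "continuous_on K (regularized y1 y2 s1 s2 F p)"
  proof -
    have K: "norm (x - y1) \<noteq> 0" "norm (x - y2) \<noteq> 0" if "x \<in> K" for x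
      using that s by (auto simp: K_def)
    have cF: "continuous_on K F" by (rule continuous_on_subset[OF cont]) (use s in \<open>auto simp: K_def\<close>)
    have c12: "continuous_on K (\<lambda>x. complex_of_real (norm (x - y1) / s1) powr fst p)"
      "continuous_on K (\<lambda>x. complex_of_real (norm (x - y2) / s2) powr snd p)"
      using K s1 s2
      by (auto intro!: continuous_on_compose2[OF continuous_on_of_real_powr] continuous_intros)
    show ?thesis
      unfolding regularized_def case_prod_unfold
      by (rule continuous_on_mult[OF continuous_on_mult[OF c12] continuous_on_of_real[OF cF]])
  qed
  ultimately have "set_integrable lborel K (regularized y1 y2 s1 s2 F p)"
    unfolding set_integrable_def by (rule borel_integrable_compact)
  hence near: "set_integrable lborel (exterior y1 y2 s \<inter> cball 0 R) (regularized y1 y2 s1 s2 F p)"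
    by (rule set_integrable_subset) (use exterior_measurable in \<open>auto simp: K_def exterior_def\<close>)
  define u v where "u = Re (fst p)" and "v = Re (snd p)"
  define w where "w = u + v - 3 - \<epsilon>"
  have w: "w < - 3" using p by (simp add: w_def u_def v_def)
  define C where "C = (2 powr \<bar>u\<bar> * s1 powr (- u)) * (2 powr \<bar>v\<bar> * s2 powr (- v)) * c"
  have "set_integrable lborel {x :: real ^ 3. R < norm x} (\<lambda>x. C * norm x powr w)"
    by (rule set_integrable_mult_right, rule tail_integrable_powr) (use w R in auto)
  moreover have "set_borel_measurable lborel {x :: real ^ 3. R < norm x} (regularized y1 y2 s1 s2 F p)"
  proof -
    have [measurable]: "{x :: real ^ 3. R < norm x} \<in> sets borel"
      by (intro borel_open open_Collect_less continuous_intros)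
    note rm[measurable]
    show ?thesis unfolding set_borel_measurable_def by measurable
  qed
  ultimately have far: "set_integrable lborel {x :: real ^ 3. R < norm x} (regularized y1 y2 s1 s2 F p)"
  proof (rule set_integrable_bound, intro AE_I2 impI)
    fix x :: "real ^ 3" assume "x \<in> {x. R < norm x}"
    hence x: "norm x > R" "norm x > 0" using R by auto
    have "cmod (regularized y1 y2 s1 s2 F p x) = (norm (x - y1) / s1) powr u * (norm (x - y2) / s2) powr v * \<bar>F x\<bar>"
      using s1 s2 norm_of_real_powr[of "norm (x - y1) / s1" "fst p"] norm_of_real_powr[of "norm (x - y2) / s2" "snd p"]
      unfolding regularized_def case_prod_unfold norm_mult u_def v_def by simp
    also have "\<dots> \<le> (2 powr \<bar>u\<bar> * s1 powr (- u) * norm x powr u) * (2 powr \<bar>v\<bar> * s2 powr (- v) * norm x powr v) * (c * norm x powr (- 3 - \<epsilon>))"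
      using x R s1 s2 by (intro mult_mono norm_diff_powr_bound b) auto
    also have "\<dots> = C * (norm x powr u * norm x powr v * norm x powr (- 3 - \<epsilon>))" by (simp add: C_def mult_ac)
    also have "norm x powr u * norm x powr v * norm x powr (- 3 - \<epsilon>) = norm x powr w"
      by (simp only: powr_add[symmetric] w_def) (simp add: algebra_simps)
    finally have "cmod (regularized y1 y2 s1 s2 F p x) \<le> C * norm x powr w" .
    thus "cmod (regularized y1 y2 s1 s2 F p x) \<le> norm (C * norm x powr w)" by simp
  qed
  have ms: "exterior y1 y2 s \<inter> cball 0 R \<in> sets lborel" "{x :: real ^ 3. R < norm x} \<in> sets lborel"
    using exterior_measurable by (auto intro!: borel_open open_Collect_less continuous_intros)
  have "set_integrable lborel ((exterior y1 y2 s \<inter> cball 0 R) \<union> {x. R < norm x}) (regularized y1 y2 s1 s2 F p)"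
    by (rule set_integrable_Un[OF near far ms])
  thus ?thesis by (rule set_integrable_subset) (use exterior_measurable in auto)
qed

text \<open>Outside the balls neither base is 0. At a singular point itself the equation could fail,
  since 0 powr 0 is 0.\<close>

lemma regularized_0:
  assumes "s > 0" "s1 > 0" "s2 > 0" "x \<in> exterior y1 y2 s"
  shows "regularized y1 y2 s1 s2 F (0, 0) x = of_real (F x)"
proof -
  have "norm (x - y1) / s1 \<noteq> 0" "norm (x - y2) / s2 \<noteq> 0"
    using assms by (auto simp: exterior_def)
  hence "complex_of_real (norm (x - y1) / s1) \<noteq> 0" "complex_of_real (norm (x - y2) / s2) \<noteq> 0"
    unfolding of_real_eq_0_iff .
  thus ?thesis unfolding regularized_def by simp
qed

lemma exterior_integrable_0:
  assumes s: "s > 0" and cont: "continuous_on (- {y1, y2}) F" and "\<epsilon> > 0"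
    and O: "F \<in> O[at_infinity](\<lambda>x. norm x powr (- 3 - \<epsilon>))"
  shows "set_integrable lborel (exterior y1 y2 s) F"
proof -
  have "set_integrable lborel (exterior y1 y2 s) (regularized y1 y2 1 1 F (0, 0))"
    by (rule exterior_integrable[OF s _ _ cont O]) (use assms in auto)
  moreover have "set_integrable lborel (exterior y1 y2 s) (regularized y1 y2 1 1 F (0, 0))
      \<longleftrightarrow> set_integrable lborel (exterior y1 y2 s) (\<lambda>x. complex_of_real (F x))"
    by (rule set_integrable_cong_strong) (use regularized_0[OF s] in auto)
  ultimately have "integrable lborel (\<lambda>x. complex_of_real (indicator (exterior y1 y2 s) x *\<^sub>R F x))"
    unfolding set_integrable_def by (simp add: scaleR_conv_of_real)
  thus ?thesis unfolding set_integrable_def complex_of_real_integrable_eq .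
qed

text \<open>As a function of both exponents the integrand is the exponential of a linear form times
  a fixed factor. It is integrable at each point of an open region, so the domination by shifted
  exponents gives holomorphy.\<close>

lemma exterior_integral_holomorphic:
  assumes s: "s > 0" and s1: "s1 > 0" and s2: "s2 > 0"
    and cont: "continuous_on (- {y1, y2}) F"
    and O: "F \<in> O[at_infinity](\<lambda>x. norm x powr (- 3 - \<epsilon>))"
  shows "holomorphic2_on (\<lambda>p. LINT x:exterior y1 y2 s|lborel. regularized y1 y2 s1 s2 F p x) {p. Re (fst p + snd p) < \<epsilon>}"
proof -
  define W where "W x = indicator (exterior y1 y2 s) x *\<^sub>R complex_of_real (F x)" for x
  have eq: "indicator (exterior y1 y2 s) x *\<^sub>R regularized y1 y2 s1 s2 F p x
     = exp (fst p * of_real (ln (norm (x - y1) / s1)) + snd p * of_real (ln (norm (x - y2) / s2))) * W x" for p x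
  proof (cases "x \<in> exterior y1 y2 s")
    case True
    hence "norm (x - y1) > s" "norm (x - y2) > s"
      by (auto simp: exterior_def dist_norm norm_minus_commute)
    hence "norm (x - y1) / s1 > 0" "norm (x - y2) / s2 > 0"
      using s s1 s2 by (auto intro!: divide_pos_pos simp del: zero_less_norm_iff)
    thus ?thesis using True
      unfolding regularized_def case_prod_unfold by (simp only: of_real_powr_eq_exp exp_add W_def) simp
  qed (simp add: W_def)
  have "holomorphic2_on (\<lambda>p. \<integral>x. exp (fst p * of_real (ln (norm (x - y1) / s1)) + snd p * of_real (ln (norm (x - y2) / s2))) * W x \<partial>lborel)
      {p. Re (fst p + snd p) < \<epsilon>}"
  proof (rule holomorphic2_on_integral_exp)
    show "open {p :: complex \<times> complex. Re (fst p + snd p) < \<epsilon>}"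
      by (intro open_Collect_less continuous_intros)
    fix p :: "complex \<times> complex" assume "p \<in> {p. Re (fst p + snd p) < \<epsilon>}"
    hence "set_integrable lborel (exterior y1 y2 s) (regularized y1 y2 s1 s2 F p)"
      by (intro exterior_integrable[OF s s1 s2 cont O]) simp
    thus "integrable lborel (\<lambda>x. exp (fst p * of_real (ln (norm (x - y1) / s1)) + snd p * of_real (ln (norm (x - y2) / s2))) * W x)"
      unfolding set_integrable_def eq .
  qed
  thus ?thesis unfolding set_lebesgue_integral_def eq .
qed

section \<open>Exchange of the two singular points\<close>

lemma regularized_swap: "regularized y2 y1 s2 s1 F (prod.swap p) = regularized y1 y2 s1 s2 F p"
  by (cases p) (auto simp: regularized_def fun_eq_iff)

lemma continues_integral_swap:
  assumes "continues_integral g S R q J"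
  shows "continues_integral (\<lambda>p. g (prod.swap p)) S (prod.swap -` R) (\<lambda>p. q (prod.swap p)) (\<lambda>p. J (prod.swap p))"
proof -
  obtain D \<delta> H where D: "open D" "connected D" "R \<subseteq> D" "holomorphic2_on J D"
    and JR: "\<forall>p\<in>R. J p = (LINT x:S|lborel. g p x)" and \<delta>: "\<delta> > 0" "{p \<in> ball 0 \<delta>. q p \<noteq> 0} \<subseteq> D"
    and H: "holomorphic2_on H (ball 0 \<delta>)" "\<forall>p\<in>ball 0 \<delta>. q p \<noteq> 0 \<longrightarrow> q p * J p = H p"
    and int: "\<forall>p\<in>R. set_integrable lborel S (g p)"
    using assms unfolding continues_integral_def continuation_near_0_def by blast
  have sw: "prod.swap -` D = prod.swap ` D"
    by (auto simp: image_iff) (metis swap_simp)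
  have cs: "continuous_on A (prod.swap :: complex \<times> complex \<Rightarrow> _)" for A
    unfolding prod.swap_def by (intro continuous_intros)
  have "open (prod.swap -` D)" by (rule open_vimage[OF D(1) cs])
  moreover have "connected (prod.swap -` D)" unfolding sw by (rule connected_continuous_image[OF cs D(2)])
  moreover have "prod.swap -` R \<subseteq> prod.swap -` D" using D(3) by auto
  moreover have "holomorphic2_on (\<lambda>p. J (prod.swap p)) (prod.swap -` D)" by (rule holomorphic2_on_swap[OF D(4)])
  moreover have "{p \<in> ball 0 \<delta>. q (prod.swap p) \<noteq> 0} \<subseteq> prod.swap -` D"
    using \<delta>(2) mem_swap_ball by blast
  moreover have "holomorphic2_on (\<lambda>p. H (prod.swap p)) (ball 0 \<delta>)" by (rule holomorphic2_on_swap_ball[OF H(1)])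
  moreover have "\<forall>p\<in>ball 0 \<delta>. q (prod.swap p) \<noteq> 0 \<longrightarrow> q (prod.swap p) * J (prod.swap p) = H (prod.swap p)"
    using H(2) mem_swap_ball by blast
  moreover have "\<forall>p\<in>prod.swap -` R. J (prod.swap p) = (LINT x:S|lborel. g (prod.swap p) x)"
    using JR by blast
  ultimately have "continuation_near_0 (\<lambda>p. LINT x:S|lborel. g (prod.swap p) x) (prod.swap -` R) (\<lambda>p. q (prod.swap p)) (\<lambda>p. J (prod.swap p))"
    unfolding continuation_near_0_def using \<delta>(1) by blast
  thus ?thesis unfolding continues_integral_def using int by blast
qed

lemma swap_half_spaces:
  "prod.swap -` {(\<alpha>, \<beta>). Re \<alpha> > c} = {(\<alpha>, \<beta>). Re \<beta> > c}"
  "prod.swap -` {(\<alpha>, \<beta>). Re \<beta> > c} = {(\<alpha>, \<beta>). Re \<alpha> > c}"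
  by auto

text \<open>Through this equivalence the results for the ball around y1 apply to the ball around y2,
  with the points, the scales and the two exponents exchanged.\<close>

lemma continues_integral_swap_regularized:
  "continues_integral (regularized y1 y2 s1 s2 F) S {(\<alpha>, \<beta>). Re \<beta> > c} snd J \<longleftrightarrow>
   continues_integral (regularized y2 y1 s2 s1 F) S {(\<alpha>, \<beta>). Re \<alpha> > c} fst (\<lambda>p. J (prod.swap p))"
proof
  assume "continues_integral (regularized y1 y2 s1 s2 F) S {(\<alpha>, \<beta>). Re \<beta> > c} snd J"
  from continues_integral_swap[OF this]
  show "continues_integral (regularized y2 y1 s2 s1 F) S {(\<alpha>, \<beta>). Re \<alpha> > c} fst (\<lambda>p. J (prod.swap p))"
    unfolding swap_half_spaces regularized_swap snd_swap .
next
  assume "continues_integral (regularized y2 y1 s2 s1 F) S {(\<alpha>, \<beta>). Re \<alpha> > c} fst (\<lambda>p. J (prod.swap p))"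
  from continues_integral_swap[OF this]
  show "continues_integral (regularized y1 y2 s1 s2 F) S {(\<alpha>, \<beta>). Re \<beta> > c} snd J"
    unfolding swap_half_spaces regularized_swap fst_swap swap_swap .
qed

text \<open>The integral converges on a convex region around the origin and is its own continuation.
  In the ball of radius \<epsilon> / 2 both real parts are below \<epsilon> / 2.\<close>

lemma exterior_continuation_exists:
  assumes s: "s > 0" and s1: "s1 > 0" and s2: "s2 > 0" and \<epsilon>: "\<epsilon> > 0"
    and cont: "continuous_on (- {y1, y2}) F"
    and O: "F \<in> O[at_infinity](\<lambda>x. norm x powr (- 3 - \<epsilon>))"
  shows "\<exists>J. continues_integral (regularized y1 y2 s1 s2 F) (exterior y1 y2 s) {(\<alpha>, \<beta>). Re (\<alpha> + \<beta>) < \<epsilon>} (\<lambda>_. 1) J"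
    and "ball 0 (\<epsilon> / 2) \<subseteq> {(\<alpha> :: complex, \<beta> :: complex). Re (\<alpha> + \<beta>) < \<epsilon>}"
proof -
  define R where "R = {(\<alpha> :: complex, \<beta> :: complex). Re (\<alpha> + \<beta>) < \<epsilon>}"
  have R: "R = {p. Re (fst p + snd p) < \<epsilon>}" by (auto simp: R_def)
  define J where "J p = (LINT x:exterior y1 y2 s|lborel. regularized y1 y2 s1 s2 F p x)" for p
  have J: "holomorphic2_on J R"
    unfolding J_def R by (rule exterior_integral_holomorphic[OF s s1 s2 cont O])
  have oR: "open R" unfolding R by (intro open_Collect_less continuous_intros)
  have "convex R"
    unfolding R convex_alt
  proof (intro ballI allI impI)
    fix p q :: "complex \<times> complex" and u :: real
    assume p: "p \<in> {p. Re (fst p + snd p) < \<epsilon>}" and q: "q \<in> {p. Re (fst p + snd p) < \<epsilon>}" and u: "0 \<le> u \<and> u \<le> 1"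
    have "(1 - u) * Re (fst p + snd p) + u * Re (fst q + snd q) < \<epsilon>"
      using p q u by (intro convex_bound_lt) auto
    thus "(1 - u) *\<^sub>R p + u *\<^sub>R q \<in> {p. Re (fst p + snd p) < \<epsilon>}" by (simp add: algebra_simps)
  qed
  hence cR: "connected R" by (rule convex_connected)
  have "ball 0 (\<epsilon> / 2) \<subseteq> R"
  proof
    fix p :: "complex \<times> complex" assume "p \<in> ball 0 (\<epsilon> / 2)"
    hence "cmod (fst p) < \<epsilon> / 2" "cmod (snd p) < \<epsilon> / 2"
      using norm_fst_le[of "fst p" "snd p"] norm_snd_le[of "snd p" "fst p"] by auto
    thus "p \<in> R" using complex_Re_le_cmod[of "fst p"] complex_Re_le_cmod[of "snd p"] by (simp add: R)
  qed
  thus ballR: "ball 0 (\<epsilon> / 2) \<subseteq> {(\<alpha> :: complex, \<beta> :: complex). Re (\<alpha> + \<beta>) < \<epsilon>}" unfolding R_def .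
  have "continuation_near_0 (\<lambda>p. LINT x:exterior y1 y2 s|lborel. regularized y1 y2 s1 s2 F p x) R (\<lambda>_. 1) J"
    unfolding continuation_near_0_def
    using oR cR J ballR \<epsilon> holomorphic2_on_subset[OF J, of "ball 0 (\<epsilon> / 2)"]
    by (intro exI[of _ R] exI[of _ "\<epsilon> / 2"] exI[of _ J]) (auto simp: J_def R_def)
  moreover have "set_integrable lborel (exterior y1 y2 s) (regularized y1 y2 s1 s2 F p)" if "p \<in> R" for p
    by (rule exterior_integrable[OF s s1 s2 cont O]) (use that in \<open>simp add: R\<close>)
  ultimately show "\<exists>J. continues_integral (regularized y1 y2 s1 s2 F) (exterior y1 y2 s) {(\<alpha>, \<beta>). Re (\<alpha> + \<beta>) < \<epsilon>} (\<lambda>_. 1) J"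
    unfolding continues_integral_def R_def by blast
qed

section \<open>Assembly of the exterior and the two balls\<close>

lemma exterior_split:
  assumes t: "0 < t" "t \<le> s" and disj: "cball y1 s \<inter> cball y2 s = {}"
    and int: "set_integrable lborel (exterior y1 y2 t) F"
  shows "(LINT x:exterior y1 y2 t|lborel. F x) = (LINT x:exterior y1 y2 s|lborel. F x)
     + (LINT x:cball y1 s - cball y1 t|lborel. F x) + (LINT x:cball y2 s - cball y2 t|lborel. F x :: real)"
proof -
  have sub: "cball y1 t \<subseteq> cball y1 s" "cball y2 t \<subseteq> cball y2 s" using t by (auto simp: subset_cball)
  have eq: "exterior y1 y2 t = (exterior y1 y2 s \<union> (cball y1 s - cball y1 t)) \<union> (cball y2 s - cball y2 t)"
    unfolding exterior_def using sub disj by blast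
  have m: "set_integrable lborel A F" if "A \<subseteq> exterior y1 y2 t" "A \<in> sets borel" for A
    by (rule set_integrable_subset[OF int]) (use that in auto)
  have ms: "exterior y1 y2 s \<in> sets borel" "cball y1 s - cball y1 t \<in> sets borel" "cball y2 s - cball y2 t \<in> sets borel"
    using exterior_measurable by auto
  have 1: "set_integrable lborel (exterior y1 y2 s) F" "set_integrable lborel (cball y1 s - cball y1 t) F" "set_integrable lborel (cball y2 s - cball y2 t) F"
    "set_integrable lborel (exterior y1 y2 s \<union> (cball y1 s - cball y1 t)) F"
    using ms by (auto intro!: m simp: eq)
  have d: "exterior y1 y2 s \<inter> (cball y1 s - cball y1 t) = {}"
    "(exterior y1 y2 s \<union> (cball y1 s - cball y1 t)) \<inter> (cball y2 s - cball y2 t) = {}"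
    unfolding exterior_def using disj by blast+
  show ?thesis
    unfolding eq set_integral_Un[OF d(2) 1(4) 1(3)] set_integral_Un[OF d(1) 1(1) 1(2)] ..
qed

lemma disjoint_cballs_less:
  fixes y1 y2 :: "real ^ 3"
  assumes "s > 0" "cball y1 s \<inter> cball y2 s = {}"
  shows "s < norm (y1 - y2)"
proof (rule ccontr)
  assume "\<not> s < norm (y1 - y2)"
  hence "y2 \<in> cball y1 s \<inter> cball y2 s" using assms(1) by (simp add: dist_norm)
  thus False using assms(2) by blast
qed

text \<open>The exterior at radius t is the exterior at a fixed radius s together with two shells,
  so the limit splits into a constant and one limit at each singular point.\<close>

lemma Pf_limit:
  assumes s: "s > 0" and disj: "cball y1 s \<inter> cball y2 s = {}" and s1: "s1 > 0" and s2: "s2 > 0" and \<epsilon>: "\<epsilon> > 0"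
    and cont: "continuous_on (- {y1, y2}) F"
    and O: "F \<in> O[at_infinity](\<lambda>x. norm x powr (- 3 - \<epsilon>))"
    and e1: "singular_expansion F y1 a f1" and e2: "singular_expansion F y2 b f2"
  shows "((\<lambda>t. (LINT x:exterior y1 y2 t|lborel. F x) + Pf_counterterm a f1 s1 t + Pf_counterterm b f2 s2 t) \<longlongrightarrow>
     (LINT x:exterior y1 y2 s|lborel. F x) + ball_FP F y1 s s1 (coeff_list a f1 M1) + ball_FP F y2 s s2 (coeff_list b f2 M2)) (at_right 0)"
proof -
  have sl: "s < norm (y1 - y2)" by (rule disjoint_cballs_less[OF s disj])
  hence sl': "s < norm (y2 - y1)" by (simp add: norm_minus_commute)
  have cont': "continuous_on (- {y2, y1}) F" using cont by (simp add: insert_commute)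
  have "((\<lambda>t. (LINT x:exterior y1 y2 s|lborel. F x) + ((LINT x:cball y1 s - cball y1 t|lborel. F x) + Pf_counterterm a f1 s1 t)
      + ((LINT x:cball y2 s - cball y2 t|lborel. F x) + Pf_counterterm b f2 s2 t)) \<longlongrightarrow>
     (LINT x:exterior y1 y2 s|lborel. F x) + ball_FP F y1 s s1 (coeff_list a f1 M1) + ball_FP F y2 s s2 (coeff_list b f2 M2)) (at_right 0)"
    by (intro tendsto_add tendsto_const ball_FP_limit[OF s sl s1 cont e1] ball_FP_limit[OF s sl' s2 cont' e2])
  moreover have "\<forall>\<^sub>F t in at_right 0. (LINT x:exterior y1 y2 s|lborel. F x) + ((LINT x:cball y1 s - cball y1 t|lborel. F x) + Pf_counterterm a f1 s1 t)
      + ((LINT x:cball y2 s - cball y2 t|lborel. F x) + Pf_counterterm b f2 s2 t)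
      = (LINT x:exterior y1 y2 t|lborel. F x) + Pf_counterterm a f1 s1 t + Pf_counterterm b f2 s2 t"
    unfolding eventually_at_right_field
  proof (intro exI[of _ s] conjI allI impI s)
    fix t assume t: "0 < t" "t < s"
    show "(LINT x:exterior y1 y2 s|lborel. F x) + ((LINT x:cball y1 s - cball y1 t|lborel. F x) + Pf_counterterm a f1 s1 t)
      + ((LINT x:cball y2 s - cball y2 t|lborel. F x) + Pf_counterterm b f2 s2 t)
      = (LINT x:exterior y1 y2 t|lborel. F x) + Pf_counterterm a f1 s1 t + Pf_counterterm b f2 s2 t"
      using exterior_split[OF t(1) less_imp_le[OF t(2)] disj exterior_integrable_0[OF t(1) cont \<epsilon> O]] by simp
  qed
  ultimately show ?thesis by (rule Lim_transform_eventually)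
qed

text \<open>The orders M1 and M2 depend on the continuations that make up \<open>I\<close>. The
  value is bound to c so as to be written once for both iterated finite parts.\<close>

lemma regularized_integral_FP:
  assumes yy: "y1 \<noteq> y2" and s: "s > 0" and disj: "cball y1 s \<inter> cball y2 s = {}"
    and s1: "s1 > 0" and s2: "s2 > 0" and \<epsilon>: "\<epsilon> > 0"
    and cont: "continuous_on (- {y1, y2}) F"
    and O: "F \<in> O[at_infinity](\<lambda>x. norm x powr (- 3 - \<epsilon>))"
    and e1: "singular_expansion F y1 a f1" and e2: "singular_expansion F y2 b f2"
    and I: "regularized_integral y1 y2 (a 0) (b 0) \<epsilon> s1 s2 F s I"
  shows "\<exists>M1 M2. \<forall>c. c = complex_of_real ((LINT x:exterior y1 y2 s|lborel. F x) + ball_FP F y1 s s1 (coeff_list a f1 M1)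
      + ball_FP F y2 s s2 (coeff_list b f2 M2)) \<longrightarrow>
    has_iterated_FP (\<lambda>\<beta> \<alpha>. I (\<alpha>, \<beta>)) c \<and> has_iterated_FP (\<lambda>\<alpha> \<beta>. I (\<alpha>, \<beta>)) c"
proof -
  have sl: "s < norm (y1 - y2)" by (rule disjoint_cballs_less[OF s disj])
  hence sl': "s < norm (y2 - y1)" by (simp add: norm_minus_commute)
  have cont': "continuous_on (- {y2, y1}) F" using cont by (simp add: insert_commute)
  have yy': "y2 \<noteq> y1" using yy by simp
  define R3 where "R3 = {(\<alpha> :: complex, \<beta> :: complex). Re (\<alpha> + \<beta>) < \<epsilon>}"
  obtain J1 J2 J3 where J1: "continues_integral (regularized y1 y2 s1 s2 F) (cball y1 s) {(\<alpha>, \<beta>). Re \<alpha> > - a 0 - 3} fst J1"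
    and J2: "continues_integral (regularized y1 y2 s1 s2 F) (cball y2 s) {(\<alpha>, \<beta>). Re \<beta> > - b 0 - 3} snd J2"
    and J3: "continues_integral (regularized y1 y2 s1 s2 F) (exterior y1 y2 s) R3 (\<lambda>_. 1) J3"
    and Isum: "\<And>p. I p = J1 p + J2 p + J3 p"
    using I unfolding regularized_integral_def R3_def by blast
  obtain \<delta>1 H1 M1 where H1: "\<delta>1 > 0" "holomorphic2_on H1 (ball 0 \<delta>1)" "\<forall>p\<in>ball 0 \<delta>1. fst p \<noteq> 0 \<longrightarrow> fst p * J1 p = H1 p"
    "deriv (\<lambda>\<alpha>. H1 (\<alpha>, 0)) 0 = of_real (ball_FP F y1 s s1 (coeff_list a f1 M1))"
    using continues_integral_FP[OF yy s sl s1 s2 cont e1 J1] by blast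
  obtain \<delta>2 K2 M2 where K2: "\<delta>2 > 0" "holomorphic2_on K2 (ball 0 \<delta>2)" "\<forall>p\<in>ball 0 \<delta>2. fst p \<noteq> 0 \<longrightarrow> fst p * J2 (prod.swap p) = K2 p"
    "deriv (\<lambda>\<alpha>. K2 (\<alpha>, 0)) 0 = of_real (ball_FP F y2 s s2 (coeff_list b f2 M2))"
    using continues_integral_FP[OF yy' s sl' s2 s1 cont' e2 J2[unfolded continues_integral_swap_regularized]] by blast
  define H2 where "H2 p = K2 (prod.swap p)" for p
  have H2: "holomorphic2_on H2 (ball 0 \<delta>2)" unfolding H2_def by (rule holomorphic2_on_swap_ball[OF K2(2)])
  obtain D where D: "R3 \<subseteq> D" "holomorphic2_on J3 D" and J3R: "\<forall>p\<in>R3. J3 p = (LINT x:exterior y1 y2 s|lborel. regularized y1 y2 s1 s2 F p x)"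
    using J3 unfolding continues_integral_def continuation_near_0_def by blast
  have ball3: "ball 0 (\<epsilon> / 2) \<subseteq> R3"
    unfolding R3_def by (rule exterior_continuation_exists(2)[OF s s1 s2 \<epsilon> cont O])
  have "J3 (0, 0) = (LINT x:exterior y1 y2 s|lborel. regularized y1 y2 s1 s2 F (0, 0) x)"
    using J3R \<epsilon> by (simp add: R3_def)
  also have "\<dots> = (LINT x:exterior y1 y2 s|lborel. complex_of_real (F x))"
    by (rule set_lebesgue_integral_cong_strong) (rule regularized_0[OF s s1 s2])
  also have "\<dots> = (\<integral>x. complex_of_real (indicator (exterior y1 y2 s) x *\<^sub>R F x) \<partial>lborel)"
    by (simp add: set_lebesgue_integral_def scaleR_conv_of_real)
  also have "\<dots> = of_real (LINT x:exterior y1 y2 s|lborel. F x)"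
    unfolding set_lebesgue_integral_def by (rule integral_complex_of_real)
  finally have J30: "J3 (0, 0) = of_real (LINT x:exterior y1 y2 s|lborel. F x)" .
  define \<delta> where "\<delta> = min \<delta>1 (min \<delta>2 (\<epsilon> / 2))"
  have \<delta>: "\<delta> > 0" using H1(1) K2(1) \<epsilon> by (simp add: \<delta>_def)
  have sub: "ball 0 \<delta> \<subseteq> ball (0 :: complex \<times> complex) \<delta>1" "ball 0 \<delta> \<subseteq> ball (0 :: complex \<times> complex) \<delta>2"
    "ball 0 \<delta> \<subseteq> ball (0 :: complex \<times> complex) (\<epsilon> / 2)"
    by (auto simp: \<delta>_def)
  have A1: "\<alpha> * J1 (\<alpha>, \<beta>) = H1 (\<alpha>, \<beta>)" if "(\<alpha>, \<beta>) \<in> ball 0 \<delta>" "\<alpha> \<noteq> 0" for \<alpha> \<beta>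
    using H1(3) that sub(1) by fastforce
  have A2: "\<beta> * J2 (\<alpha>, \<beta>) = H2 (\<alpha>, \<beta>)" if "(\<alpha>, \<beta>) \<in> ball 0 \<delta>" "\<beta> \<noteq> 0" for \<alpha> \<beta>
  proof -
    have "(\<alpha>, \<beta>) \<in> ball 0 \<delta>2" using that(1) sub(2) by blast
    hence "prod.swap (\<alpha>, \<beta>) \<in> ball 0 \<delta>2" unfolding mem_swap_ball .
    thus ?thesis using K2(3) that(2) by (fastforce simp: H2_def)
  qed
  have h3: "holomorphic2_on J3 (ball 0 \<delta>)"
    by (rule holomorphic2_on_subset[OF D(2)]) (use sub(3) ball3 D(1) in blast)
  have d2: "deriv (\<lambda>\<beta>. H2 (0, \<beta>)) 0 = of_real (ball_FP F y2 s s2 (coeff_list b f2 M2))"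
    using K2(4) by (simp add: H2_def)
  note FP = has_iterated_FP_sum_both[OF \<delta> holomorphic2_on_subset[OF H1(2) sub(1)] holomorphic2_on_subset[OF H2 sub(2)] h3 A1 A2]
  show ?thesis
    using FP unfolding H1(4) d2 J30 Isum
    by (intro exI[of _ M1] exI[of _ M2]) (simp add: add_ac)
qed

theorem theorem2:
  fixes y1 y2 :: "real ^ 3" and F :: "real ^ 3 \<Rightarrow> real"
    and a b :: "nat \<Rightarrow> real" and f1 f2 :: "real \<Rightarrow> real ^ 3 \<Rightarrow> real"
    and \<epsilon> s1 s2 :: real
  assumes "y1 \<noteq> y2"
    and "class_F y1 y2 a f1 b f2 F"
    and "\<epsilon> > 0"
    and "F \<in> O[at_infinity](\<lambda>x. norm x powr (- 3 - \<epsilon>))"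
    and "s1 > 0" and "s2 > 0"
  shows "\<exists>L. has_Pf_integral y1 y2 a f1 b f2 s1 s2 F L \<and>
    (\<forall>s>0. cball y1 s \<inter> cball y2 s = {} \<longrightarrow>
       (\<exists>I. regularized_integral y1 y2 (a 0) (b 0) \<epsilon> s1 s2 F s I) \<and>
       (\<forall>I. regularized_integral y1 y2 (a 0) (b 0) \<epsilon> s1 s2 F s I \<longrightarrow>
          has_iterated_FP (\<lambda>\<beta> \<alpha>. I (\<alpha>, \<beta>)) (of_real L) \<and>
          has_iterated_FP (\<lambda>\<alpha> \<beta>. I (\<alpha>, \<beta>)) (of_real L)))"
proof -
  note yy = assms(1) and \<epsilon> = assms(3) and O = assms(4) and s1 = assms(5) and s2 = assms(6)
  have sm: "C_k_on 0 F (- {y1, y2})" and e1: "singular_expansion F y1 a f1" and e2: "singular_expansion F y2 b f2"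
    using assms(2) unfolding class_F_def smooth_on_def by blast+
  have cont: "continuous_on (- {y1, y2}) F" using sm by simp
  have cont': "continuous_on (- {y2, y1}) F" using cont by (simp add: insert_commute)
  define d where "d = norm (y1 - y2)"
  have d: "d > 0" using yy by (simp add: d_def)
  define P where "P t = (LINT x:exterior y1 y2 t|lborel. F x) + Pf_counterterm a f1 s1 t + Pf_counterterm b f2 s2 t" for t
  define V where "V s M1 M2 = (LINT x:exterior y1 y2 s|lborel. F x) + ball_FP F y1 s s1 (coeff_list a f1 M1)
      + ball_FP F y2 s s2 (coeff_list b f2 M2)" for s M1 M2
  have lim: "(P \<longlongrightarrow> V s M1 M2) (at_right 0)" if "s > 0" "cball y1 s \<inter> cball y2 s = {}" for s M1 M2
    unfolding P_def V_def by (rule Pf_limit[OF that s1 s2 \<epsilon> cont O e1 e2])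
  have disj: "cball y1 (d / 3) \<inter> cball y2 (d / 3) = {}"
  proof (rule ccontr)
    assume "cball y1 (d / 3) \<inter> cball y2 (d / 3) \<noteq> {}"
    then obtain x where "dist y1 x \<le> d / 3" "dist y2 x \<le> d / 3" by auto
    hence "dist y1 y2 \<le> d / 3 + d / 3" using dist_triangle2[of y1 y2 x] by linarith
    thus False using d by (simp add: d_def dist_norm)
  qed
  \<comment> \<open>One admissible radius, with both orders 0, serves to name the limit.\<close>
  define L where "L = V (d / 3) 0 0"
  have PL: "(P \<longlongrightarrow> L) (at_right 0)" unfolding L_def by (rule lim[OF _ disj]) (use d in simp)
  \<comment> \<open>A limit is unique, so \<open>V\<close> depends neither on the radius nor on the
    orders. This removes the dependence of the finite parts on the chosen continuation.\<close>
  have VL: "V s M1 M2 = L" if "s > 0" "cball y1 s \<inter> cball y2 s = {}" for s M1 M2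
    by (rule tendsto_unique[OF _ lim[OF that] PL]) simp
  \<comment> \<open>Continuity of the coefficients gives the convergence of the solid angle
    integrals in the partie finie.\<close>
  have ca: "continuous_on (sphere 0 1) (f1 c)" for c
    by (rule expansion_coeff_continuous[OF e1 d])
       (rule continuous_on_subset[OF cont], auto simp: d_def dist_norm)
  have cb: "continuous_on (sphere 0 1) (f2 c)" for c
    by (rule expansion_coeff_continuous[OF e2 d])
       (rule continuous_on_subset[OF cont], auto simp: d_def dist_norm norm_minus_commute)
  have "has_Pf_integral y1 y2 a f1 b f2 s1 s2 F L"
    unfolding has_Pf_integral_def
    using exterior_integrable_0[OF _ cont \<epsilon> O] solid_angle_integrable_continuous[OF ca]
      solid_angle_integrable_continuous[OF cb] PL[unfolded P_def] by blast
  moreover have "(\<exists>I. regularized_integral y1 y2 (a 0) (b 0) \<epsilon> s1 s2 F s I)"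
    if s: "s > 0" and disj: "cball y1 s \<inter> cball y2 s = {}" for s
  proof -
    have sl: "s < norm (y1 - y2)" by (rule disjoint_cballs_less[OF s disj])
    hence sl': "s < norm (y2 - y1)" by (simp add: norm_minus_commute)
    obtain J1 where J1: "continues_integral (regularized y1 y2 s1 s2 F) (cball y1 s) {(\<alpha>, \<beta>). Re \<alpha> > - a 0 - 3} fst J1"
      using continues_integral_exists[OF yy s sl s1 s2 cont e1] by blast
    obtain K2 where K2: "continues_integral (regularized y2 y1 s2 s1 F) (cball y2 s) {(\<alpha>, \<beta>). Re \<alpha> > - b 0 - 3} fst K2"
      using continues_integral_exists[OF yy[symmetric] s sl' s2 s1 cont' e2] by blast
    define J2 where "J2 p = K2 (prod.swap p)" for p
    have J2: "continues_integral (regularized y1 y2 s1 s2 F) (cball y2 s) {(\<alpha>, \<beta>). Re \<beta> > - b 0 - 3} snd J2"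
      unfolding continues_integral_swap_regularized J2_def swap_swap using K2 by simp
    obtain J3 where J3: "continues_integral (regularized y1 y2 s1 s2 F) (exterior y1 y2 s) {(\<alpha>, \<beta>). Re (\<alpha> + \<beta>) < \<epsilon>} (\<lambda>_. 1) J3"
      using exterior_continuation_exists(1)[OF s s1 s2 \<epsilon> cont O] by blast
    show ?thesis unfolding regularized_integral_def
      using J1 J2 J3 by (intro exI[of _ "\<lambda>p. J1 p + J2 p + J3 p"] exI[of _ J1] exI[of _ J2] exI[of _ J3]) auto
  qed
  moreover have "has_iterated_FP (\<lambda>\<beta> \<alpha>. I (\<alpha>, \<beta>)) (of_real L) \<and> has_iterated_FP (\<lambda>\<alpha> \<beta>. I (\<alpha>, \<beta>)) (of_real L)"
    if s: "s > 0" and disj: "cball y1 s \<inter> cball y2 s = {}" and I: "regularized_integral y1 y2 (a 0) (b 0) \<epsilon> s1 s2 F s I" for s I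
    using regularized_integral_FP[OF yy s disj s1 s2 \<epsilon> cont O e1 e2 I] VL[OF s disj] unfolding V_def by auto
  ultimately show ?thesis by blast
qed

end
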